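(* The kernel of the $\mathbb Q$-algebra homomorphism $$\zeta^f:(\mathfrak H^1,* )\to\mathcal Z^f,\qquad z_{k_1}\cdots z_{k_r}\mapsto\zeta^f(k_1,\dots,k_r)$$ is the ideal of $(\mathfrak H^1,* )$ generated by all $w*v-w\,ш\,v$ with $w\in\mathfrak H^1$ and $v\in\mathfrak H^0$. (That is, the formal multiple zeta values, defined here as elements of a quotient of the algebra of formal multiple Eisenstein series, satisfy exactly the extended double shuffle relations.)
   Context: Formal multiple Eisenstein series. Let $\mathcal A=\{\left[{k\atop d}\right] : k\ge1,\ d\ge0\}$ be a set of letters indexed by pairs of integers, and let $\mathbb Q\langle\mathcal A\rangle$ be the free noncommutative $\mathbb Q$-algebra on $\mathcal A$. Its monic monomials are called words, $1$ is the empty word, and $\left[{k_1,\dots,k_r\atop d_1,\dots,d_r}\right]:=\left[{k_1\atop d_1}\right]\cdots\left[{k_r\atop d_r}\right]$. The stuffle product $*$ on $\mathbb Q\langle\mathcal A\rangle$ is the $\mathbb Q$-bilinear product with $1*w=w*1=w$ for words $w$ and $$\left[{k_1\atop d_1}\right]w*\left[{k_2\atop d_2}\right]v=\left[{k_1\atop d_1}\right]\Big(w*\left[{k_2\atop d_2}\right]v\Big)+\left[{k_2\atop d_2}\right]\Big(\left[{k_1\atop d_1}\right]w*v\Big)+\left[{k_1+k_2\atop d_1+d_2}\right](w*v)$$ for letters and words $w,v$; it makes $\mathbb Q\langle\mathcal A\rangle$ a commutative $\mathbb Q$-algebra. For $r\ge1$ put $$\mathfrak A_r\left({X_1,\dots,X_r\atop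 Y_1,\dots,Y_r}\right)=\sum_{k_i\ge1,\,d_i\ge0}\left[{k_1,\dots,k_r\atop d_1,\dots,d_r}\right]X_1^{k_1-1}\cdots X_r^{k_r-1}\frac{Y_1^{d_1}}{d_1!}\cdots\frac{Y_r^{d_r}}{d_r!}.$$ The swap $\sigma:\mathbb Q\langle\mathcal A\rangle\to\mathbb Q\langle\mathcal A\rangle$ is the $\mathbb Q$-linear map with $\sigma(1)=1$ such that $\sigma\left[{k_1,\dots,k_r\atop d_1,\dots,d_r}\right]$ is the coefficient of $X_1^{k_1-1}\cdots X_r^{k_r-1}\frac{Y_1^{d_1}}{d_1!}\cdots\frac{Y_r^{d_r}}{d_r!}$ in $\mathfrak A_r\left({Y_1+\dots+Y_r,\ \dots,\ Y_1+Y_2,\ Y_1\atop X_r,\ X_{r-1}-X_r,\ \dots,\ X_1-X_2}\right)$. Put $\mathcal G^f=(\mathbb Q\langle\mathcal A\rangle,* )/\mathcal I$, where $\mathcal I$ is the ideal of $(\mathbb Q\langle\mathcal A\rangle,* )$ generated by all $\sigma(w)-w$, $w\in\mathbb Q\langle\mathcal A\rangle$. The class of a word $w$ is denoted $G^f(w)$, and $G^f(k_1,\dots,k_r):=G^f\left(\left[{k_1,\dots,k_r\atop 0,\dots,0}\right]\right)$. Formal multiple zeta values. Let $\mathcal A_0=\{\left[{k\atop0}\right]:k\ge1\}$ and $\mathcal A^1=\{\left[{1\atop d}\right]:d\ge0\}$, and for an alphabet $\mathcal L$ let $\mathcal L^*$ be the free monoid of words in $\mathcal L$. Let $\mathfrak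 N$ be the ideal of $\mathcal G^f$ generated by the classes of the words in $\mathcal A^*\setminus\big((\mathcal A^1)^*(\mathcal A_0)^*\big)$. Set $\mathcal Z^f=\mathcal G^f/\mathfrak N$, let $\pi:\mathcal G^f\to\mathcal Z^f$ be the canonical projection, and $\zeta^f(k_1,\dots,k_r):=\pi(G^f(k_1,\dots,k_r))$ for $k_1,\dots,k_r\ge1$. Words in $z_k$. $\mathfrak H^1=\mathbb Q\langle z_k: k\ge1\rangle$ is the free noncommutative polynomial algebra, with stuffle product $*$ defined by $1*w=w*1=w$ and $z_iw*z_jv=z_i(w*z_jv)+z_j(z_iw*v)+z_{i+j}(w*v)$. $\mathfrak H^0\subset\mathfrak H^1$ is the span of the words (including the empty word) not starting in $z_1$. Via $z_k=x^{k-1}y$ one regards $\mathfrak H^1=\mathbb Q+\mathbb Q\langle x,y\rangle y$ as a subspace of $\mathbb Q\langle x,y\rangle$, closed under the usual shuffle product $ш$ of words in the two letters $x,y$. *)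

theory Defs
  imports Complex_Main "HOL-Algebra.QuotRing" "HOL-Library.Poly_Mapping" "HOL-Library.Product_Plus"
begin

section \<open>Noncommutative polynomials and the stuffle algebra\<close>

text \<open>
  A noncommutative polynomial over \<open>\<rat>\<close> is a finitely supported function from words (lists of
  letters) to \<open>\<rat>\<close>. Alphabets are sets of letters.
\<close>

type_synonym 'a ncpoly = "'a list \<Rightarrow>\<^sub>0 rat"

definition word :: "'a list \<Rightarrow> 'a ncpoly" where
  "word w = Poly_Mapping.single w 1"

definition scale :: "rat \<Rightarrow> ('b \<Rightarrow>\<^sub>0 rat) \<Rightarrow> ('b \<Rightarrow>\<^sub>0 rat)" where
  "scale c p = Poly_Mapping.map ((*) c) p"

definition lin_ext :: "('b \<Rightarrow> ('c \<Rightarrow>\<^sub>0 rat)) \<Rightarrow> ('b \<Rightarrow>\<^sub>0 rat) \<Rightarrow> ('c \<Rightarrow>\<^sub>0 rat)" where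
  "lin_ext f p = (\<Sum>w\<in>Poly_Mapping.keys p. scale (Poly_Mapping.lookup p w) (f w))"

definition bilin_ext ::
    "('a \<Rightarrow> 'b \<Rightarrow> ('c \<Rightarrow>\<^sub>0 rat)) \<Rightarrow> ('a \<Rightarrow>\<^sub>0 rat) \<Rightarrow> ('b \<Rightarrow>\<^sub>0 rat) \<Rightarrow> ('c \<Rightarrow>\<^sub>0 rat)" where
  "bilin_ext f p q = lin_ext (\<lambda>u. lin_ext (f u) q) p"

definition free_alg :: "'a set \<Rightarrow> 'a ncpoly set" where
  "free_alg A = {p. Poly_Mapping.keys p \<subseteq> lists A}"

definition lmul :: "'a \<Rightarrow> 'a ncpoly \<Rightarrow> 'a ncpoly" where
  "lmul a = lin_ext (\<lambda>w. word (a # w))"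

fun stuffle_word :: "'a::ab_semigroup_add list \<Rightarrow> 'a list \<Rightarrow> 'a ncpoly" where
  "stuffle_word [] v = word v"
| "stuffle_word (a # u) [] = word (a # u)"
| "stuffle_word (a # u) (b # v) =
     lmul a (stuffle_word u (b # v)) + lmul b (stuffle_word (a # u) v)
     + lmul (a + b) (stuffle_word u v)"

definition stuffle :: "'a::ab_semigroup_add ncpoly \<Rightarrow> 'a ncpoly \<Rightarrow> 'a ncpoly" where
  "stuffle = bilin_ext stuffle_word"

definition stuffle_alg :: "'a::ab_semigroup_add set \<Rightarrow> 'a ncpoly ring" where
  "stuffle_alg A =
     \<lparr>carrier = free_alg A, mult = stuffle, one = word [], zero = 0, add = (+)\<rparr>"


section \<open>The swap\<close>

text \<open>
  The pair \<open>(k, d)\<close> is the letter with upper entry \<open>k\<close> and lower entry \<open>d\<close>; the sum of two pairs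
  is componentwise.
\<close>

definition biletters :: "(nat \<times> nat) set" where
  "biletters = {(k, d). 1 \<le> k}"

definition biletters_0 :: "(nat \<times> nat) set" where
  "biletters_0 = {(k, d). 1 \<le> k \<and> d = 0}"

definition biletters_1 :: "(nat \<times> nat) set" where
  "biletters_1 = {(k, d). k = 1}"

abbreviation QA :: "(nat \<times> nat) ncpoly ring" where
  "QA \<equiv> stuffle_alg biletters"

datatype gvar = VX nat | VY nat

text \<open>Commutative polynomials over \<open>\<rat>\<close> in the variables \<open>X\<^sub>i\<close>, \<open>Y\<^sub>i\<close>.\<close>

type_synonym gmonom = "gvar \<Rightarrow>\<^sub>0 nat"
type_synonym gpoly = "gmonom \<Rightarrow>\<^sub>0 rat"

definition gvar_poly :: "gvar \<Rightarrow> gpoly" where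
  "gvar_poly v = Poly_Mapping.single (Poly_Mapping.single v 1) 1"

text \<open>
  \<open>gen_summand [(P\<^sub>1,Q\<^sub>1),\<dots>,(P\<^sub>r,Q\<^sub>r)] w\<close> is the commutative factor
  \<open>\<Prod>\<^sub>i P\<^sub>i\<^bsup>k\<^sub>i-1\<^esup> Q\<^sub>i\<^bsup>d\<^sub>i\<^esup> / d\<^sub>i!\<close> of the word \<open>w = [(k\<^sub>1,d\<^sub>1),\<dots>,(k\<^sub>r,d\<^sub>r)]\<close> in the
  generating series \<open>\<AA>\<^sub>r\<close> evaluated at upper arguments \<open>P\<^sub>i\<close> and lower arguments \<open>Q\<^sub>i\<close>.
\<close>

definition gen_summand :: "(gpoly \<times> gpoly) list \<Rightarrow> (nat \<times> nat) list \<Rightarrow> gpoly" where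
  "gen_summand PQ w =
     prod_list (map2 (\<lambda>(P, Q) (k, d). P ^ (k - 1) * Q ^ d * Poly_Mapping.single 0 (1 / fact d)) PQ w)"

text \<open>
  The coefficient of the monomial \<open>m\<close> in \<open>\<AA>\<^sub>r\<close> evaluated at the \<open>r\<close> pairs of arguments \<open>PQ\<close>. If all
  arguments are linear forms, only finitely many words contribute; see \<open>finite_swap_support\<close>.
\<close>

definition gen_coeff :: "(gpoly \<times> gpoly) list \<Rightarrow> gmonom \<Rightarrow> (nat \<times> nat) ncpoly" where
  "gen_coeff PQ m =
     (\<Sum>w | w \<in> lists biletters \<and> length w = length PQ \<and>
            Poly_Mapping.lookup (gen_summand PQ w) m \<noteq> 0.
        scale (Poly_Mapping.lookup (gen_summand PQ w) m) (word w))"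

text \<open>
  The \<open>j\<close>-th pair of arguments is
  \<open>(Y\<^sub>1 + \<dots> + Y\<^bsub>r+1-j\<^esub>, X\<^bsub>r+1-j\<^esub> - X\<^bsub>r+2-j\<^esub>)\<close> with the convention \<open>X\<^bsub>r+1\<^esub> = 0\<close>.
\<close>

definition swap_args :: "nat \<Rightarrow> (gpoly \<times> gpoly) list" where
  "swap_args r =
     map (\<lambda>j. (\<Sum>i=1..r + 1 - j. gvar_poly (VY i),
               if j = 1 then gvar_poly (VX r)
               else gvar_poly (VX (r + 1 - j)) - gvar_poly (VX (r + 2 - j)))) [1..<r + 1]"

text \<open>The monomial \<open>X\<^sub>1\<^bsup>k\<^sub>1-1\<^esup> \<cdots> X\<^sub>r\<^bsup>k\<^sub>r-1\<^esup> Y\<^sub>1\<^bsup>d\<^sub>1\<^esup> \<cdots> Y\<^sub>r\<^bsup>d\<^sub>r\<^esup>\<close>.\<close>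

definition word_monom :: "(nat \<times> nat) list \<Rightarrow> gmonom" where
  "word_monom w =
     (\<Sum>i=1..length w. Poly_Mapping.single (VX i) (fst (w ! (i - 1)) - 1)
                     + Poly_Mapping.single (VY i) (snd (w ! (i - 1))))"

text \<open>
  The factor \<open>d\<^sub>1! \<cdots> d\<^sub>r!\<close> appears because coefficients are taken with respect to
  \<open>X\<^sub>1\<^bsup>k\<^sub>1-1\<^esup> \<cdots> X\<^sub>r\<^bsup>k\<^sub>r-1\<^esup> Y\<^sub>1\<^bsup>d\<^sub>1\<^esup>/d\<^sub>1! \<cdots> Y\<^sub>r\<^bsup>d\<^sub>r\<^esup>/d\<^sub>r!\<close>.
\<close>

definition swap_word :: "(nat \<times> nat) list \<Rightarrow> (nat \<times> nat) ncpoly" where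
  "swap_word w =
     scale (\<Prod>(k, d)\<leftarrow>w. fact d) (gen_coeff (swap_args (length w)) (word_monom w))"

definition swap :: "(nat \<times> nat) ncpoly \<Rightarrow> (nat \<times> nat) ncpoly" where
  "swap = lin_ext swap_word"


section \<open>Formal multiple Eisenstein series and formal multiple zeta values\<close>

definition swap_ideal :: "(nat \<times> nat) ncpoly set" where
  "swap_ideal = Idl\<^bsub>QA\<^esub> {swap p - p | p. p \<in> carrier QA}"

definition Gf :: "(nat \<times> nat) ncpoly set ring" where
  "Gf = QA Quot swap_ideal"

definition Gf_class :: "(nat \<times> nat) ncpoly \<Rightarrow> (nat \<times> nat) ncpoly set" where
  "Gf_class p = swap_ideal +>\<^bsub>QA\<^esub> p"

definition N_ideal :: "(nat \<times> nat) ncpoly set set" where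
  "N_ideal = Idl\<^bsub>Gf\<^esub> {Gf_class (word w) | w.
     w \<in> lists biletters - {u @ v | u v. u \<in> lists biletters_1 \<and> v \<in> lists biletters_0}}"

definition Zf :: "(nat \<times> nat) ncpoly set set ring" where
  "Zf = Gf Quot N_ideal"

definition Zf_proj :: "(nat \<times> nat) ncpoly set \<Rightarrow> (nat \<times> nat) ncpoly set set" where
  "Zf_proj x = N_ideal +>\<^bsub>Gf\<^esub> x"

definition formal_zeta :: "nat list \<Rightarrow> (nat \<times> nat) ncpoly set set" where
  "formal_zeta ks = Zf_proj (Gf_class (word (map (\<lambda>k. (k, 0)) ks)))"


section \<open>Words in \<open>z\<^sub>k\<close>\<close>

text \<open>The letter \<open>z\<^sub>k\<close> is the number \<open>k\<close>.\<close>

abbreviation H1 :: "nat ncpoly ring" where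
  "H1 \<equiv> stuffle_alg {1..}"

definition H0 :: "nat ncpoly set" where
  "H0 = {p \<in> carrier H1. \<forall>w \<in> Poly_Mapping.keys p. w = [] \<or> hd w \<noteq> 1}"

definition H1_to_QA :: "nat ncpoly \<Rightarrow> (nat \<times> nat) ncpoly" where
  "H1_to_QA = lin_ext (\<lambda>ks. word (map (\<lambda>k. (k, 0)) ks))"

text \<open>
  The linear extension of \<open>z\<^bsub>k\<^sub>1\<^esub> \<cdots> z\<^bsub>k\<^sub>r\<^esub> \<mapsto> \<zeta>\<^sup>f(k\<^sub>1,\<dots>,k\<^sub>r)\<close>, see \<open>zeta_hom_word\<close>. The record
  \<open>Zf\<close> carries no scalar multiplication, so the extension is taken in \<open>\<rat>\<langle>\<A>\<rangle>\<close>, before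
  projecting to the quotients.
\<close>

definition zeta_hom :: "nat ncpoly \<Rightarrow> (nat \<times> nat) ncpoly set set" where
  "zeta_hom p = Zf_proj (Gf_class (H1_to_QA p))"

datatype xy = Lx | Ly

fun shuffle_word :: "'a list \<Rightarrow> 'a list \<Rightarrow> 'a ncpoly" where
  "shuffle_word [] v = word v"
| "shuffle_word (a # u) [] = word (a # u)"
| "shuffle_word (a # u) (b # v) =
     lmul a (shuffle_word u (b # v)) + lmul b (shuffle_word (a # u) v)"

definition shuffle :: "'a ncpoly \<Rightarrow> 'a ncpoly \<Rightarrow> 'a ncpoly" where
  "shuffle = bilin_ext shuffle_word"

definition xy_word :: "nat list \<Rightarrow> xy list" where
  "xy_word ks = concat (map (\<lambda>k. replicate (k - 1) Lx @ [Ly]) ks)"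

definition xy_embed :: "nat ncpoly \<Rightarrow> xy ncpoly" where
  "xy_embed = lin_ext (\<lambda>ks. word (xy_word ks))"

text \<open>
  The shuffle product transported to \<open>\<HH>\<^sup>1\<close> along the embedding into \<open>\<rat>\<langle>x,y\<rangle>\<close>; the image of
  \<open>\<HH>\<^sup>1\<close> is closed under it, see \<open>H1_shuffle\<close>.
\<close>

definition H1_shuffle :: "nat ncpoly \<Rightarrow> nat ncpoly \<Rightarrow> nat ncpoly" where
  "H1_shuffle p q = inv_into (carrier H1) xy_embed (shuffle (xy_embed p) (xy_embed q))"


section \<open>Well-definedness\<close>

subsection \<open>The stuffle algebra is a commutative ring\<close>

lemma lookup_scale [simp]: "Poly_Mapping.lookup (scale c p) k = c * Poly_Mapping.lookup p k"
  by (simp add: scale_def Poly_Mapping.map.rep_eq when_def)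

lemma scale_add: "scale c (p + q) = scale c p + scale c q"
  by (rule poly_mapping_eqI) (simp add: lookup_add algebra_simps)

lemma scale_left_add: "scale (c + d) p = scale c p + scale d p"
  by (rule poly_mapping_eqI) (simp add: lookup_add algebra_simps)

lemma scale_0 [simp]: "scale c 0 = 0"
  by (rule poly_mapping_eqI) simp

lemma scale_scale [simp]: "scale c (scale d p) = scale (c * d) p"
  by (rule poly_mapping_eqI) simp

lemma scale_sum: "scale c (sum f S) = (\<Sum>x\<in>S. scale c (f x))"
  by (rule poly_mapping_eqI) (simp add: lookup_sum sum_distrib_left)

lemma lin_ext_superset:
  assumes "finite S" "Poly_Mapping.keys p \<subseteq> S"
  shows "lin_ext f p = (\<Sum>w\<in>S. scale (Poly_Mapping.lookup p w) (f w))"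
  unfolding lin_ext_def
  by (rule sum.mono_neutral_left[OF assms])
     (auto simp: in_keys_iff intro!: poly_mapping_eqI)

lemma lin_ext_0 [simp]: "lin_ext f 0 = 0"
  by (simp add: lin_ext_def)

lemma lin_ext_add: "lin_ext f (p + q) = lin_ext f p + lin_ext f q"
proof -
  let ?S = "Poly_Mapping.keys p \<union> Poly_Mapping.keys q"
  have k: "Poly_Mapping.keys (p + q) \<subseteq> ?S" by (rule keys_add)
  show ?thesis
    using k by (simp add: lin_ext_superset[where S = ?S] sum.distrib lookup_add scale_left_add)
qed

lemma lin_ext_scale: "lin_ext f (scale c p) = scale c (lin_ext f p)"
proof -
  have "Poly_Mapping.keys (scale c p) \<subseteq> Poly_Mapping.keys p"
    by (auto simp: in_keys_iff)
  then have "lin_ext f (scale c p)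
      = (\<Sum>w\<in>Poly_Mapping.keys p. scale (Poly_Mapping.lookup (scale c p) w) (f w))"
    by (rule lin_ext_superset[rotated]) simp
  then show ?thesis by (simp add: lin_ext_def scale_sum)
qed

lemma lin_ext_single [simp]: "lin_ext f (Poly_Mapping.single w c) = scale c (f w)"
  by (subst lin_ext_superset[where S = "{w}"]) auto

lemma scale_1 [simp]: "scale 1 p = p"
  by (rule poly_mapping_eqI) simp

lemma lin_ext_word [simp]: "lin_ext f (word w) = f w"
  by (simp add: word_def)

lemma lin_ext_fun_add: "lin_ext (\<lambda>w. f w + g w) p = lin_ext f p + lin_ext g p"
  by (simp add: lin_ext_def scale_add sum.distrib)

lemma lin_ext_fun_scale: "lin_ext (\<lambda>w. scale c (f w)) p = scale c (lin_ext f p)"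
  by (simp add: lin_ext_def scale_sum mult.commute)

lemma ncpoly_expand: "p = (\<Sum>w\<in>Poly_Mapping.keys p. scale (Poly_Mapping.lookup p w) (word w))"
  by (rule poly_mapping_eqI)
     (simp add: lookup_sum word_def lookup_single when_def in_keys_iff if_distrib
        cong: if_cong)

lemma lin_ext_sum: "lin_ext f (sum g S) = (\<Sum>x\<in>S. lin_ext f (g x))"
  by (induction S rule: infinite_finite_induct) (auto simp: lin_ext_add)

text \<open>Two linear maps agreeing on words are equal.\<close>

lemma ncpoly_eqI:
  assumes "\<And>p q. F (p + q) = F p + F q" "\<And>p q. G (p + q) = G p + G q"
    and "\<And>c p. F (scale c p) = scale c (F p)" "\<And>c p. G (scale c p) = scale c (G p)"
    and "\<And>w. w \<in> Poly_Mapping.keys p \<Longrightarrow> F (word w) = G (word w)"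
  shows "F p = (G p :: 'b \<Rightarrow>\<^sub>0 rat)"
proof -
  have F0: "F 0 = 0" using assms(1)[of 0 0] by simp
  have G0: "G 0 = 0" using assms(2)[of 0 0] by simp
  have "F (\<Sum>w\<in>S. scale (c w) (word w)) = G (\<Sum>w\<in>S. scale (c w) (word w))"
    if "S \<subseteq> Poly_Mapping.keys p" for S c
    using that
    by (induction S rule: infinite_finite_induct) (auto simp: F0 G0 assms)
  from this[OF subset_refl, of "Poly_Mapping.lookup p"] show ?thesis
    by (simp flip: ncpoly_expand)
qed

lemma bilin_ext_add_left: "bilin_ext f (p + q) r = bilin_ext f p r + bilin_ext f q r"
  by (simp add: bilin_ext_def lin_ext_add)

lemma bilin_ext_add_right: "bilin_ext f r (p + q) = bilin_ext f r p + bilin_ext f r q"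
  by (simp add: bilin_ext_def lin_ext_add lin_ext_fun_add)

lemma bilin_ext_scale_left: "bilin_ext f (scale c p) r = scale c (bilin_ext f p r)"
  by (simp add: bilin_ext_def lin_ext_scale)

lemma bilin_ext_scale_right: "bilin_ext f r (scale c p) = scale c (bilin_ext f r p)"
  by (simp add: bilin_ext_def lin_ext_scale lin_ext_fun_scale)

lemma bilin_ext_word [simp]: "bilin_ext f (word u) (word v) = f u v"
  by (simp add: bilin_ext_def)

lemmas stuffle_lin = 
  bilin_ext_add_left[of stuffle_word, folded stuffle_def]
  bilin_ext_add_right[of stuffle_word, folded stuffle_def]
  bilin_ext_scale_left[of stuffle_word, folded stuffle_def]
  bilin_ext_scale_right[of stuffle_word, folded stuffle_def]

lemma lmul_add: "lmul a (p + q) = lmul a p + lmul a q"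
  and lmul_scale: "lmul a (scale c p) = scale c (lmul a p)"
  and lmul_word [simp]: "lmul a (word w) = word (a # w)"
  by (simp_all add: lmul_def lin_ext_add lin_ext_scale)

lemma stuffle_word_Nil_right [simp]: "stuffle_word u [] = word u"
  by (cases u) auto

lemma stuffle_words [simp]: "stuffle (word u) (word v) = stuffle_word u v"
  by (simp add: stuffle_def)

lemma stuffle_one_left [simp]: "stuffle (word []) p = p"
  by (rule ncpoly_eqI[where F = "stuffle (word [])" and G = "\<lambda>p. p"]) (auto simp: stuffle_lin)

lemma stuffle_one_right [simp]: "stuffle p (word []) = p"
  by (rule ncpoly_eqI[where F = "\<lambda>p. stuffle p (word [])" and G = "\<lambda>p. p"])
     (auto simp: stuffle_lin)

lemma stuffle_word_commute: "stuffle_word u v = stuffle_word v u"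
  by (induction u v rule: stuffle_word.induct) (auto simp: add_ac)

lemma stuffle_commute: "stuffle p q = stuffle q p"
proof (rule ncpoly_eqI[where F = "\<lambda>p. stuffle p q" and G = "\<lambda>p. stuffle q p"])
  fix u
  show "stuffle (word u) q = stuffle q (word u)"
    by (rule ncpoly_eqI[where F = "\<lambda>q. stuffle (word u) q" and G = "\<lambda>q. stuffle q (word u)"])
       (auto simp: stuffle_lin stuffle_word_commute)
qed (auto simp: stuffle_lin)

lemma stuffle_lmul:
  "stuffle (lmul a p) (lmul b q) =
     lmul a (stuffle p (lmul b q)) + lmul b (stuffle (lmul a p) q) + lmul (a + b) (stuffle p q)"
proof (rule ncpoly_eqI[where F = "\<lambda>p. stuffle (lmul a p) (lmul b q)" and
      G = "\<lambda>p. lmul a (stuffle p (lmul b q)) + lmul b (stuffle (lmul a p) q) + lmul (a + b) (stuffle p q)"])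
  fix u
  show "stuffle (lmul a (word u)) (lmul b q) = lmul a (stuffle (word u) (lmul b q))
      + lmul b (stuffle (lmul a (word u)) q) + lmul (a + b) (stuffle (word u) q)"
    by (rule ncpoly_eqI[where F = "\<lambda>q. stuffle (lmul a (word u)) (lmul b q)" and
      G = "\<lambda>q. lmul a (stuffle (word u) (lmul b q))
      + lmul b (stuffle (lmul a (word u)) q) + lmul (a + b) (stuffle (word u) q)"])
       (auto simp: stuffle_lin lmul_add lmul_scale scale_add add_ac)
qed (auto simp: stuffle_lin lmul_add lmul_scale scale_add add_ac)

lemma stuffle_lmul_word:
  "stuffle (lmul a p) (word (c # w)) = lmul a (stuffle p (word (c # w)))
     + lmul c (stuffle (lmul a p) (word w)) + lmul (a + c) (stuffle p (word w))"
  "stuffle (word (c # w)) (lmul a p) = lmul c (stuffle (word w) (lmul a p))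
     + lmul a (stuffle (word (c # w)) p) + lmul (c + a) (stuffle (word w) p)"
  using stuffle_lmul[of a p c "word w"] stuffle_lmul[of c "word w" a p] by simp_all

lemma stuffle_word_assoc:
  "stuffle (stuffle_word u v) (word w) = stuffle (word u) (stuffle_word v w)"
proof (induction "length u + length v + length w" arbitrary: u v w rule: less_induct)
  case less
  show ?case
  proof (cases "u = [] \<or> v = [] \<or> w = []")
    case True
    then show ?thesis by auto
  next
    case False
    then obtain a u' b v' c w' where e: "u = a # u'" "v = b # v'" "w = c # w'"
      by (meson neq_Nil_conv)
    note IH = less[unfolded e]
    have i1: "stuffle (stuffle_word u' (b # v')) (word (c # w')) = stuffle (word u') (stuffle_word (b # v') (c # w'))"
      and i2: "stuffle (stuffle_word (a # u') v') (word (c # w')) = stuffle (word (a # u')) (stuffle_word v' (c # w'))"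
      and i3: "stuffle (stuffle_word u' v') (word (c # w')) = stuffle (word u') (stuffle_word v' (c # w'))"
      and i4: "stuffle (stuffle_word (a # u') (b # v')) (word w') = stuffle (word (a # u')) (stuffle_word (b # v') w')"
      and i5: "stuffle (stuffle_word u' (b # v')) (word w') = stuffle (word u') (stuffle_word (b # v') w')"
      and i6: "stuffle (stuffle_word (a # u') v') (word w') = stuffle (word (a # u')) (stuffle_word v' w')"
      and i7: "stuffle (stuffle_word u' v') (word w') = stuffle (word u') (stuffle_word v' w')"
      by (rule IH; simp)+
    let ?P = "stuffle_word u' (b # v')" and ?Q = "stuffle_word (a # u') v'" and ?R = "stuffle_word u' v'"
    have "stuffle (stuffle_word u v) (word w) =
       lmul a (stuffle ?P (word (c # w'))) + lmul b (stuffle ?Q (word (c # w')))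
       + lmul (a + b) (stuffle ?R (word (c # w')))
       + lmul c (stuffle (stuffle_word (a # u') (b # v')) (word w'))
       + lmul (a + c) (stuffle ?P (word w')) + lmul (b + c) (stuffle ?Q (word w'))
       + lmul (a + b + c) (stuffle ?R (word w'))"
      unfolding e by (simp add: stuffle_lin lmul_add stuffle_lmul_word add_ac)
    also have "\<dots> = stuffle (word u) (stuffle_word v w)"
      unfolding i1 i2 i3 i4 i5 i6 i7 unfolding e
      by (simp add: stuffle_lin lmul_add stuffle_lmul_word add_ac)
    finally show ?thesis .
  qed
qed

lemma stuffle_assoc: "stuffle (stuffle p q) r = stuffle p (stuffle q r)"
proof (rule ncpoly_eqI[where F = "\<lambda>p. stuffle (stuffle p q) r" and G = "\<lambda>p. stuffle p (stuffle q r)"])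
  fix u
  show "stuffle (stuffle (word u) q) r = stuffle (word u) (stuffle q r)"
  proof (rule ncpoly_eqI[where F = "\<lambda>q. stuffle (stuffle (word u) q) r"
        and G = "\<lambda>q. stuffle (word u) (stuffle q r)"])
    fix v
    show "stuffle (stuffle (word u) (word v)) r = stuffle (word u) (stuffle (word v) r)"
      by (rule ncpoly_eqI[where F = "\<lambda>r. stuffle (stuffle (word u) (word v)) r"
          and G = "\<lambda>r. stuffle (word u) (stuffle (word v) r)"])
         (auto simp: stuffle_lin stuffle_word_assoc)
  qed (auto simp: stuffle_lin)
qed (auto simp: stuffle_lin)

lemma free_algD: "p \<in> free_alg A \<Longrightarrow> w \<in> Poly_Mapping.keys p \<Longrightarrow> w \<in> lists A"
  by (auto simp: free_alg_def)

lemma free_alg_add: "p \<in> free_alg A \<Longrightarrow> q \<in> free_alg A \<Longrightarrow> p + q \<in> free_alg A"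
  using keys_add[of p q] unfolding free_alg_def by blast

lemma free_alg_scale: "p \<in> free_alg A \<Longrightarrow> scale c p \<in> free_alg A"
  unfolding free_alg_def by (auto simp: in_keys_iff subset_iff)

lemma free_alg_0 [simp]: "0 \<in> free_alg A"
  by (simp add: free_alg_def)

lemma word_in_free_alg [simp]: "word w \<in> free_alg A \<longleftrightarrow> w \<in> lists A"
  by (simp add: free_alg_def word_def)

lemma free_alg_sum: "(\<And>x. x \<in> S \<Longrightarrow> f x \<in> free_alg A) \<Longrightarrow> sum f S \<in> free_alg A"
  by (induction S rule: infinite_finite_induct) (auto simp: free_alg_add)

lemma lin_ext_in_free_alg:
  "(\<And>w. w \<in> Poly_Mapping.keys p \<Longrightarrow> f w \<in> free_alg A) \<Longrightarrow> lin_ext f p \<in> free_alg A"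
  unfolding lin_ext_def by (intro free_alg_sum free_alg_scale)

lemma lmul_in_free_alg: "a \<in> A \<Longrightarrow> p \<in> free_alg A \<Longrightarrow> lmul a p \<in> free_alg A"
  unfolding lmul_def by (rule lin_ext_in_free_alg) (auto dest: free_algD)

lemma stuffle_word_in_free_alg:
  assumes "\<And>a b. a \<in> A \<Longrightarrow> b \<in> A \<Longrightarrow> a + b \<in> A"
  shows "u \<in> lists A \<Longrightarrow> v \<in> lists A \<Longrightarrow> stuffle_word u v \<in> free_alg A"
  by (induction u v rule: stuffle_word.induct)
     (auto intro!: free_alg_add lmul_in_free_alg assms)

lemma stuffle_in_free_alg:
  assumes "\<And>a b. a \<in> A \<Longrightarrow> b \<in> A \<Longrightarrow> a + b \<in> A" "p \<in> free_alg A" "q \<in> free_alg A"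
  shows "stuffle p q \<in> free_alg A"
  unfolding stuffle_def bilin_ext_def
  by (intro lin_ext_in_free_alg stuffle_word_in_free_alg[OF assms(1)])
     (use assms(2,3) in \<open>auto dest: free_algD\<close>)

theorem cring_stuffle_alg:
  assumes "\<And>a b. a \<in> A \<Longrightarrow> b \<in> A \<Longrightarrow> a + b \<in> A"
  shows "cring (stuffle_alg A)"
proof (rule cringI)
  show "abelian_group (stuffle_alg A)"
  proof (rule abelian_groupI)
    fix p assume "p \<in> carrier (stuffle_alg A)"
    then have "scale (-1) p \<in> free_alg A" "scale (-1) p + p = 0"
      by (auto simp: stuffle_alg_def lookup_add intro: free_alg_scale intro!: poly_mapping_eqI)
    then show "\<exists>y\<in>carrier (stuffle_alg A). y \<oplus>\<^bsub>stuffle_alg A\<^esub> p = \<zero>\<^bsub>stuffle_alg A\<^esub>"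
      by (auto simp: stuffle_alg_def)
  qed (auto simp: stuffle_alg_def free_alg_add add_ac)
  show "comm_monoid (stuffle_alg A)"
    by (rule comm_monoidI)
       (auto simp: stuffle_alg_def stuffle_in_free_alg[OF assms] stuffle_assoc intro: stuffle_commute)
qed (auto simp: stuffle_alg_def stuffle_lin)


lemma cring_QA: "cring QA"
  by (rule cring_stuffle_alg) (auto simp: biletters_def)

lemma cring_H1: "cring H1"
  by (rule cring_stuffle_alg) auto

subsection \<open>The swap\<close>

definition mdeg :: "gmonom \<Rightarrow> nat" where
  "mdeg m = (\<Sum>v\<in>Poly_Mapping.keys m. Poly_Mapping.lookup m v)"

definition homog :: "nat \<Rightarrow> gpoly \<Rightarrow> bool" where
  "homog n P \<longleftrightarrow> (\<forall>m\<in>Poly_Mapping.keys P. mdeg m = n)"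

lemma mdeg_add: "mdeg (m + n) = mdeg m + mdeg n"
proof -
  let ?S = "Poly_Mapping.keys m \<union> Poly_Mapping.keys n"
  have *: "mdeg p = (\<Sum>v\<in>?S. Poly_Mapping.lookup p v)" if "Poly_Mapping.keys p \<subseteq> ?S" for p
    unfolding mdeg_def using that by (intro sum.mono_neutral_left) (auto simp: in_keys_iff)
  show ?thesis
    using *[of m] *[of n] *[of "m + n"] keys_add[of m n]
    by (simp add: lookup_add sum.distrib)
qed

lemma homog_mult: "homog a P \<Longrightarrow> homog b Q \<Longrightarrow> homog (a + b) (P * Q)"
  unfolding homog_def using keys_mult[of P Q] by (fastforce simp: mdeg_add)

lemma homog_0: "homog a 0"
  by (simp add: homog_def)

lemma homog_const: "homog 0 (Poly_Mapping.single 0 c)"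
  by (simp add: homog_def mdeg_def)

lemma homog_1: "homog 0 1"
  by (simp add: homog_def mdeg_def)

lemma homog_power: "homog a P \<Longrightarrow> homog (n * a) (P ^ n)"
  by (induction n) (auto simp: homog_1 homog_mult)

lemma homog_add: "homog a P \<Longrightarrow> homog a Q \<Longrightarrow> homog a (P + Q)"
  unfolding homog_def using keys_add[of P Q] by blast

lemma homog_diff: "homog a P \<Longrightarrow> homog a Q \<Longrightarrow> homog a (P - Q)"
  unfolding homog_def by (metis (no_types, lifting) diff_self in_keys_iff lookup_minus diff_zero)

lemma homog_sum: "(\<And>x. x \<in> S \<Longrightarrow> homog a (f x)) \<Longrightarrow> homog a (sum f S)"
  by (induction S rule: infinite_finite_induct) (auto simp: homog_0 homog_add)

lemma homog_gvar: "homog (Suc 0) (gvar_poly v)"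
  by (simp add: homog_def gvar_poly_def mdeg_def)

lemma homog_gen_summand:
  assumes "length PQ = length w" "\<forall>(P, Q)\<in>set PQ. homog 1 P \<and> homog 1 Q"
  shows "homog (\<Sum>(k, d)\<leftarrow>w. (k - 1) + d) (gen_summand PQ w)"
  using assms
proof (induction PQ w rule: list_induct2)
  case Nil
  then show ?case by (simp add: gen_summand_def homog_1)
next
  case (Cons pq PQ kd w)
  obtain P Q k d where e: "pq = (P, Q)" "kd = (k, d)" by (cases pq, cases kd)
  have "homog ((k - 1) * 1 + d * 1 + 0) (P ^ (k - 1) * Q ^ d * Poly_Mapping.single 0 (1 / fact d))"
    using Cons.prems e by (intro homog_mult homog_power homog_const) auto
  with Cons show ?case by (auto simp: gen_summand_def e intro!: homog_mult)
qed

lemma finite_words_weight: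
  "finite {w. length w = r \<and> (\<Sum>(k, d)\<leftarrow>w. (k - 1) + d) = (n::nat)}" (is "finite ?S")
proof (rule finite_subset)
  have *: "k \<le> n + 1 \<and> d \<le> n" if "(k, d) \<in> set w" "(\<Sum>(k, d)\<leftarrow>w. (k - 1) + d) = n" for k d w
    using that by (induction w arbitrary: n) fastforce+
  show "?S \<subseteq> {w. set w \<subseteq> {..n + 1} \<times> {..n} \<and> length w = r}"
    using * by fastforce
  show "finite {w. set w \<subseteq> {..n + 1} \<times> {..n} \<and> length w = r}"
    by (rule finite_lists_length_eq) auto
qed

lemma homog_swap_args: "\<forall>(P, Q)\<in>set (swap_args r). homog 1 P \<and> homog 1 Q"
  by (auto simp: swap_args_def intro!: homog_sum homog_gvar homog_diff)

lemma finite_swap_support: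
  "finite {w. w \<in> lists biletters \<and> length w = length (swap_args r) \<and>
              Poly_Mapping.lookup (gen_summand (swap_args r) w) m \<noteq> 0}"
proof (rule finite_subset[OF _ finite_words_weight[of "length (swap_args r)" "mdeg m"]])
  show "{w. w \<in> lists biletters \<and> length w = length (swap_args r) \<and>
              Poly_Mapping.lookup (gen_summand (swap_args r) w) m \<noteq> 0}
     \<subseteq> {w. length w = length (swap_args r) \<and> (\<Sum>(k, d)\<leftarrow>w. (k - 1) + d) = mdeg m}"
  proof safe
    fix w assume "length w = length (swap_args r)" "Poly_Mapping.lookup (gen_summand (swap_args r) w) m \<noteq> 0"
    with homog_gen_summand[OF _ homog_swap_args, of r w]
    show "(\<Sum>(k, d)\<leftarrow>w. (k - 1) + d) = mdeg m" by (auto simp: homog_def in_keys_iff)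
  qed
qed

lemma swap_in_QA: "swap p \<in> carrier QA"
  unfolding stuffle_alg_def swap_def swap_word_def gen_coeff_def
  by (auto intro!: lin_ext_in_free_alg free_alg_scale free_alg_sum)

lemma swap_one: "swap (word []) = word []"
proof -
  have "{w. w \<in> lists biletters \<and> length w = length (swap_args 0) \<and>
      Poly_Mapping.lookup (gen_summand (swap_args 0) w) 0 \<noteq> 0} = {[]}"
    by (auto simp: swap_args_def gen_summand_def)
  then show ?thesis
    by (simp add: swap_def swap_word_def gen_coeff_def word_monom_def swap_args_def gen_summand_def)
qed

subsection \<open>The quotients and the zeta map\<close>

lemma ideal_swap: "ideal swap_ideal QA"
proof -
  interpret cring QA by (rule cring_QA)
  have "p - q \<in> carrier QA" if "p \<in> carrier QA" "q \<in> carrier QA" for p q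
  proof -
    have e: "p - q = p + scale (-1) q" by (rule poly_mapping_eqI) (simp add: lookup_add lookup_minus)
    show ?thesis unfolding e
      using that by (simp add: stuffle_alg_def free_alg_add free_alg_scale)
  qed
  then show ?thesis unfolding swap_ideal_def
    by (intro genideal_ideal) (auto simp: swap_in_QA)
qed

lemma cring_Gf: "cring Gf"
  unfolding Gf_def by (rule ideal.quotient_is_cring[OF ideal_swap cring_QA])

lemma Gf_class_hom: "Gf_class \<in> ring_hom QA Gf"
  unfolding Gf_def using ideal.rcos_ring_hom[OF ideal_swap] by (simp add: Gf_class_def[abs_def])

lemma ideal_N: "ideal N_ideal Gf"
proof -
  interpret cring Gf by (rule cring_Gf)
  show ?thesis unfolding N_ideal_def
    by (rule genideal_ideal)
       (auto intro!: ring_hom_closed[OF Gf_class_hom] simp: stuffle_alg_def)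
qed

lemma cring_Zf: "cring Zf"
  unfolding Zf_def by (rule ideal.quotient_is_cring[OF ideal_N cring_Gf])

lemma Zf_proj_hom: "Zf_proj \<in> ring_hom Gf Zf"
  unfolding Zf_def using ideal.rcos_ring_hom[OF ideal_N] by (simp add: Zf_proj_def[abs_def])

lemma H1_to_QA_lmul: "H1_to_QA (lmul k p) = lmul (k, 0) (H1_to_QA p)"
  by (rule ncpoly_eqI[where F = "\<lambda>p. H1_to_QA (lmul k p)" and G = "\<lambda>p. lmul (k, 0) (H1_to_QA p)"])
     (auto simp: H1_to_QA_def lmul_add lmul_scale lin_ext_add lin_ext_scale)

lemma H1_to_QA_stuffle_word:
  "H1_to_QA (stuffle_word u v) = stuffle_word (map (\<lambda>k. (k, 0)) u) (map (\<lambda>k. (k, 0)) v)"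
proof (induction u v rule: stuffle_word.induct)
  case (3 a u b v)
  have [simp]: "H1_to_QA (p + q) = H1_to_QA p + H1_to_QA q" for p q
    by (simp add: H1_to_QA_def lin_ext_add)
  show ?case using 3 by (simp add: H1_to_QA_lmul)
qed (auto simp: H1_to_QA_def)

lemma H1_to_QA_stuffle: "H1_to_QA (stuffle p q) = stuffle (H1_to_QA p) (H1_to_QA q)"
proof (rule ncpoly_eqI[where F = "\<lambda>p. H1_to_QA (stuffle p q)" and G = "\<lambda>p. stuffle (H1_to_QA p) (H1_to_QA q)"])
  fix u
  show "H1_to_QA (stuffle (word u) q) = stuffle (H1_to_QA (word u)) (H1_to_QA q)"
    by (rule ncpoly_eqI[where F = "\<lambda>q. H1_to_QA (stuffle (word u) q)" and
          G = "\<lambda>q. stuffle (H1_to_QA (word u)) (H1_to_QA q)"])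
       (use H1_to_QA_stuffle_word in \<open>auto simp: H1_to_QA_def stuffle_lin lin_ext_add lin_ext_scale\<close>)
qed (auto simp: H1_to_QA_def stuffle_lin lin_ext_add lin_ext_scale)

lemma H1_to_QA_hom: "H1_to_QA \<in> ring_hom H1 QA"
proof (rule ring_hom_memI)
  fix p assume "p \<in> carrier H1"
  then show "H1_to_QA p \<in> carrier QA"
    unfolding stuffle_alg_def H1_to_QA_def
    by (auto intro!: lin_ext_in_free_alg dest!: free_algD simp: biletters_def)
qed (simp_all add: stuffle_alg_def H1_to_QA_stuffle, simp_all add: H1_to_QA_def lin_ext_add)

theorem zeta_hom_ring_hom: "zeta_hom \<in> ring_hom H1 Zf"
proof -
  have "Zf_proj \<circ> (Gf_class \<circ> H1_to_QA) \<in> ring_hom H1 Zf"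
    by (intro ring_hom_trans[OF _ Zf_proj_hom] ring_hom_trans[OF _ Gf_class_hom] H1_to_QA_hom)
  moreover have "Zf_proj \<circ> (Gf_class \<circ> H1_to_QA) = zeta_hom"
    by (auto simp: zeta_hom_def H1_to_QA_def)
  ultimately show ?thesis by simp
qed

lemma zeta_hom_word: "zeta_hom (word ks) = formal_zeta ks"
  by (simp add: zeta_hom_def formal_zeta_def H1_to_QA_def)

subsection \<open>The shuffle product on the words in \<open>z\<^sub>k\<close>\<close>

lemma xy_word_Cons: "xy_word (k # ks) = replicate (k - 1) Lx @ Ly # xy_word ks"
  by (simp add: xy_word_def)

lemma replicate_Lx_inj:
  "replicate m Lx @ Ly # u = replicate n Lx @ Ly # v \<longleftrightarrow> m = n \<and> u = v"
proof (induction m arbitrary: n)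
  case 0 then show ?case by (cases n) auto
next
  case (Suc m) then show ?case by (cases n) auto
qed

lemma inj_on_xy_word: "inj_on xy_word (lists {1..})"
proof (rule inj_onI)
  fix u v assume "u \<in> lists {1..}" "v \<in> lists {1..}" "xy_word u = xy_word v"
  then show "u = v"
  proof (induction u arbitrary: v rule: list.induct)
    case Nil then show ?case by (cases v) (auto simp: xy_word_Cons, simp add: xy_word_def)
  next
    case (Cons k u)
    show ?case
    proof (cases v)
      case Nil with Cons show ?thesis by (simp add: xy_word_Cons) (simp add: xy_word_def)
    next
      case C: (Cons l v')
      have "1 \<le> k" "1 \<le> l" using Cons.prems C by auto
      moreover have "k - 1 = l - 1" "xy_word u = xy_word v'"
        using Cons.prems(3) by (auto simp: C xy_word_Cons replicate_Lx_inj)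
      moreover from this have "u = v'"
        using Cons.prems Cons.IH[of v'] C by auto
      ultimately show ?thesis by (simp add: C)
    qed
  qed
qed

definition ends_y :: "xy list set" where
  "ends_y = {w. w = [] \<or> last w = Ly}"

lemma xy_word_image: "xy_word ` lists {1..} = ends_y"
proof (intro equalityI subsetI)
  fix w assume "w \<in> xy_word ` lists {1..}"
  then obtain ks where "w = xy_word ks" by auto
  moreover have "xy_word ks \<in> ends_y" for ks
    by (induction ks) (auto simp: ends_y_def xy_word_Cons, auto simp: xy_word_def)
  ultimately show "w \<in> ends_y" by simp
next
  fix w assume "w \<in> ends_y"
  then show "w \<in> xy_word ` lists {1..}"
  proof (induction w)
    case Nil
    then show ?case by (auto simp: image_iff xy_word_def intro: bexI[of _ "[]"])
  next
    case (Cons a w)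
    then have w: "w \<in> ends_y" by (auto simp: ends_y_def split: if_splits)
    with Cons obtain ks where ks: "ks \<in> lists {1..}" "w = xy_word ks" by auto
    show ?case
    proof (cases a)
      case Ly
      with ks show ?thesis by (intro image_eqI[of _ _ "1 # ks"]) (auto simp: xy_word_Cons)
    next
      case Lx
      with Cons.prems have "w \<noteq> []" by (auto simp: ends_y_def)
      with ks obtain k ks' where e: "ks = k # ks'" by (cases ks) (auto simp: xy_word_def)
      with ks Lx have "a # w = xy_word (Suc k # ks')"
        by (cases k) (auto simp: xy_word_Cons)
      with ks e show ?thesis by (intro image_eqI[of _ _ "Suc k # ks'"]) auto
    qed
  qed
qed

lemma lookup_xy_embed:
  assumes "p \<in> carrier H1" "ks \<in> lists {1..}"
  shows "Poly_Mapping.lookup (xy_embed p) (xy_word ks) = Poly_Mapping.lookup p ks"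
proof -
  have K: "Poly_Mapping.keys p \<subseteq> lists {1..}" using assms by (simp add: stuffle_alg_def free_alg_def)
  have "Poly_Mapping.lookup (xy_embed p) (xy_word ks)
     = (\<Sum>w\<in>Poly_Mapping.keys p. if w = ks then Poly_Mapping.lookup p w else 0)"
    unfolding xy_embed_def lin_ext_def lookup_sum
    using K assms(2) inj_on_xy_word
    by (intro sum.cong) (auto simp: word_def lookup_single when_def dest!: inj_onD)
  then show ?thesis by (simp add: in_keys_iff)
qed

lemma inj_on_xy_embed: "inj_on xy_embed (carrier H1)"
proof (rule inj_onI, rule poly_mapping_eqI)
  fix p q ks assume *: "p \<in> carrier H1" "q \<in> carrier H1" "xy_embed p = xy_embed q"
  show "Poly_Mapping.lookup p ks = Poly_Mapping.lookup q ks"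
  proof (cases "ks \<in> lists {1..}")
    case True then show ?thesis using * lookup_xy_embed by metis
  next
    case False
    then have "ks \<notin> Poly_Mapping.keys p" "ks \<notin> Poly_Mapping.keys q"
      using * by (auto simp: stuffle_alg_def dest: free_algD)
    then show ?thesis by (simp add: in_keys_iff)
  qed
qed

lemma keys_lin_ext:
  "x \<in> Poly_Mapping.keys (lin_ext f p) \<Longrightarrow>
     \<exists>w\<in>Poly_Mapping.keys p. x \<in> Poly_Mapping.keys (f w)"
proof -
  assume "x \<in> Poly_Mapping.keys (lin_ext f p)"
  then have "(\<Sum>w\<in>Poly_Mapping.keys p. Poly_Mapping.lookup p w * Poly_Mapping.lookup (f w) x) \<noteq> 0"
    by (simp add: lin_ext_def in_keys_iff lookup_sum)
  then obtain w where "w \<in> Poly_Mapping.keys p"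
    "Poly_Mapping.lookup p w * Poly_Mapping.lookup (f w) x \<noteq> 0"
    by (rule sum.not_neutral_contains_not_neutral)
  then show ?thesis by (auto simp: in_keys_iff)
qed

lemma keys_word [simp]: "Poly_Mapping.keys (word w) = {w}"
  by (simp add: word_def)

lemma keys_lmul: "x \<in> Poly_Mapping.keys (lmul a p) \<Longrightarrow> \<exists>y\<in>Poly_Mapping.keys p. x = a # y"
  unfolding lmul_def by (drule keys_lin_ext) simp

lemma shuffle_word_ends_y:
  "u \<in> ends_y \<Longrightarrow> v \<in> ends_y \<Longrightarrow> x \<in> Poly_Mapping.keys (shuffle_word u v) \<Longrightarrow>
     x \<in> ends_y \<and> length x = length u + length v"
proof (induction u v arbitrary: x rule: shuffle_word.induct)
  case (3 a u b v)
  have uv: "u \<in> ends_y" "v \<in> ends_y" using "3.prems" by (auto simp: ends_y_def split: if_splits)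
  from "3.prems"(3)
  have "x \<in> Poly_Mapping.keys (lmul a (shuffle_word u (b # v))) \<or>
        x \<in> Poly_Mapping.keys (lmul b (shuffle_word (a # u) v))"
    using keys_add by fastforce
  then show ?case
  proof
    assume "x \<in> Poly_Mapping.keys (lmul a (shuffle_word u (b # v)))"
    then obtain y where "x = a # y" "y \<in> Poly_Mapping.keys (shuffle_word u (b # v))"
      using keys_lmul by metis
    moreover from this have "y \<in> ends_y \<and> length y = length u + length v + 1"
      using "3.IH"(1)[OF uv(1) "3.prems"(2), of y] by simp
    ultimately show ?thesis by (auto simp: ends_y_def)
  next
    assume "x \<in> Poly_Mapping.keys (lmul b (shuffle_word (a # u) v))"
    then obtain y where "x = b # y" "y \<in> Poly_Mapping.keys (shuffle_word (a # u) v)"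
      using keys_lmul by metis
    moreover from this have "y \<in> ends_y \<and> length y = length u + length v + 1"
      using "3.IH"(2)[OF "3.prems"(1) uv(2), of y] by simp
    ultimately show ?thesis by (auto simp: ends_y_def)
  qed
qed (auto simp: word_def)

lemma shuffle_xy_embed_in_image:
  assumes "p \<in> carrier H1" "q \<in> carrier H1"
  shows "shuffle (xy_embed p) (xy_embed q) \<in> xy_embed ` carrier H1"
proof -
  let ?I = "xy_embed ` carrier H1"
  have lin: "sum f S \<in> ?I" if "\<And>x. x \<in> S \<Longrightarrow> f x \<in> ?I" for S and f :: "xy list \<Rightarrow> xy ncpoly"
    using that
  proof (induction S rule: infinite_finite_induct)
    case (insert x S)
    have "f x \<in> ?I" "sum f S \<in> ?I" using insert by blast+
    then obtain a b where "a \<in> carrier H1" "b \<in> carrier H1" "f x = xy_embed a" "sum f S = xy_embed b"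
      by blast
    with insert show ?case
      by (auto simp: xy_embed_def stuffle_alg_def free_alg_add lin_ext_add intro!: image_eqI[of _ _ "a + b"])
  qed (auto simp: xy_embed_def stuffle_alg_def intro!: image_eqI[of _ _ 0])
  have sc: "scale c f \<in> ?I" if "f \<in> ?I" for c f
    using that by (auto simp: xy_embed_def stuffle_alg_def free_alg_scale simp flip: lin_ext_scale)
  have wd: "word w \<in> ?I" if "w \<in> ends_y" for w
  proof -
    from that obtain ks where "ks \<in> lists {1..}" "w = xy_word ks" using xy_word_image by blast
    then show ?thesis by (intro image_eqI[of _ _ "word ks"]) (auto simp: xy_embed_def stuffle_alg_def)
  qed
  have I: "f \<in> ?I" if "Poly_Mapping.keys f \<subseteq> ends_y" for f
  proof -
    have "(\<Sum>w\<in>Poly_Mapping.keys f. scale (Poly_Mapping.lookup f w) (word w)) \<in> ?I"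
      by (intro lin sc wd) (use that in auto)
    then show ?thesis by (simp flip: ncpoly_expand)
  qed
  have le: "lin_ext g f \<in> ?I" if "\<And>w. w \<in> Poly_Mapping.keys f \<Longrightarrow> g w \<in> ?I"
    for f :: "xy ncpoly" and g
    unfolding lin_ext_def by (intro lin sc that)
  have k: "w \<in> ends_y" if "r \<in> carrier H1" "w \<in> Poly_Mapping.keys (xy_embed r)" for r w
  proof -
    from that(2) obtain u where "u \<in> Poly_Mapping.keys r" "w = xy_word u"
      unfolding xy_embed_def using keys_lin_ext by fastforce
    then show ?thesis
      using that(1) xy_word_image by (auto simp: stuffle_alg_def dest!: free_algD)
  qed
  show ?thesis
    unfolding shuffle_def bilin_ext_def
    by (intro le I subsetI) (use k assms shuffle_word_ends_y in blast)
qed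

lemma H1_shuffle:
  assumes "p \<in> carrier H1" "q \<in> carrier H1"
  shows "H1_shuffle p q \<in> carrier H1"
    and "xy_embed (H1_shuffle p q) = shuffle (xy_embed p) (xy_embed q)"
  using shuffle_xy_embed_in_image[OF assms] unfolding H1_shuffle_def
  by (auto intro: inv_into_into f_inv_into_f)

end

theory Submission
  imports Defs
begin

text \<open>
  Write \<open>I\<close> for the ideal of extended double shuffle relations. Both inclusions rest on an
  explicit description of the swap of a word whose upper entries are all one. Such a word is given
  by its lower entries \<open>d\<^sub>1, \<dots>, d\<^sub>r\<close>, and its swap is a combination of words in the \<open>z\<^sub>k\<close>. Read in
  the letters \<open>x\<close>, \<open>y\<close>, this combination is obtained from the empty word by applying operators
  \<open>insert_y d\<^sub>1, \<dots>, insert_y d\<^sub>r\<close> one after the other. They satisfy a Rota-Baxter identity for the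
  shuffle product (\<open>shuffle_insert_y\<close>). Hence the resulting map \<open>tau\<close> turns the shuffle product of
  lists of lower entries into the shuffle product of words in \<open>x\<close>, \<open>y\<close> (\<open>tau_shuffle\<close>). It is
  inverted by the swap of the words in \<open>z\<^sub>k\<close> (\<open>tau_theta\<close>).

  The relations hold. Take two words with all upper entries one, the second one ending in
  a positive lower entry. In their stuffle product every word that comes from adding two letters
  contains an upper entry at least two at or before a positive lower entry, so it vanishes in
  \<open>\<Z>\<^sup>f\<close>, and what is left is a shuffle product. Applying the swap invariance to both factors and
  to the product gives the relation \<open>w * v = w \<squnion> v\<close> for \<open>v\<close> in \<open>\<HH>\<^sup>0\<close>
  (\<open>double_shuffle_in_zeta_ideal\<close>).

  There are no other relations. It suffices to find a linear map \<open>realization\<close> from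
  \<open>\<rat>\<langle>\<A>\<rangle>\<close> to \<open>\<HH>\<^sup>1\<close> that is multiplicative modulo \<open>I\<close>, invariant under the swap and zero on the
  words that generate the ideal \<open>\<NN>\<close>, and that sends the word of the letters \<open>(k\<^sub>i, 0)\<close> back to
  \<open>z\<^bsub>k\<^sub>1\<^esub> \<cdots> z\<^bsub>k\<^sub>r\<^esub>\<close>: an element of the kernel is then the value of \<open>realization\<close> at an element of
  the defining ideals, and so lies in \<open>I\<close>. This map sums, over all ways to write a word as
  \<open>u v\<close>, the products of a value for \<open>u\<close>, which is zero unless all upper entries of \<open>u\<close> are
  one, and a value for \<open>v\<close>, which is zero unless all lower entries of \<open>v\<close> are zero. The value
  for \<open>v\<close> is \<open>v\<close> itself; the value for \<open>u\<close> is the shuffle regularization \<open>reg_zeta\<close>, with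
  \<open>z\<^sub>1 \<mapsto> 0\<close>, of the swap of \<open>u\<close>. Both are multiplicative, the second one modulo \<open>I\<close>
  (\<open>reg_zeta_shuffle\<close>), and so is their convolution because splitting words is compatible with the
  stuffle product (\<open>convolution_stuffle_word\<close>). A word in the \<open>z\<^sub>k\<close> is the sum over \<open>l\<close> of the
  stuffle products of the word \<open>z\<^sub>1\<^sup>l\<close> with \<open>reg_zeta\<close> of what remains after removing \<open>l\<close> leading
  letters \<open>z\<^sub>1\<close> (\<open>word_eq_ones_reg_zeta\<close>). Inserting this for \<open>v\<close> turns the sum into one
  over decompositions into three parts, in which both outer parts enter through \<open>reg_zeta\<close>.
  The swap exchanges the outer parts (\<open>block_part_swap\<close>), which proves the invariance.
\<close>

section \<open>Linear maps and left quotients\<close>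

definition qlinear :: "(('a \<Rightarrow>\<^sub>0 rat) \<Rightarrow> ('b \<Rightarrow>\<^sub>0 rat)) \<Rightarrow> bool" where
  "qlinear F \<longleftrightarrow> (\<forall>p q. F (p + q) = F p + F q) \<and> (\<forall>c p. F (scale c p) = scale c (F p))"

lemma qlinearI:
  assumes "\<And>p q. F (p + q) = F p + F q" "\<And>c p. F (scale c p) = scale c (F p)"
  shows "qlinear F"
  using assms by (auto simp: qlinear_def)

lemma qlinear_add: "qlinear F \<Longrightarrow> F (p + q) = F p + F q"
  and qlinear_scale: "qlinear F \<Longrightarrow> F (scale c p) = scale c (F p)"
  by (auto simp: qlinear_def)

lemma scale_by_0 [simp]: "scale 0 p = 0"
  by (rule poly_mapping_eqI) simp

lemma scale_diff: "scale c (p - q) = scale c p - scale c q"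
  by (rule poly_mapping_eqI) (simp add: lookup_minus algebra_simps)

lemma diff_scale: "p - q = p + scale (- 1) q"
  by (rule poly_mapping_eqI) (simp add: lookup_add lookup_minus)

lemma qlinear_0: "qlinear F \<Longrightarrow> F 0 = 0"
  using qlinear_scale[of F 0 0] by simp

lemma qlinear_diff: "qlinear F \<Longrightarrow> F (p - q) = F p - F q"
  by (simp add: diff_scale qlinear_add qlinear_scale)

lemma qlinear_sum: "qlinear F \<Longrightarrow> F (sum f S) = (\<Sum>x\<in>S. F (f x))"
  by (induction S rule: infinite_finite_induct) (auto simp: qlinear_add qlinear_0)

lemma qlinear_lin_ext: "qlinear (lin_ext f)"
  by (simp add: qlinear_def lin_ext_add lin_ext_scale)

lemma qlinear_eqI:
  assumes "qlinear F" "qlinear G" "\<And>w. w \<in> Poly_Mapping.keys p \<Longrightarrow> F (word w) = G (word w)"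
  shows "F p = G p"
  by (rule ncpoly_eqI[where F = F and G = G])
     (simp_all add: qlinear_add qlinear_scale assms)

lemma qlinear_expand:
  assumes "qlinear F"
  shows "F p = (\<Sum>w\<in>Poly_Mapping.keys p. scale (Poly_Mapping.lookup p w) (F (word w)))"
  by (subst ncpoly_expand[of p]) (simp add: qlinear_sum[OF assms] qlinear_scale[OF assms])

definition qsubspace :: "('a \<Rightarrow>\<^sub>0 rat) set \<Rightarrow> bool" where
  "qsubspace V \<longleftrightarrow> 0 \<in> V \<and> (\<forall>p\<in>V. \<forall>q\<in>V. p + q \<in> V) \<and> (\<forall>c. \<forall>p\<in>V. scale c p \<in> V)"

lemma qsubspace_0: "qsubspace V \<Longrightarrow> 0 \<in> V"
  and qsubspace_add: "qsubspace V \<Longrightarrow> p \<in> V \<Longrightarrow> q \<in> V \<Longrightarrow> p + q \<in> V"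
  and qsubspace_scale: "qsubspace V \<Longrightarrow> p \<in> V \<Longrightarrow> scale c p \<in> V"
  by (auto simp: qsubspace_def)

lemma qsubspace_diff: "qsubspace V \<Longrightarrow> p \<in> V \<Longrightarrow> q \<in> V \<Longrightarrow> p - q \<in> V"
  unfolding diff_scale by (intro qsubspace_add qsubspace_scale)

lemma qsubspace_sum: "qsubspace V \<Longrightarrow> (\<And>x. x \<in> S \<Longrightarrow> f x \<in> V) \<Longrightarrow> sum f S \<in> V"
  by (induction S rule: infinite_finite_induct) (auto simp: qsubspace_0 qsubspace_add)

lemma qsubspace_qlinear:
  assumes "qsubspace V" "qlinear F" "\<And>w. w \<in> Poly_Mapping.keys p \<Longrightarrow> F (word w) \<in> V"
  shows "F p \<in> V"
  using assms by (subst qlinear_expand) (auto intro!: qsubspace_sum qsubspace_scale)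

lemma qsubspace_lin_ext:
  assumes "qsubspace V" "\<And>w. w \<in> Poly_Mapping.keys p \<Longrightarrow> f w \<in> V"
  shows "lin_ext f p \<in> V"
  unfolding lin_ext_def using assms by (intro qsubspace_sum qsubspace_scale)

definition keys_in :: "'a set \<Rightarrow> ('a \<Rightarrow>\<^sub>0 rat) set" where
  "keys_in A = {p. Poly_Mapping.keys p \<subseteq> A}"

lemma free_alg_keys_in: "free_alg A = keys_in (lists A)"
  by (simp add: free_alg_def keys_in_def)

lemma qsubspace_keys_in [simp]: "qsubspace (keys_in A)"
  unfolding qsubspace_def keys_in_def
  by (auto simp: in_keys_iff lookup_add subset_iff) (metis add.right_neutral)

lemma word_keys_in [simp]: "word w \<in> keys_in A \<longleftrightarrow> w \<in> A"
  by (simp add: keys_in_def)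

lemma keys_inD: "p \<in> keys_in A \<Longrightarrow> w \<in> Poly_Mapping.keys p \<Longrightarrow> w \<in> A"
  by (auto simp: keys_in_def)

lemma lookup_lin_ext:
  "Poly_Mapping.lookup (lin_ext f p) x =
     (\<Sum>w\<in>Poly_Mapping.keys p. Poly_Mapping.lookup p w * Poly_Mapping.lookup (f w) x)"
  by (simp add: lin_ext_def lookup_sum)

lemma lookup_word: "Poly_Mapping.lookup (word w) x = (if w = x then 1 else 0)"
  by (simp add: word_def lookup_single when_def)

text \<open>
  The left quotient by a letter strips that letter from the words that start with it. Together
  with the coefficient of the empty word the left quotients determine a polynomial, and they are
  derivations of the shuffle product; identities between shuffles are therefore checked by
  comparing left quotients.
\<close>

definition ldq :: "'a \<Rightarrow> 'a ncpoly \<Rightarrow> 'a ncpoly" where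
  "ldq a = lin_ext (\<lambda>w. case w of [] \<Rightarrow> 0 | b # v \<Rightarrow> if a = b then word v else 0)"

lemma ldq_word [simp]:
  "ldq a (word []) = 0" "ldq a (word (b # v)) = (if a = b then word v else 0)"
  by (simp_all add: ldq_def)

lemma ldq_add: "ldq a (p + q) = ldq a p + ldq a q"
  and ldq_scale: "ldq a (scale c p) = scale c (ldq a p)"
  and ldq_0 [simp]: "ldq a 0 = 0"
  by (simp_all add: ldq_def lin_ext_add lin_ext_scale)

lemma qlinear_ldq: "qlinear (ldq a)"
  by (intro qlinearI ldq_add ldq_scale)

lemma lookup_ldq: "Poly_Mapping.lookup (ldq a p) w = Poly_Mapping.lookup p (a # w)"
proof -
  have *: "Poly_Mapping.lookup (case u of [] \<Rightarrow> 0 | b # v \<Rightarrow> if a = b then word v else 0) w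
      = (if u = a # w then 1 else (0::rat))" for u
    by (auto simp: lookup_word split: list.splits)
  show ?thesis
    unfolding ldq_def lookup_lin_ext * by (simp add: if_distrib in_keys_iff cong: if_cong)
qed

lemma ncpoly_eq_ldqI:
  assumes "Poly_Mapping.lookup p [] = Poly_Mapping.lookup q []" "\<And>a. ldq a p = ldq a q"
  shows "p = q"
proof (rule poly_mapping_eqI)
  fix w
  show "Poly_Mapping.lookup p w = Poly_Mapping.lookup q w"
    by (cases w) (simp add: assms, metis assms(2) lookup_ldq)
qed

lemma lmul_0 [simp]: "lmul a 0 = 0"
  by (simp add: lmul_def)

lemma ldq_lmul [simp]: "ldq a (lmul b p) = (if a = b then p else 0)"
  by (rule qlinear_eqI[where F = "\<lambda>p. ldq a (lmul b p)" and G = "\<lambda>p. if a = b then p else 0"])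
     (auto intro!: qlinearI simp: lmul_add lmul_scale ldq_add ldq_scale)

lemma lookup_lmul [simp]:
  "Poly_Mapping.lookup (lmul a p) [] = 0"
  "Poly_Mapping.lookup (lmul a p) (b # w) = (if a = b then Poly_Mapping.lookup p w else 0)"
proof -
  show "Poly_Mapping.lookup (lmul a p) [] = 0"
    by (simp add: lmul_def lookup_lin_ext lookup_word)
  show "Poly_Mapping.lookup (lmul a p) (b # w) = (if a = b then Poly_Mapping.lookup p w else 0)"
    by (subst lookup_ldq[symmetric]) simp
qed

section \<open>The shuffle product\<close>

lemmas shuffle_lin =
  bilin_ext_add_left[of shuffle_word, folded shuffle_def]
  bilin_ext_add_right[of shuffle_word, folded shuffle_def]
  bilin_ext_scale_left[of shuffle_word, folded shuffle_def]
  bilin_ext_scale_right[of shuffle_word, folded shuffle_def]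

lemma shuffle_words [simp]: "shuffle (word u) (word v) = shuffle_word u v"
  by (simp add: shuffle_def)

lemma qlinear_shuffle_left: "qlinear (\<lambda>p. shuffle p q)"
  and qlinear_shuffle_right: "qlinear (shuffle p)"
  by (auto intro!: qlinearI simp: shuffle_lin)

lemma qlinear_stuffle_left: "qlinear (\<lambda>p. stuffle p q)"
  and qlinear_stuffle_right: "qlinear (stuffle p)"
  by (auto intro!: qlinearI simp: stuffle_lin)

lemma shuffle_0 [simp]: "shuffle 0 p = 0" "shuffle p 0 = 0"
  using qlinear_0[OF qlinear_shuffle_left] qlinear_0[OF qlinear_shuffle_right] by auto

lemma stuffle_0 [simp]: "stuffle 0 p = 0" "stuffle p 0 = 0"
  using qlinear_0[OF qlinear_stuffle_left] qlinear_0[OF qlinear_stuffle_right] by auto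

lemma shuffle_word_Nil_right [simp]: "shuffle_word u [] = word u"
  by (cases u) auto

lemma shuffle_one [simp]: "shuffle (word []) p = p" "shuffle p (word []) = p"
  by (rule qlinear_eqI[where F = "shuffle (word [])" and G = "\<lambda>p. p"],
      auto intro!: qlinearI simp: shuffle_lin)
     (rule qlinear_eqI[where F = "\<lambda>p. shuffle p (word [])" and G = "\<lambda>p. p"],
      auto intro!: qlinearI simp: shuffle_lin)

lemma bilinear_eqI:
  assumes "\<And>q. qlinear (\<lambda>p. F p q)" "\<And>p. qlinear (F p)" "\<And>q. qlinear (\<lambda>p. G p q)" "\<And>p. qlinear (G p)"
    and "\<And>u v. u \<in> Poly_Mapping.keys p \<Longrightarrow> v \<in> Poly_Mapping.keys q \<Longrightarrow>
      F (word u) (word v) = G (word u) (word v)"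
  shows "F p q = G p q"
proof (rule qlinear_eqI[where F = "\<lambda>p. F p q" and G = "\<lambda>p. G p q"])
  fix u assume "u \<in> Poly_Mapping.keys p"
  then show "F (word u) q = G (word u) q"
    by (intro qlinear_eqI[where F = "F (word u)" and G = "G (word u)" and p = q] assms(2,4,5))
qed (simp_all only: assms(1,3))

lemma ldq_shuffle: "ldq a (shuffle p q) = shuffle (ldq a p) q + shuffle p (ldq a q)"
proof (rule bilinear_eqI[where F = "\<lambda>p q. ldq a (shuffle p q)"
      and G = "\<lambda>p q. shuffle (ldq a p) q + shuffle p (ldq a q)"])
  fix u v :: "'a list"
  show "ldq a (shuffle (word u) (word v)) =
      shuffle (ldq a (word u)) (word v) + shuffle (word u) (ldq a (word v))"
    by (cases u; cases v) (auto simp: ldq_add)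
qed (auto intro!: qlinearI simp: shuffle_lin ldq_add ldq_scale scale_add)

lemma lookup_shuffle_Nil:
  "Poly_Mapping.lookup (shuffle p q) [] = Poly_Mapping.lookup p [] * Poly_Mapping.lookup q []"
proof -
  let ?c = "\<lambda>r. Poly_Mapping.single [] (Poly_Mapping.lookup r []) :: 'a ncpoly"
  have c: "?c r = scale (Poly_Mapping.lookup r []) (word [])" for r :: "'a ncpoly"
    by (rule poly_mapping_eqI) (simp add: lookup_word lookup_single when_def)
  have "?c (shuffle p q) = shuffle (?c p) (?c q)"
  proof (rule bilinear_eqI[where F = "\<lambda>p q. ?c (shuffle p q)" and G = "\<lambda>p q. shuffle (?c p) (?c q)"])
    fix u v :: "'a list"
    show "?c (shuffle (word u) (word v)) = shuffle (?c (word u)) (?c (word v))"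
      unfolding c by (cases u; cases v) (auto simp: lookup_word lookup_add shuffle_lin)
  qed (auto intro!: qlinearI simp: shuffle_lin lookup_add single_add c scale_left_add scale_add
      distrib_left distrib_right mult_ac)
  then have "Poly_Mapping.lookup (?c (shuffle p q)) [] = Poly_Mapping.lookup (shuffle (?c p) (?c q)) []"
    by (rule arg_cong)
  then show ?thesis
    unfolding c shuffle_lin by (simp add: lookup_word)
qed

lemma shuffle_commute: "shuffle p q = shuffle q p"
proof (rule bilinear_eqI[where F = shuffle and G = "\<lambda>p q. shuffle q p"])
  fix u v :: "'a list"
  show "shuffle (word u) (word v) = shuffle (word v) (word u)"
    by (simp, induction u v rule: shuffle_word.induct) (auto simp: add_ac)
qed (auto intro!: qlinearI simp: shuffle_lin)

text \<open>
  Taking left quotients reduces associativity for three words to instances with a shorter word.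
\<close>

lemma shuffle_assoc: "shuffle (shuffle p q) r = shuffle p (shuffle q r)"
proof -
  have w: "shuffle (shuffle (word u) (word v)) (word w) = shuffle (word u) (shuffle (word v) (word w))"
    for u v w :: "'a list"
  proof (induction "length u + length v + length w" arbitrary: u v w rule: less_induct)
    case less
    show ?case
    proof (rule ncpoly_eq_ldqI)
      fix a
      have "shuffle (shuffle (ldq a (word u)) (word v)) (word w)
          = shuffle (ldq a (word u)) (shuffle (word v) (word w))"
        using less[of "tl u" v w] by (cases u) auto
      moreover have "shuffle (shuffle (word u) (ldq a (word v))) (word w)
          = shuffle (word u) (shuffle (ldq a (word v)) (word w))"
        using less[of u "tl v" w] by (cases v) auto
      moreover have "shuffle (shuffle (word u) (word v)) (ldq a (word w))
          = shuffle (word u) (shuffle (word v) (ldq a (word w)))"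
        using less[of u v "tl w"] by (cases w) auto
      ultimately show "ldq a (shuffle (shuffle (word u) (word v)) (word w))
          = ldq a (shuffle (word u) (shuffle (word v) (word w)))"
        unfolding ldq_shuffle shuffle_lin by (simp only: add_ac)
    qed (simp add: lookup_shuffle_Nil del: shuffle_words)
  qed
  show ?thesis
  proof (rule qlinear_eqI[where F = "\<lambda>p. shuffle (shuffle p q) r" and G = "\<lambda>p. shuffle p (shuffle q r)"])
    fix u
    show "shuffle (shuffle (word u) q) r = shuffle (word u) (shuffle q r)"
      by (rule bilinear_eqI[where F = "\<lambda>q r. shuffle (shuffle (word u) q) r"
            and G = "\<lambda>q r. shuffle (word u) (shuffle q r)"])
         (auto intro!: qlinearI simp: shuffle_lin w simp del: shuffle_words)
  qed (auto intro!: qlinearI simp: shuffle_lin)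
qed

section \<open>The swap of words in the letters with upper entry one\<close>

text \<open>
  The recursion is the one that gives the left quotients of \<open>ins d w\<close> at once: its left quotient by
  \<open>y\<close> is \<open>w\<close> or zero, and its left quotient by \<open>x\<close> involves only a smaller \<open>d\<close> or a shorter \<open>w\<close>.
\<close>

fun ins :: "nat \<Rightarrow> xy list \<Rightarrow> xy ncpoly" where
  "ins d w =
     (case d of 0 \<Rightarrow> word (Ly # w) | Suc e \<Rightarrow> scale (of_nat d) (lmul Lx (ins e w)))
     + (case w of Lx # v \<Rightarrow> lmul Lx (ins d v) | _ \<Rightarrow> 0)"

declare ins.simps [simp del]

lemma ins_cases:
  "ins d w = (if d = 0 then word (Ly # w) else scale (of_nat d) (lmul Lx (ins (d - 1) w)))
     + (if w \<noteq> [] \<and> hd w = Lx then lmul Lx (ins d (tl w)) else 0)"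
  by (subst ins.simps) (auto split: nat.splits list.splits xy.splits)

text \<open>
  In closed form \<open>x\<^sup>n y v\<close> is sent to \<open>d! \<Sum> (a + d choose d) x\<^bsup>a+d\<^esup> y x\<^sup>b y v\<close>, summed over
  \<open>a + b = n\<close>. The numbers are the coefficients of \<open>S\<^sup>n Y\<^sup>d / d!\<close> in \<open>(S + Y)\<^bsup>a+d\<^esup> S\<^sup>b\<close>. Here \<open>S\<close> and \<open>S + Y\<close> stand
  for two consecutive upper arguments \<open>Y\<^sub>1 + \<dots> + Y\<^sub>j\<close> and \<open>Y\<^sub>1 + \<dots> + Y\<^bsub>j+1\<^esub>\<close> of the swap.
\<close>

definition insert_y :: "nat \<Rightarrow> xy ncpoly \<Rightarrow> xy ncpoly" where
  "insert_y d = lin_ext (ins d)"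

lemma insert_y_add: "insert_y d (p + q) = insert_y d p + insert_y d q"
  and insert_y_scale: "insert_y d (scale c p) = scale c (insert_y d p)"
  and insert_y_0 [simp]: "insert_y d 0 = 0"
  and insert_y_word: "insert_y d (word w) = ins d w"
  by (simp_all add: insert_y_def lin_ext_add lin_ext_scale)

lemma ldq_x_insert_y:
  "ldq Lx (insert_y d p) = scale (of_nat d) (insert_y (d - 1) p) + insert_y d (ldq Lx p)"
proof (rule qlinear_eqI[where F = "\<lambda>p. ldq Lx (insert_y d p)"
      and G = "\<lambda>p. scale (of_nat d) (insert_y (d - 1) p) + insert_y d (ldq Lx p)"])
  fix w
  show "ldq Lx (insert_y d (word w))
      = scale (of_nat d) (insert_y (d - 1) (word w)) + insert_y d (ldq Lx (word w))"
    by (cases w) (auto simp: insert_y_word ins_cases[of d] ldq_add ldq_scale)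
qed (auto intro!: qlinearI simp: ldq_add ldq_scale insert_y_add insert_y_scale scale_add mult_ac add_ac)

lemma ldq_y_insert_y: "ldq Ly (insert_y d p) = (if d = 0 then p else 0)"
proof (rule qlinear_eqI[where F = "\<lambda>p. ldq Ly (insert_y d p)" and G = "\<lambda>p. if d = 0 then p else 0"])
  fix w
  show "ldq Ly (insert_y d (word w)) = (if d = 0 then word w else 0)"
    by (auto simp: insert_y_word ins_cases[of d] ldq_add ldq_scale)
qed (auto intro!: qlinearI simp: ldq_add ldq_scale insert_y_add insert_y_scale)

lemma lookup_insert_y_Nil [simp]: "Poly_Mapping.lookup (insert_y d p) [] = 0"
proof -
  have "Poly_Mapping.lookup (ins d w) [] = 0" for w
    by (subst ins.simps) (auto simp: lookup_add lookup_word split: nat.splits list.splits xy.splits)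
  then show ?thesis by (simp add: insert_y_def lookup_lin_ext)
qed

text \<open>
  Both sides have no constant term, and their left quotients by \<open>y\<close> agree at once. The
  left quotients by \<open>x\<close> differ by a combination of instances of the same identity
  for smaller \<open>d\<close>, \<open>e\<close> or shorter words, so induction finishes the proof.
\<close>

lemma shuffle_insert_y:
  "shuffle (insert_y d p) (insert_y e q) =
     insert_y d (shuffle p (insert_y e q)) + insert_y e (shuffle (insert_y d p) q)"
proof -
  have w: "shuffle (insert_y d (word u)) (insert_y e (word v)) =
     insert_y d (shuffle (word u) (insert_y e (word v)))
     + insert_y e (shuffle (insert_y d (word u)) (word v))" for u v
  proof (induction "d + e + length u + length v" arbitrary: d e u v rule: less_induct)
    case less
    let ?L = "\<lambda>d e p q. shuffle (insert_y d p) (insert_y e q) =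
     insert_y d (shuffle p (insert_y e q)) + insert_y e (shuffle (insert_y d p) q)"
    have 1: "scale (of_nat d) (shuffle (insert_y (d - 1) (word u)) (insert_y e (word v))) =
       scale (of_nat d) (insert_y (d - 1) (shuffle (word u) (insert_y e (word v)))
        + insert_y e (shuffle (insert_y (d - 1) (word u)) (word v)))"
      using less[of "d - 1" e u v] by (cases d) auto
    have 2: "scale (of_nat e) (shuffle (insert_y d (word u)) (insert_y (e - 1) (word v))) =
       scale (of_nat e) (insert_y d (shuffle (word u) (insert_y (e - 1) (word v)))
        + insert_y (e - 1) (shuffle (insert_y d (word u)) (word v)))"
      using less[of d "e - 1" u v] by (cases e) auto
    have 3: "?L d e (ldq Lx (word u)) (word v)"
      using less[of d e "tl u" v] by (cases u) auto
    have 4: "?L d e (word u) (ldq Lx (word v))"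
      using less[of d e u "tl v"] by (cases v) auto
    show ?case
    proof (rule ncpoly_eq_ldqI)
      fix a
      show "ldq a (shuffle (insert_y d (word u)) (insert_y e (word v))) =
        ldq a (insert_y d (shuffle (word u) (insert_y e (word v)))
          + insert_y e (shuffle (insert_y d (word u)) (word v)))"
      proof (cases a)
        case Lx
        show ?thesis
          unfolding Lx
          using 1 2 3 4
          by (simp only: ldq_shuffle ldq_add ldq_x_insert_y shuffle_lin insert_y_add insert_y_scale
              scale_add add_ac)
      next
        case Ly
        show ?thesis
          unfolding Ly by (auto simp: ldq_shuffle ldq_add ldq_y_insert_y)
      qed
    qed (simp add: lookup_shuffle_Nil lookup_add)
  qed
  show ?thesis
    by (rule bilinear_eqI[where F = "\<lambda>p q. shuffle (insert_y d p) (insert_y e q)"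
          and G = "\<lambda>p q. insert_y d (shuffle p (insert_y e q)) + insert_y e (shuffle (insert_y d p) q)"])
       (auto intro!: qlinearI simp: w shuffle_lin insert_y_add insert_y_scale scale_add
        )
qed

text \<open>
  The list holds the lower entries in reverse order: the last variable occurs only in the first
  upper argument of the swap, so it is inserted last.
\<close>

fun tau :: "nat list \<Rightarrow> xy ncpoly" where
  "tau [] = word []"
| "tau (d # ds) = insert_y d (tau ds)"

lemma tau_lmul: "lin_ext tau (lmul d p) = insert_y d (lin_ext tau p)"
  by (rule qlinear_eqI[where F = "\<lambda>p. lin_ext tau (lmul d p)" and G = "\<lambda>p. insert_y d (lin_ext tau p)"])
     (auto intro!: qlinearI simp: lin_ext_add lin_ext_scale lmul_add lmul_scale insert_y_add insert_y_scale)

lemma tau_shuffle: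
  "lin_ext tau (shuffle p q) = shuffle (lin_ext tau p) (lin_ext tau q)"
proof (rule bilinear_eqI[where F = "\<lambda>p q. lin_ext tau (shuffle p q)"
      and G = "\<lambda>p q. shuffle (lin_ext tau p) (lin_ext tau q)"])
  fix u v
  show "lin_ext tau (shuffle (word u) (word v)) = shuffle (lin_ext tau (word u)) (lin_ext tau (word v))"
    by (simp, induction u v rule: shuffle_word.induct)
       (simp_all add: lin_ext_add tau_lmul shuffle_insert_y)
qed (auto intro!: qlinearI simp: shuffle_lin lin_ext_add lin_ext_scale)

text \<open>
  These are the coefficients that appear when a variable is removed from \<open>(S + Y)\<^sup>a\<close>; compare
  \<open>lookup_power_shift\<close>.
\<close>

lemma lookup_insert_y:
  "Poly_Mapping.lookup (insert_y d p) (replicate a Lx @ Ly # w) =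
     (if d \<le> a then fact d * of_nat (a choose d) * Poly_Mapping.lookup p (replicate (a - d) Lx @ w)
      else 0)"
proof (induction a arbitrary: d p)
  case 0
  have "Poly_Mapping.lookup (insert_y d p) (Ly # w) = Poly_Mapping.lookup (ldq Ly (insert_y d p)) w"
    by (simp add: lookup_ldq)
  then show ?case by (auto simp: ldq_y_insert_y)
next
  case (Suc a)
  have "Poly_Mapping.lookup (insert_y d p) (replicate (Suc a) Lx @ Ly # w)
      = Poly_Mapping.lookup (ldq Lx (insert_y d p)) (replicate a Lx @ Ly # w)"
    by (simp add: lookup_ldq)
  also have "\<dots> = of_nat d * Poly_Mapping.lookup (insert_y (d - 1) p) (replicate a Lx @ Ly # w)
      + Poly_Mapping.lookup (insert_y d (ldq Lx p)) (replicate a Lx @ Ly # w)"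
    by (simp add: ldq_x_insert_y lookup_add)
  also have "\<dots> = (if d \<le> Suc a then fact d * of_nat (Suc a choose d)
      * Poly_Mapping.lookup p (replicate (Suc a - d) Lx @ w) else 0)"
  proof (cases d)
    case 0
    then show ?thesis by (simp add: Suc.IH lookup_ldq)
  next
    case (Suc e)
    have l: "Lx # replicate (a - Suc e) Lx @ w = replicate (a - e) Lx @ w" if "Suc e \<le> a"
      using that by (cases "a - e") (auto simp: Suc_diff_le dest: Suc_diff_Suc[symmetric])
    show ?thesis
      unfolding Suc.IH by (auto simp: Suc lookup_ldq Suc_diff_le algebra_simps l binomial_eq_0)
  qed
  finally show ?case .
qed

definition xy_words :: "nat \<Rightarrow> xy list set" where
  "xy_words n = {xy_word ks | ks. ks \<in> lists {1..} \<and> length ks = n}"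

lemma xy_word_Nil [simp]: "xy_word [] = []"
  by (simp add: xy_word_def)

lemma Ly_xy_words: "w \<in> xy_words n \<Longrightarrow> Ly # w \<in> xy_words (Suc n)"
  unfolding xy_words_def
  by clarify (rule exI[of _ "1 # ks" for ks], auto simp: xy_word_Cons)

lemma Lx_xy_words:
  assumes "w \<in> xy_words (Suc n)"
  shows "Lx # w \<in> xy_words (Suc n)"
proof -
  from assms obtain k ks where "1 \<le> k" "ks \<in> lists {1..}" "length ks = n" "w = xy_word (k # ks)"
    by (fastforce simp: xy_words_def length_Suc_conv)
  then show ?thesis unfolding xy_words_def
    by (intro CollectI exI[of _ "Suc k # ks"]) (cases k, auto simp: xy_word_Cons)
qed

lemma Lx_xy_wordsD:
  assumes "Lx # w \<in> xy_words n"
  shows "w \<in> xy_words n"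
proof -
  from assms obtain ks where ks: "ks \<in> lists {1..}" "length ks = n" "Lx # w = xy_word ks"
    by (auto simp: xy_words_def)
  then obtain k ks' where e: "ks = k # ks'" by (cases ks) auto
  with ks have "k \<noteq> 1" by (auto simp: xy_word_Cons)
  with ks e have "w = xy_word ((k - 1) # ks')" "1 \<le> k - 1"
    by (cases "k - 1"; force simp: xy_word_Cons)+
  with ks e show ?thesis by (auto simp: xy_words_def intro!: exI[of _ "(k - 1) # ks'"])
qed

lemma lmul_keys_in:
  "p \<in> keys_in A \<Longrightarrow> (\<And>w. w \<in> A \<Longrightarrow> a # w \<in> B) \<Longrightarrow> lmul a p \<in> keys_in B"
  by (rule qsubspace_qlinear[of _ "lmul a"])
     (auto intro!: qlinearI simp: lmul_add lmul_scale dest: keys_inD)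

lemma ins_keys_in: "w \<in> xy_words n \<Longrightarrow> ins d w \<in> keys_in (xy_words (Suc n))"
proof (induction d w rule: ins.induct)
  case (1 d w)
  have a: "(case d of 0 \<Rightarrow> word (Ly # w) | Suc e \<Rightarrow> scale (of_nat d) (lmul Lx (ins e w)))
      \<in> keys_in (xy_words (Suc n))"
    using "1.IH"(1) "1.prems"
    by (cases d) (auto intro!: Ly_xy_words qsubspace_scale lmul_keys_in Lx_xy_words)
  have b: "(case w of Lx # v \<Rightarrow> lmul Lx (ins d v) | _ \<Rightarrow> 0) \<in> keys_in (xy_words (Suc n))"
    using "1.IH"(2) "1.prems"
    by (auto intro!: qsubspace_0 lmul_keys_in Lx_xy_words dest: Lx_xy_wordsD split: list.splits xy.splits)
  show ?case
    by (subst ins.simps) (intro qsubspace_add a b qsubspace_keys_in)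
qed

lemma tau_keys_in: "tau ds \<in> keys_in (xy_words (length ds))"
proof (induction ds)
  case Nil
  show ?case by (auto simp: xy_words_def intro!: exI[of _ "[]"])
next
  case (Cons d ds)
  then show ?case
    unfolding tau.simps insert_y_def length_Cons
    by (intro qsubspace_lin_ext qsubspace_keys_in ins_keys_in) (auto dest: keys_inD)
qed

text \<open>
  The argument lists the numbers \<open>k\<^sub>i - 1\<close>, the result is in terms of reversed lower entries. The signs
  and factorials are those of \<open>(X\<^sub>i - X\<^bsub>i+1\<^esub>)\<^sup>d / d!\<close>, the factors contributed by the lower arguments
  of the swap; thus this is the swap of a word with all lower entries zero.
\<close>

fun theta :: "nat list \<Rightarrow> nat ncpoly" where
  "theta [] = word []"
| "theta [a] = scale (1 / fact a) (word [a])"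
| "theta (a # b # as) =
     (\<Sum>j\<le>b. scale ((- 1) ^ j / (fact a * fact j)) (lmul (a + j) (theta ((b - j) # as))))"

text \<open>
  The left quotients by \<open>x\<close> of the summands are two-term expressions. With
  \<open>(a + j) / (a! j!) = 1 / ((a-1)! j!) + 1 / (a! (j-1)!)\<close> the sum of them telescopes to the same sum
  for \<open>a - 1\<close>, which allows induction on \<open>a\<close>.
\<close>

lemma insert_y_inversion:
  assumes "ldq Lx (word w) = 0"
  shows "(\<Sum>j\<le>b. scale ((- 1) ^ j / (fact a * fact j)) (insert_y (a + j) (word (replicate (b - j) Lx @ w))))
     = word (replicate a Lx @ Ly # replicate b Lx @ w)"
proof -
  \<comment> \<open>The last word with its first \<open>j\<close> letters \<open>x\<close> removed; zero once they are used up.\<close>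
  define U where "U = (\<lambda>j. if j \<le> b then word (replicate (b - j) Lx @ w) else 0)"
  define c where "c = (\<lambda>a j. (- 1) ^ j / (fact a * fact j) :: rat)"
  have U: "ldq Lx (U j) = U (Suc j)" if "j \<le> b" for j
  proof (cases "j = b")
    case True
    then show ?thesis using assms by (simp add: U_def)
  next
    case False
    then have "b - j = Suc (b - Suc j)" "Suc j \<le> b" using that by auto
    then show ?thesis by (simp add: U_def)
  qed
  have "(\<Sum>j\<le>b. scale (c a j) (insert_y (a + j) (U j)))
     = word (replicate a Lx @ Ly # replicate b Lx @ w)" (is "?S a = _")
  proof (induction a)
    case 0
    show ?case
    proof (rule ncpoly_eq_ldqI)
      fix l
      show "ldq l (?S 0) = ldq l (word (replicate 0 Lx @ Ly # replicate b Lx @ w))"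
      proof (cases l)
        case Ly
        have "ldq l (?S 0) = (\<Sum>j\<le>b. if j = 0 then word (replicate b Lx @ w) else 0)"
          unfolding Ly qlinear_sum[OF qlinear_ldq]
          by (intro sum.cong) (auto simp: ldq_scale ldq_y_insert_y c_def U_def)
        then show ?thesis by (simp add: Ly)
      next
        case Lx
        \<comment> \<open>Removing \<open>x\<close> from the first and from the second block of letters \<open>x\<close> gives
          consecutive values of \<open>D\<close>.\<close>
        define D where "D = (\<lambda>j. if j = 0 then 0 else scale (c 0 (j - 1)) (insert_y (j - 1) (U j)))"
        have "ldq Lx (?S 0) = (\<Sum>j\<le>b. D (Suc j) - D j)"
          unfolding qlinear_sum[OF qlinear_ldq]
        proof (intro sum.cong refl)
          fix j assume "j \<in> {..b}"
          then have "ldq Lx (scale (c 0 j) (insert_y (0 + j) (U j)))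
              = scale (c 0 j * of_nat j) (insert_y (j - 1) (U j)) + scale (c 0 j) (insert_y j (U (Suc j)))"
            by (simp add: ldq_scale ldq_x_insert_y U scale_add)
          moreover have "c 0 j * of_nat j = - c 0 (j - 1)" if "j \<noteq> 0"
            using that by (cases j) (auto simp: c_def simp del: of_nat_Suc)
          ultimately show "ldq Lx (scale (c 0 j) (insert_y (0 + j) (U j))) = D (Suc j) - D j"
            by (auto simp: D_def intro!: poly_mapping_eqI simp: lookup_add lookup_minus)
        qed
        also have "\<dots> = D (Suc b) - D 0"
          by (simp add: sum_lessThan_telescope flip: lessThan_Suc_atMost)
        finally show ?thesis by (simp add: Lx D_def U_def)
      qed
    qed (simp add: lookup_sum lookup_word)
  next
    case (Suc a)
    show ?case
    proof (rule ncpoly_eq_ldqI)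
      fix l
      show "ldq l (?S (Suc a)) = ldq l (word (replicate (Suc a) Lx @ Ly # replicate b Lx @ w))"
      proof (cases l)
        case Ly
        show ?thesis
          unfolding Ly qlinear_sum[OF qlinear_ldq]
          by (simp add: ldq_scale ldq_y_insert_y)
      next
        case Lx
        \<comment> \<open>As before, up to the summands for \<open>a\<close>.\<close>
        define D where "D = (\<lambda>j. if j = 0 then 0 else scale (c (Suc a) (j - 1)) (insert_y (a + j) (U j)))"
        have "ldq Lx (?S (Suc a)) = (\<Sum>j\<le>b. scale (c a j) (insert_y (a + j) (U j)) + (D (Suc j) - D j))"
          unfolding qlinear_sum[OF qlinear_ldq]
        proof (intro sum.cong refl)
          fix j assume "j \<in> {..b}"
          then have e1: "ldq Lx (scale (c (Suc a) j) (insert_y (Suc a + j) (U j)))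
              = scale (c (Suc a) j * of_nat (Suc a + j)) (insert_y (a + j) (U j))
                + scale (c (Suc a) j) (insert_y (Suc a + j) (U (Suc j)))"
            by (simp add: ldq_scale ldq_x_insert_y U scale_add)
          have e2: "c (Suc a) j * of_nat (Suc a + j)
              = c a j - (if j = 0 then 0 else c (Suc a) (j - 1))"
          proof (cases j)
            case 0
            then show ?thesis by (simp add: c_def del: of_nat_Suc)
          next
            case (Suc i)
            have "- s * (A + I) / (A * F * (I * G)) = - s / (F * (I * G)) - s / (A * F * G)"
              if "A \<noteq> 0" "I \<noteq> 0" "F \<noteq> 0" "G \<noteq> 0" for s A I F G :: rat
              using that by (simp add: field_simps)
            from this[of "of_nat (Suc a)" "of_nat (Suc i)" "fact a" "fact i" "(- 1) ^ i"]
            show ?thesis by (simp add: c_def Suc add_ac)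
          qed
          show "ldq Lx (scale (c (Suc a) j) (insert_y (Suc a + j) (U j)))
              = scale (c a j) (insert_y (a + j) (U j)) + (D (Suc j) - D j)"
            unfolding e1 e2
            by (auto simp: D_def left_diff_distrib lookup_add lookup_minus intro!: poly_mapping_eqI)
        qed
        also have "\<dots> = ?S a + (D (Suc b) - D 0)"
          unfolding sum.distrib by (simp add: sum_lessThan_telescope flip: lessThan_Suc_atMost)
        also have "D (Suc b) - D 0 = 0"
          by (simp add: D_def U_def)
        finally show ?thesis by (simp add: Lx Suc)
      qed
    qed (simp add: lookup_sum lookup_word)
  qed
  moreover have "?S a = (\<Sum>j\<le>b. scale (c a j) (insert_y (a + j) (word (replicate (b - j) Lx @ w))))"
    by (intro sum.cong) (auto simp: U_def)
  ultimately show ?thesis by (simp add: c_def)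
qed

lemma tau_theta: "lin_ext tau (theta as) = word (xy_word (map Suc as))"
proof (induction as rule: theta.induct)
  case (2 a)
  show ?case
    using insert_y_inversion[of "[]" a 0] by (simp add: lin_ext_scale xy_word_Cons)
next
  case (3 a b as)
  have "lin_ext tau (theta (a # b # as))
      = (\<Sum>j\<le>b. scale ((- 1) ^ j / (fact a * fact j))
           (insert_y (a + j) (word (replicate (b - j) Lx @ Ly # xy_word (map Suc as)))))"
    unfolding theta.simps lin_ext_sum
    by (intro sum.cong refl) (simp add: lin_ext_scale tau_lmul 3 xy_word_Cons)
  also have "\<dots> = word (xy_word (map Suc (a # b # as)))"
    by (subst insert_y_inversion) (simp_all add: xy_word_Cons)
  finally show ?case .
qed simp

lemma theta_keys_in: "theta as \<in> keys_in {ds. length ds = length as \<and> (as \<noteq> [] \<longrightarrow> hd as \<le> hd ds)}"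
proof (induction as rule: theta.induct)
  case (3 a b as)
  show ?case
    unfolding theta.simps
    by (intro qsubspace_sum qsubspace_scale qsubspace_keys_in lmul_keys_in[OF 3]) auto
qed (auto intro!: qsubspace_scale)

lemma lookup_theta_Cons:
  "Poly_Mapping.lookup (theta (a # b # as)) (u # us) =
     (if a \<le> u \<and> u - a \<le> b
      then (- 1) ^ (u - a) / (fact a * fact (u - a)) * Poly_Mapping.lookup (theta ((b - (u - a)) # as)) us
      else 0)"
proof -
  have "Poly_Mapping.lookup (theta (a # b # as)) (u # us) =
    (\<Sum>j\<le>b. if j = u - a then (if a \<le> u then (- 1) ^ (u - a) / (fact a * fact (u - a))
        * Poly_Mapping.lookup (theta ((b - (u - a)) # as)) us else 0) else 0)"
    unfolding theta.simps lookup_sum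
    by (intro sum.cong) auto
  then show ?thesis by (simp add: sum.delta')
qed

section \<open>Coefficients of the swapped generating series\<close>

definition free_of :: "gvar \<Rightarrow> gpoly \<Rightarrow> bool" where
  "free_of v P \<longleftrightarrow> (\<forall>m. Poly_Mapping.lookup m v \<noteq> 0 \<longrightarrow> Poly_Mapping.lookup P m = 0)"

lemma free_of_add: "free_of v P \<Longrightarrow> free_of v Q \<Longrightarrow> free_of v (P + Q)"
  and free_of_uminus: "free_of v P \<Longrightarrow> free_of v (- P)"
  and free_of_diff: "free_of v P \<Longrightarrow> free_of v Q \<Longrightarrow> free_of v (P - Q)"
  and free_of_scale: "free_of v P \<Longrightarrow> free_of v (scale c P)"
  and free_of_0: "free_of v 0"
  by (auto simp: free_of_def lookup_add lookup_minus)

lemma free_of_mult: "free_of v P \<Longrightarrow> free_of v Q \<Longrightarrow> free_of v (P * Q)"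
proof -
  assume PQ: "free_of v P" "free_of v Q"
  show ?thesis
    unfolding free_of_def
  proof (intro allI impI, rule ccontr)
    fix m assume m: "Poly_Mapping.lookup m v \<noteq> 0" "Poly_Mapping.lookup (P * Q) m \<noteq> 0"
    then have "m \<in> Poly_Mapping.keys (P * Q)" by (simp add: in_keys_iff)
    then obtain a b where "a \<in> Poly_Mapping.keys P" "b \<in> Poly_Mapping.keys Q" "m = a + b"
      using keys_mult[of P Q] by blast
    then show False using m(1) PQ by (auto simp: free_of_def in_keys_iff lookup_add)
  qed
qed

lemma free_of_1: "free_of v 1"
  by (auto simp: free_of_def lookup_one when_def)

lemma free_of_power: "free_of v P \<Longrightarrow> free_of v (P ^ n)"
  by (induction n) (auto simp: free_of_1 free_of_mult)

lemma free_of_sum: "(\<And>x. x \<in> S \<Longrightarrow> free_of v (f x)) \<Longrightarrow> free_of v (sum f S)"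
  by (induction S rule: infinite_finite_induct) (auto simp: free_of_0 free_of_add)

lemma free_of_gvar: "u \<noteq> v \<Longrightarrow> free_of v (gvar_poly u)"
  by (auto simp: free_of_def gvar_poly_def lookup_single when_def)

lemmas free_of_intros = free_of_add free_of_uminus free_of_diff free_of_scale free_of_0 free_of_mult
  free_of_1 free_of_power free_of_sum free_of_gvar

lemma gvar_poly_power: "gvar_poly v ^ n = Poly_Mapping.single (Poly_Mapping.single v n) 1"
  by (induction n) (auto simp: gvar_poly_def mult_single simp flip: single_add)

lemma gpoly_expand:
  "P = (\<Sum>m\<in>Poly_Mapping.keys P. Poly_Mapping.single m (Poly_Mapping.lookup P m))"
  by (rule poly_mapping_eqI)
     (auto simp: lookup_sum lookup_single when_def in_keys_iff cong: if_cong)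

lemma lookup_gvar_power_mult:
  "Poly_Mapping.lookup (gvar_poly v ^ n * P) m =
     (if n \<le> Poly_Mapping.lookup m v then Poly_Mapping.lookup P (m - Poly_Mapping.single v n) else 0)"
proof -
  have "gvar_poly v ^ n * P = (\<Sum>k\<in>Poly_Mapping.keys P.
      Poly_Mapping.single (Poly_Mapping.single v n + k) (Poly_Mapping.lookup P k))"
    by (subst (1) gpoly_expand[of P]) (simp add: gvar_poly_power sum_distrib_left mult_single)
  then have *: "Poly_Mapping.lookup (gvar_poly v ^ n * P) m
      = (\<Sum>k\<in>Poly_Mapping.keys P. if Poly_Mapping.single v n + k = m then Poly_Mapping.lookup P k else 0)"
    by (simp add: lookup_sum lookup_single when_def)
  have "Poly_Mapping.single v n + k = m \<longleftrightarrow>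
      n \<le> Poly_Mapping.lookup m v \<and> k = m - Poly_Mapping.single v n" for k
    by (auto simp: poly_mapping_eq_iff fun_eq_iff lookup_add lookup_minus lookup_single when_def)
  then show ?thesis
    unfolding * by (simp add: in_keys_iff cong: if_cong)
qed

definition erase :: "gvar \<Rightarrow> gmonom \<Rightarrow> gmonom" where
  "erase v m = m - Poly_Mapping.single v (Poly_Mapping.lookup m v)"

lemma lookup_erase: "Poly_Mapping.lookup (erase v m) u = (if u = v then 0 else Poly_Mapping.lookup m u)"
  by (auto simp: erase_def lookup_minus lookup_single when_def)

lemma lookup_of_nat_mult: "Poly_Mapping.lookup (of_nat c * (P :: gpoly)) m = of_nat c * Poly_Mapping.lookup P m"
  by (induction c) (auto simp: lookup_add algebra_simps)

lemma lookup_minus_1_power_mult: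
  "Poly_Mapping.lookup ((- 1) ^ c * (P :: gpoly)) m = (- 1) ^ c * Poly_Mapping.lookup P m"
  by (induction c) auto

text \<open>
  In the swapped generating series each variable, taken in the right order, occurs in a single
  remaining factor. Coefficients can therefore be extracted one variable at a time.
\<close>

lemma lookup_power_shift:
  assumes "free_of v F" "free_of v G"
  shows "Poly_Mapping.lookup ((F + gvar_poly v) ^ n * G) m =
     of_nat (n choose Poly_Mapping.lookup m v)
     * Poly_Mapping.lookup (F ^ (n - Poly_Mapping.lookup m v) * G) (erase v m)"
proof -
  let ?d = "Poly_Mapping.lookup m v"
  have "(F + gvar_poly v) ^ n * G
      = (\<Sum>k\<le>n. of_nat (n choose k) * (gvar_poly v ^ k * (F ^ (n - k) * G)))"
    by (simp add: add.commute[of F] binomial_ring sum_distrib_right mult.assoc)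
  then have "Poly_Mapping.lookup ((F + gvar_poly v) ^ n * G) m
      = (\<Sum>k\<le>n. of_nat (n choose k) * (if k \<le> ?d
           then Poly_Mapping.lookup (F ^ (n - k) * G) (m - Poly_Mapping.single v k) else 0))"
    by (simp only: lookup_sum lookup_of_nat_mult lookup_gvar_power_mult)
  also have "\<dots> = (\<Sum>k\<le>n. if k = ?d then of_nat (n choose ?d)
      * Poly_Mapping.lookup (F ^ (n - ?d) * G) (erase v m) else 0)"
  proof (intro sum.cong refl)
    fix k
    have "Poly_Mapping.lookup (F ^ (n - k) * G) (m - Poly_Mapping.single v k) = 0" if "k < ?d"
    proof -
      have "free_of v (F ^ (n - k) * G)" by (intro free_of_intros assms)
      then show ?thesis using that by (auto simp: free_of_def lookup_minus)
    qed
    then show "of_nat (n choose k) * (if k \<le> ?d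
           then Poly_Mapping.lookup (F ^ (n - k) * G) (m - Poly_Mapping.single v k) else 0)
       = (if k = ?d then of_nat (n choose ?d)
      * Poly_Mapping.lookup (F ^ (n - ?d) * G) (erase v m) else 0)"
      by (auto simp: erase_def)
  qed
  finally show ?thesis by (auto simp: binomial_eq_0)
qed

fun y_prod :: "nat list \<Rightarrow> gpoly" where
  "y_prod [] = 1"
| "y_prod (k # ks) = (\<Sum>i=1..Suc (length ks). gvar_poly (VY i)) ^ (k - 1) * y_prod ks"

lemma free_of_y_prod: "(\<And>i. 1 \<le> i \<Longrightarrow> i \<le> length ks \<Longrightarrow> v \<noteq> VY i) \<Longrightarrow> free_of v (y_prod ks)"
proof (induction ks)
  case (Cons k ks)
  have "free_of v (gvar_poly (VY i))" if "i \<in> {1..Suc (length ks)}" for i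
    using Cons.prems[of i] that by (intro free_of_gvar) auto
  then have "free_of v (\<Sum>i=1..Suc (length ks). gvar_poly (VY i))" by (rule free_of_sum)
  then show ?case
    unfolding y_prod.simps using Cons by (intro free_of_mult free_of_power) auto
qed (simp add: free_of_1)

text \<open>
  The extra power of \<open>Y\<^sub>1 + \<dots> + Y\<^sub>q\<close> makes the induction work. Removing \<open>Y\<^sub>q\<close> leaves a power of
  \<open>Y\<^sub>1 + \<dots> + Y\<^bsub>q-1\<^esub>\<close>, which merges with the next factor; on the side of words, \<open>insert_y\<close> leaves
  letters \<open>x\<close> that merge with the next block of letters \<open>x\<close>. The factor \<open>H\<close> will be the product of
  the linear forms in the \<open>X\<^sub>i\<close>.
\<close>

lemma lookup_y_prod:
  assumes "\<And>i. 1 \<le> i \<Longrightarrow> i \<le> length ks \<Longrightarrow> free_of (VY i) H"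
    and "\<And>v. Poly_Mapping.lookup m' v = (if v \<in> VY ` {1..length ks} then 0 else Poly_Mapping.lookup m v)"
  shows "(\<Prod>i=1..length ks. fact (Poly_Mapping.lookup m (VY i)))
      * Poly_Mapping.lookup ((\<Sum>i=1..length ks. gvar_poly (VY i)) ^ n * (y_prod ks * H)) m
    = Poly_Mapping.lookup (tau (map (\<lambda>i. Poly_Mapping.lookup m (VY i)) (rev [1..<Suc (length ks)])))
        (replicate n Lx @ xy_word ks) * Poly_Mapping.lookup H m'"
  using assms
proof (induction ks arbitrary: n m)
  case Nil
  then have "m' = m" by (intro poly_mapping_eqI) simp
  then show ?case by (cases n) (simp_all add: lookup_word)
next
  case (Cons k ks)
  let ?q = "Suc (length ks)"
  let ?S = "\<Sum>i=1..length ks. gvar_poly (VY i)"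
  let ?d = "Poly_Mapping.lookup m (VY ?q)" and ?m = "erase (VY ?q) m"
  let ?N = "n + (k - 1)"
  have S: "(\<Sum>i=1..?q. gvar_poly (VY i)) = ?S + gvar_poly (VY ?q)" by simp
  have "Poly_Mapping.lookup ((\<Sum>i=1..?q. gvar_poly (VY i)) ^ n * (y_prod (k # ks) * H)) m
      = Poly_Mapping.lookup ((?S + gvar_poly (VY ?q)) ^ ?N * (y_prod ks * H)) m"
    unfolding S y_prod.simps by (simp add: power_add mult_ac)
  also have "\<dots> = of_nat (?N choose ?d) * Poly_Mapping.lookup (?S ^ (?N - ?d) * (y_prod ks * H)) ?m"
  proof (rule lookup_power_shift)
    show "free_of (VY ?q) ?S" by (intro free_of_sum free_of_gvar) auto
    show "free_of (VY ?q) (y_prod ks * H)"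
      using Cons.prems(1)[of ?q] by (intro free_of_mult free_of_y_prod) auto
  qed
  finally have 1: "Poly_Mapping.lookup ((\<Sum>i=1..?q. gvar_poly (VY i)) ^ n * (y_prod (k # ks) * H)) m
      = of_nat (?N choose ?d) * Poly_Mapping.lookup (?S ^ (?N - ?d) * (y_prod ks * H)) ?m" .
  have m: "Poly_Mapping.lookup ?m (VY i) = Poly_Mapping.lookup m (VY i)" if "i \<le> length ks" for i
    using that by (simp add: lookup_erase)
  have 2: "(\<Prod>i=1..length ks. fact (Poly_Mapping.lookup m (VY i)))
      * Poly_Mapping.lookup (?S ^ (?N - ?d) * (y_prod ks * H)) ?m
    = Poly_Mapping.lookup (tau (map (\<lambda>i. Poly_Mapping.lookup m (VY i)) (rev [1..<?q])))
        (replicate (?N - ?d) Lx @ xy_word ks) * Poly_Mapping.lookup H m'"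
  proof -
    have "(\<Prod>i=1..length ks. fact (Poly_Mapping.lookup ?m (VY i)))
      * Poly_Mapping.lookup (?S ^ (?N - ?d) * (y_prod ks * H)) ?m
    = Poly_Mapping.lookup (tau (map (\<lambda>i. Poly_Mapping.lookup ?m (VY i)) (rev [1..<?q])))
        (replicate (?N - ?d) Lx @ xy_word ks) * Poly_Mapping.lookup H m'"
    proof (rule Cons.IH)
      show "free_of (VY i) H" if "1 \<le> i" "i \<le> length ks" for i
        using that by (intro Cons.prems(1)) auto
      show "Poly_Mapping.lookup m' v = (if v \<in> VY ` {1..length ks} then 0 else Poly_Mapping.lookup ?m v)" for v
        using Cons.prems(2)[of v] by (cases v) (auto simp: lookup_erase image_iff le_Suc_eq Suc_le_eq)
    qed
    moreover have "(\<Prod>i=1..length ks. fact (Poly_Mapping.lookup ?m (VY i)) :: rat)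
        = (\<Prod>i=1..length ks. fact (Poly_Mapping.lookup m (VY i)))"
      by (intro prod.cong) (auto simp: m)
    moreover have "map (\<lambda>i. Poly_Mapping.lookup ?m (VY i)) (rev [1..<?q])
        = map (\<lambda>i. Poly_Mapping.lookup m (VY i)) (rev [1..<?q])"
      by (intro map_cong refl m) auto
    ultimately show ?thesis by (simp only:)
  qed
  have 3: "replicate n Lx @ xy_word (k # ks) = replicate ?N Lx @ Ly # xy_word ks"
    by (simp add: xy_word_Cons replicate_add)
  have "Poly_Mapping.lookup (tau (map (\<lambda>i. Poly_Mapping.lookup m (VY i)) (rev [1..<Suc ?q])))
        (replicate n Lx @ xy_word (k # ks))
      = fact ?d * of_nat (?N choose ?d)
        * Poly_Mapping.lookup (tau (map (\<lambda>i. Poly_Mapping.lookup m (VY i)) (rev [1..<?q])))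
        (replicate (?N - ?d) Lx @ xy_word ks)"
    unfolding 3 by (simp add: lookup_insert_y binomial_eq_0)
  with 2 show ?case
    unfolding list.size add_Suc_right add_0_right 1 by (simp add: algebra_simps)
qed

text \<open>
  The value zero beyond \<open>r\<close> realizes the convention \<open>X\<^bsub>r+1\<^esub> = 0\<close>.
\<close>

definition x_var :: "nat \<Rightarrow> nat \<Rightarrow> gpoly" where
  "x_var r i = (if i \<le> r then gvar_poly (VX i) else 0)"

fun x_prod :: "nat \<Rightarrow> nat list \<Rightarrow> gpoly" where
  "x_prod r [] = 1"
| "x_prod r (u # us) = scale (1 / fact u)
     ((x_var r (r - length us) - x_var r (Suc r - length us)) ^ u * x_prod r us)"

lemma free_of_x_var: "v \<noteq> VX i \<Longrightarrow> free_of v (x_var r i)"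
  by (auto simp: x_var_def intro!: free_of_gvar free_of_0)

lemma free_of_x_prod:
  "length us \<le> r \<Longrightarrow> (\<And>i. r < i + length us \<Longrightarrow> i \<le> r \<Longrightarrow> v \<noteq> VX i) \<Longrightarrow> free_of v (x_prod r us)"
proof (induction us)
  case (Cons u us)
  have 1: "free_of v (x_var r (r - length us))"
    using Cons.prems(1) by (intro free_of_x_var Cons.prems(2)) auto
  have 2: "free_of v (x_var r (Suc r - length us))"
  proof (cases "us = []")
    case True
    then show ?thesis by (simp add: x_var_def free_of_0)
  next
    case False
    then show ?thesis using Cons.prems(1) by (intro free_of_x_var Cons.prems(2)) (cases us; auto)+
  qed
  have 3: "free_of v (x_prod r us)" using Cons.prems by (intro Cons.IH) auto
  show ?case unfolding x_prod.simps by (intro free_of_intros 1 2 3)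
qed (simp add: free_of_1)

lemma lookup_power_shift_diff:
  assumes "free_of v F" "free_of v G"
  shows "Poly_Mapping.lookup (gvar_poly v ^ n * ((gvar_poly v - F) ^ u * G)) m =
     (if n \<le> Poly_Mapping.lookup m v
      then (- 1) ^ (u - (Poly_Mapping.lookup m v - n)) * of_nat (u choose (Poly_Mapping.lookup m v - n))
        * Poly_Mapping.lookup (F ^ (u - (Poly_Mapping.lookup m v - n)) * G) (erase v m)
      else 0)"
proof (cases "n \<le> Poly_Mapping.lookup m v")
  case True
  let ?m = "m - Poly_Mapping.single v n"
  have e: "erase v ?m = erase v m"
    by (rule poly_mapping_eqI) (simp add: lookup_erase lookup_minus lookup_single when_def)
  have "Poly_Mapping.lookup (gvar_poly v ^ n * ((gvar_poly v - F) ^ u * G)) m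
      = Poly_Mapping.lookup ((- F + gvar_poly v) ^ u * G) ?m"
    using True by (simp add: lookup_gvar_power_mult)
  also have "\<dots> = of_nat (u choose Poly_Mapping.lookup ?m v)
     * Poly_Mapping.lookup ((- F) ^ (u - Poly_Mapping.lookup ?m v) * G) (erase v ?m)"
    by (intro lookup_power_shift assms free_of_uminus)
  also have "(- F) ^ (u - Poly_Mapping.lookup ?m v) * G
      = (- 1) ^ (u - Poly_Mapping.lookup ?m v) * (F ^ (u - Poly_Mapping.lookup ?m v) * G)"
    by (subst power_minus) (simp add: mult_ac)
  finally show ?thesis
    using True by (simp add: lookup_minus lookup_minus_1_power_mult e del: diff_diff_right)
next
  case False
  then show ?thesis by (simp add: lookup_gvar_power_mult)
qed

text \<open>
  Again the extra power is what is left of the previous factor: extracting a power of \<open>X\<^sub>s\<close> from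
  \<open>(X\<^sub>s - X\<^bsub>s+1\<^esub>)\<^sup>u\<close> leaves a power of \<open>X\<^bsub>s+1\<^esub>\<close>, which lowers the exponent wanted from the next factor.
\<close>

lemma lookup_x_prod_shifted:
  assumes "us \<noteq> []" "length us \<le> r" "s = Suc r - length us"
    and "\<And>i. s \<le> i \<Longrightarrow> i \<le> r \<Longrightarrow> free_of (VX i) H"
    and "\<And>v. Poly_Mapping.lookup m' v = (if v \<in> VX ` {s..r} then 0 else Poly_Mapping.lookup m v)"
  shows "Poly_Mapping.lookup (x_var r s ^ n * (x_prod r us * H)) m =
    (if n \<le> Poly_Mapping.lookup m (VX s)
     then Poly_Mapping.lookup (theta ((Poly_Mapping.lookup m (VX s) - n)
            # map (\<lambda>i. Poly_Mapping.lookup m (VX i)) [Suc s..<Suc r])) us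
     else 0) * Poly_Mapping.lookup H m'"
  using assms
proof (induction us arbitrary: n m s)
  case (Cons u us)
  let ?a = "Poly_Mapping.lookup m (VX s)" and ?m = "erase (VX s) m"
  have s: "r - length us = s" "Suc r - length us = Suc s" "s \<le> r"
    using Cons.prems by (auto simp: Suc_diff_le)
  have "Poly_Mapping.lookup (x_var r s ^ n * (x_prod r (u # us) * H)) m
      = 1 / fact u * Poly_Mapping.lookup (gvar_poly (VX s) ^ n *
          ((gvar_poly (VX s) - x_var r (Suc s)) ^ u * (x_prod r us * H))) m"
  proof -
    have "P * (scale c Q * H) = scale c (P * (Q * H))" for c and P Q :: gpoly
      unfolding scale_def mult_map_scale_conv_mult by (simp add: mult_ac)
    then have "x_var r s ^ n * (x_prod r (u # us) * H) = scale (1 / fact u)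
        (gvar_poly (VX s) ^ n * ((gvar_poly (VX s) - x_var r (Suc s)) ^ u * (x_prod r us * H)))"
      using s by (simp add: x_var_def mult.assoc)
    then show ?thesis by simp
  qed
  also have "Poly_Mapping.lookup (gvar_poly (VX s) ^ n *
          ((gvar_poly (VX s) - x_var r (Suc s)) ^ u * (x_prod r us * H))) m =
     (if n \<le> ?a
      then (- 1) ^ (u - (?a - n)) * of_nat (u choose (?a - n))
        * Poly_Mapping.lookup (x_var r (Suc s) ^ (u - (?a - n)) * (x_prod r us * H)) ?m
      else 0)"
  proof (rule lookup_power_shift_diff)
    show "free_of (VX s) (x_var r (Suc s))" by (rule free_of_x_var) simp
    show "free_of (VX s) (x_prod r us * H)"
      using Cons.prems(2) s by (intro free_of_mult free_of_x_prod Cons.prems(4)) auto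
  qed
  finally have 1: "Poly_Mapping.lookup (x_var r s ^ n * (x_prod r (u # us) * H)) m
     = (if n \<le> ?a
      then (- 1) ^ (u - (?a - n)) * (of_nat (u choose (?a - n)) / fact u)
        * Poly_Mapping.lookup (x_var r (Suc s) ^ (u - (?a - n)) * (x_prod r us * H)) ?m
      else 0)" by simp
  show ?case
  proof (cases "us = []")
    case True
    then have [simp]: "r = s" using s by simp
    have "?m = m'"
      by (rule poly_mapping_eqI) (auto simp: lookup_erase Cons.prems(5))
    then show ?thesis
      unfolding 1 using True
      by (cases "u - (?a - n)") (auto simp: x_var_def lookup_word binomial_eq_0 le_less)
  next
    case False
    then obtain u' us' where us: "us = u' # us'" by (cases us) auto
    have sr: "Suc s \<le> r" using s us Cons.prems(2) by auto
    have upt: "[Suc s..<Suc r] = Suc s # [Suc (Suc s)..<Suc r]"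
      using sr by (simp add: upt_conv_Cons)
    let ?b = "Poly_Mapping.lookup m (VX (Suc s))"
    have "Poly_Mapping.lookup (x_var r (Suc s) ^ (u - (?a - n)) * (x_prod r us * H)) ?m
      = (if u - (?a - n) \<le> Poly_Mapping.lookup ?m (VX (Suc s))
     then Poly_Mapping.lookup (theta ((Poly_Mapping.lookup ?m (VX (Suc s)) - (u - (?a - n)))
            # map (\<lambda>i. Poly_Mapping.lookup ?m (VX i)) [Suc (Suc s)..<Suc r])) us
     else 0) * Poly_Mapping.lookup H m'"
    proof (rule Cons.IH[OF False])
      show "length us \<le> r" using Cons.prems by simp
      show "Suc s = Suc r - length us" using s by simp
      show "free_of (VX i) H" if "Suc s \<le> i" "i \<le> r" for i using that by (intro Cons.prems(4)) auto
      show "Poly_Mapping.lookup m' v = (if v \<in> VX ` {Suc s..r} then 0 else Poly_Mapping.lookup ?m v)" for v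
        using s(3) by (auto simp: Cons.prems(5) lookup_erase image_iff le_Suc_eq not_less_eq_eq)
    qed
    also have "map (\<lambda>i. Poly_Mapping.lookup ?m (VX i)) [Suc (Suc s)..<Suc r]
        = map (\<lambda>i. Poly_Mapping.lookup m (VX i)) [Suc (Suc s)..<Suc r]"
      by (auto simp: lookup_erase)
    finally have 2: "Poly_Mapping.lookup (x_var r (Suc s) ^ (u - (?a - n)) * (x_prod r us * H)) ?m
      = (if u - (?a - n) \<le> ?b
     then Poly_Mapping.lookup (theta ((?b - (u - (?a - n)))
            # map (\<lambda>i. Poly_Mapping.lookup m (VX i)) [Suc (Suc s)..<Suc r])) us
     else 0) * Poly_Mapping.lookup H m'"
      by (simp add: lookup_erase)
    have 3: "of_nat (u choose (?a - n)) / fact u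
        = (if ?a - n \<le> u then 1 / (fact (?a - n) * fact (u - (?a - n))) else (0 :: rat))"
      by (simp add: binomial_fact binomial_eq_0)
    show ?thesis
      unfolding 1 2 3 upt list.map lookup_theta_Cons
      by (auto simp del: diff_diff_right upt_Suc theta.simps)
  qed
qed simp

lemma lookup_x_prod:
  assumes "length us \<le> r"
    and "\<And>i. r < i + length us \<Longrightarrow> i \<le> r \<Longrightarrow> free_of (VX i) H"
    and "\<And>v. Poly_Mapping.lookup m' v = (if v \<in> VX ` {Suc r - length us..r} then 0 else Poly_Mapping.lookup m v)"
  shows "Poly_Mapping.lookup (x_prod r us * H) m =
    Poly_Mapping.lookup (theta (map (\<lambda>i. Poly_Mapping.lookup m (VX i)) [Suc r - length us..<Suc r])) us
     * Poly_Mapping.lookup H m'"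
proof (cases "us = []")
  case True
  then have "m' = m" using assms(3) by (intro poly_mapping_eqI) auto
  then show ?thesis using True by (simp add: lookup_word)
next
  case False
  have u: "[Suc r - length us..<Suc r] = (Suc r - length us) # [Suc (Suc r - length us)..<Suc r]"
    using False by (intro upt_conv_Cons) auto
  have "Poly_Mapping.lookup (x_var r (Suc r - length us) ^ 0 * (x_prod r us * H)) m =
    (if 0 \<le> Poly_Mapping.lookup m (VX (Suc r - length us))
     then Poly_Mapping.lookup (theta ((Poly_Mapping.lookup m (VX (Suc r - length us)) - 0)
            # map (\<lambda>i. Poly_Mapping.lookup m (VX i)) [Suc (Suc r - length us)..<Suc r])) us
     else 0) * Poly_Mapping.lookup H m'"
    by (rule lookup_x_prod_shifted[OF False assms(1) refl]) (use assms in auto)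
  then show ?thesis by (simp add: u del: upt_Suc)
qed

text \<open>
  The words of \<open>(\<A>\<^sup>1)\<^sup>*(\<A>\<^sub>0)\<^sup>*\<close>. Since the letter \<open>(1, 0)\<close> belongs to both alphabets, a word has
  several such forms; the three lengths determine at most one.
\<close>

definition block :: "nat list \<Rightarrow> nat \<Rightarrow> nat list \<Rightarrow> (nat \<times> nat) list" where
  "block ds l ks = map (Pair 1) ds @ replicate l (1, 0) @ map (\<lambda>k. (k, 0)) ks"

lemma length_block [simp]: "length (block ds l ks) = length ds + l + length ks"
  by (simp add: block_def)

lemma block_biletters: "ks \<in> lists {1..} \<Longrightarrow> block ds l ks \<in> lists biletters"
  by (auto simp: block_def biletters_def)

lemma gen_summand_Nil [simp]: "gen_summand [] w = 1"
  by (simp add: gen_summand_def)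

lemma gen_summand_Cons:
  "gen_summand (pq # PQ) ((k, d) # w) = scale (1 / fact d) (fst pq ^ (k - 1) * snd pq ^ d) * gen_summand PQ w"
  by (cases pq) (simp add: gen_summand_def scale_def mult_map_scale_conv_mult mult_ac)

lemma gen_summand_append:
  "length PQ = length w \<Longrightarrow> gen_summand (PQ @ PQ') (w @ w') = gen_summand PQ w * gen_summand PQ' w'"
  by (simp add: gen_summand_def)

lemma gen_summand_ones: "gen_summand PQ (replicate (length PQ) (1, 0)) = 1"
  by (induction PQ) (simp_all add: gen_summand_Cons)

definition swap_arg :: "nat \<Rightarrow> nat \<Rightarrow> gpoly \<times> gpoly" where
  "swap_arg r j = (\<Sum>i=1..r + 1 - j. gvar_poly (VY i),
               if j = 1 then gvar_poly (VX r)
               else gvar_poly (VX (r + 1 - j)) - gvar_poly (VX (r + 2 - j)))"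

lemma swap_args_map: "swap_args r = map (swap_arg r) [1..<Suc r]"
  by (simp add: swap_args_def swap_arg_def)

lemma gen_summand_y_prod:
  "length ks \<le> r \<Longrightarrow> gen_summand (map (swap_arg r) [Suc r - length ks..<Suc r]) (map (\<lambda>k. (k, 0)) ks)
     = y_prod ks"
proof (induction ks)
  case (Cons k ks)
  have u: "[Suc r - length (k # ks)..<Suc r] = (r - length ks) # [Suc r - length ks..<Suc r]"
    using Cons.prems by (simp add: upt_conv_Cons Suc_diff_le del: upt_Suc)
  show ?case
    unfolding u using Cons by (simp add: gen_summand_Cons swap_arg_def Suc_diff_le del: upt_Suc)
qed simp

lemma gen_summand_x_prod:
  "length us \<le> r \<Longrightarrow> gen_summand (map (swap_arg r) [1..<Suc (length us)]) (map (Pair 1) (rev us))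
     = x_prod r us"
proof (induction us)
  case (Cons u us)
  have s: "snd (swap_arg r (Suc (length us))) = x_var r (r - length us) - x_var r (Suc r - length us)"
    using Cons.prems by (cases us) (auto simp: swap_arg_def x_var_def)
  have upt: "[1..<Suc (length (u # us))] = [1..<Suc (length us)] @ [Suc (length us)]" by simp
  have "gen_summand (map (swap_arg r) [1..<Suc (length (u # us))]) (map (Pair 1) (rev (u # us)))
      = gen_summand (map (swap_arg r) [1..<Suc (length us)]) (map (Pair 1) (rev us))
        * gen_summand [swap_arg r (Suc (length us))] [(1, u)]"
    unfolding upt by (simp add: gen_summand_append del: upt_Suc)
  also have "\<dots> = x_prod r (u # us)"
    using Cons by (simp add: gen_summand_Cons s scale_def mult_map_scale_conv_mult mult_ac)
  finally show ?case .
qed simp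

lemma gen_summand_block:
  assumes "r = length us + l + length ks"
  shows "gen_summand (swap_args r) (block (rev us) l ks) = y_prod ks * x_prod r us"
proof -
  have u: "[1..<Suc r] = [1..<Suc (length us)] @ [Suc (length us)..<Suc (length us) + l]
      @ [Suc r - length ks..<Suc r]"
    unfolding assms by (metis (no_types, lifting) add_Suc diff_add_inverse2 le_add1 plus_1_eq_Suc upt_add_eq_append add.assoc append_assoc)
  have m: "gen_summand (map (swap_arg r) [Suc (length us)..<Suc (length us) + l]) (replicate l (1, 0)) = 1"
    using gen_summand_ones[of "map (swap_arg r) [Suc (length us)..<Suc (length us) + l]"] by (simp del: upt_Suc)
  have "gen_summand (swap_args r) (block (rev us) l ks)
      = gen_summand (map (swap_arg r) [1..<Suc (length us)]) (map (Pair 1) (rev us))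
        * (gen_summand (map (swap_arg r) [Suc (length us)..<Suc (length us) + l]) (replicate l (1, 0))
           * gen_summand (map (swap_arg r) [Suc r - length ks..<Suc r]) (map (\<lambda>k. (k, 0)) ks))"
    unfolding swap_args_map u block_def map_append
    by (simp add: gen_summand_append del: upt_Suc)
  also have "\<dots> = x_prod r us * (1 * y_prod ks)"
    using gen_summand_x_prod[of us r] gen_summand_y_prod[of ks r] assms unfolding m by (simp del: upt_Suc)
  finally show ?thesis by (simp add: mult.commute)
qed

text \<open>
  Used to describe the monomial that remains when several variables have been removed, independently
  of the order of removal.
\<close>

lemma ex_erased:
  assumes "finite V"
  shows "\<exists>m'. \<forall>v. Poly_Mapping.lookup m' v = (if v \<in> V then 0 else Poly_Mapping.lookup (m :: gmonom) v)"
  using assms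
proof (induction V)
  case (insert u V)
  then obtain m' where "\<forall>v. Poly_Mapping.lookup m' v = (if v \<in> V then 0 else Poly_Mapping.lookup m v)"
    by blast
  then show ?case by (intro exI[of _ "erase u m'"]) (simp add: lookup_erase)
qed auto

text \<open>
  In the series for a block word the first part contributes only variables \<open>X\<^sub>i\<close> with large \<open>i\<close>, the
  last part only variables \<open>Y\<^sub>i\<close> with small \<open>i\<close>, and the middle part nothing.
\<close>

lemma lookup_gen_summand_block:
  assumes r: "r = length us + l + length ks"
  shows "(\<Prod>i=1..length ks. fact (Poly_Mapping.lookup m (VY i)))
      * Poly_Mapping.lookup (gen_summand (swap_args r) (block (rev us) l ks)) m
    = Poly_Mapping.lookup (tau (map (\<lambda>i. Poly_Mapping.lookup m (VY i)) (rev [1..<Suc (length ks)]))) (xy_word ks)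
      * Poly_Mapping.lookup (theta (map (\<lambda>i. Poly_Mapping.lookup m (VX i)) [Suc r - length us..<Suc r])) us
      * (if \<forall>v. v \<notin> VY ` {1..length ks} \<longrightarrow> v \<notin> VX ` {Suc r - length us..r} \<longrightarrow> Poly_Mapping.lookup m v = 0
         then 1 else 0)"
proof -
  let ?V = "VY ` {1..length ks}" and ?W = "VX ` {Suc r - length us..r}"
  obtain m' where m': "\<And>v. Poly_Mapping.lookup m' v = (if v \<in> ?V then 0 else Poly_Mapping.lookup m v)"
    using ex_erased[of ?V m] by auto
  obtain m'' where m'': "\<And>v. Poly_Mapping.lookup m'' v = (if v \<in> ?W then 0 else Poly_Mapping.lookup m' v)"
    using ex_erased[of ?W m'] by auto
  have "(\<Prod>i=1..length ks. fact (Poly_Mapping.lookup m (VY i)))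
      * Poly_Mapping.lookup ((\<Sum>i=1..length ks. gvar_poly (VY i)) ^ 0 * (y_prod ks * (x_prod r us * 1))) m
    = Poly_Mapping.lookup (tau (map (\<lambda>i. Poly_Mapping.lookup m (VY i)) (rev [1..<Suc (length ks)])))
        (replicate 0 Lx @ xy_word ks) * Poly_Mapping.lookup (x_prod r us * 1) m'"
    by (intro lookup_y_prod free_of_mult free_of_x_prod free_of_1 m') (use r in auto)
  moreover have "Poly_Mapping.lookup (x_prod r us * 1) m' =
    Poly_Mapping.lookup (theta (map (\<lambda>i. Poly_Mapping.lookup m' (VX i)) [Suc r - length us..<Suc r])) us
     * Poly_Mapping.lookup 1 m''"
    by (intro lookup_x_prod free_of_1 m'') (use r in auto)
  moreover have "map (\<lambda>i. Poly_Mapping.lookup m' (VX i)) [Suc r - length us..<Suc r]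
      = map (\<lambda>i. Poly_Mapping.lookup m (VX i)) [Suc r - length us..<Suc r]"
    by (intro map_cong refl) (auto simp: m')
  moreover have "Poly_Mapping.lookup 1 m'' = (if \<forall>v. v \<notin> ?V \<longrightarrow> v \<notin> ?W \<longrightarrow> Poly_Mapping.lookup m v = 0
      then 1 else (0::rat))"
  proof -
    have "m'' = 0 \<longleftrightarrow> (\<forall>v. v \<notin> ?V \<longrightarrow> v \<notin> ?W \<longrightarrow> Poly_Mapping.lookup m v = 0)"
      unfolding poly_mapping_eq_iff fun_eq_iff m'' m' by auto
    then show ?thesis by (simp add: lookup_one when_def)
  qed
  ultimately show ?thesis
    unfolding gen_summand_block[OF r] by (simp only: power_0 mult_1_left mult_1_right replicate_0 append_Nil mult.assoc)
qed

lemma lookup_word_monom: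
  "Poly_Mapping.lookup (word_monom w) (VX i) = (if 1 \<le> i \<and> i \<le> length w then fst (w ! (i - 1)) - 1 else 0)"
  "Poly_Mapping.lookup (word_monom w) (VY i) = (if 1 \<le> i \<and> i \<le> length w then snd (w ! (i - 1)) else 0)"
proof -
  have "Poly_Mapping.lookup (word_monom w) (VX i)
      = (\<Sum>j=1..length w. if j = i then fst (w ! (i - 1)) - 1 else 0)"
    unfolding word_monom_def lookup_sum
    by (intro sum.cong) (auto simp: lookup_add lookup_single when_def)
  then show "Poly_Mapping.lookup (word_monom w) (VX i)
      = (if 1 \<le> i \<and> i \<le> length w then fst (w ! (i - 1)) - 1 else 0)"
    by simp
  have "Poly_Mapping.lookup (word_monom w) (VY i)
      = (\<Sum>j=1..length w. if j = i then snd (w ! (i - 1)) else 0)"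
    unfolding word_monom_def lookup_sum
    by (intro sum.cong) (auto simp: lookup_add lookup_single when_def)
  then show "Poly_Mapping.lookup (word_monom w) (VY i)
      = (if 1 \<le> i \<and> i \<le> length w then snd (w ! (i - 1)) else 0)"
    by simp
qed

lemma length_swap_args [simp]: "length (swap_args r) = r"
  by (simp add: swap_args_def)

lemma lookup_swap_word:
  "Poly_Mapping.lookup (swap_word w) w' =
     (if w' \<in> lists biletters \<and> length w' = length w
      then (\<Prod>(k, d)\<leftarrow>w. fact d) * Poly_Mapping.lookup (gen_summand (swap_args (length w)) w') (word_monom w)
      else 0)"
proof -
  have "Poly_Mapping.lookup (gen_coeff (swap_args r) m) w' =
     (if w' \<in> lists biletters \<and> length w' = r then Poly_Mapping.lookup (gen_summand (swap_args r) w') m else 0)"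
    for r m
  proof -
    let ?W = "{w. w \<in> lists biletters \<and> length w = length (swap_args r) \<and>
              Poly_Mapping.lookup (gen_summand (swap_args r) w) m \<noteq> 0}"
    have "Poly_Mapping.lookup (gen_coeff (swap_args r) m) w' =
      (\<Sum>w\<in>?W. if w = w' then Poly_Mapping.lookup (gen_summand (swap_args r) w') m else 0)"
      unfolding gen_coeff_def lookup_sum by (intro sum.cong) (auto simp: lookup_word)
    also have "\<dots> = (if w' \<in> ?W then Poly_Mapping.lookup (gen_summand (swap_args r) w') m else 0)"
      using finite_swap_support[of r m] by (simp add: sum.delta)
    finally show ?thesis by auto
  qed
  then show ?thesis by (simp add: swap_word_def)
qed

text \<open>
  This and the next lemma say that the swap preserves the shape of block words and exchanges the
  lengths of the outer parts: the coefficients are those of \<open>tau\<close> on one part and \<open>theta\<close> on the other.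
\<close>

lemma swap_coeff_block:
  assumes "ks \<in> lists {1..}" "length ds = length ks" "length as = length us"
  shows "Poly_Mapping.lookup (swap_word (block ds l (map Suc as))) (block (rev us) l ks)
     = Poly_Mapping.lookup (tau (rev ds)) (xy_word ks) * Poly_Mapping.lookup (theta as) us"
proof -
  let ?w = "block ds l (map Suc as)" and ?q = "length ks"
  let ?r = "length us + l + ?q" and ?m = "word_monom ?w"
  have r: "length ?w = ?r" using assms by simp
  have Y: "Poly_Mapping.lookup ?m (VY i) = (if 1 \<le> i \<and> i \<le> ?q then ds ! (i - 1) else 0)" for i
    using assms unfolding lookup_word_monom r by (auto simp: block_def nth_append)
  have X: "Poly_Mapping.lookup ?m (VX i) = (if Suc (?q + l) \<le> i \<and> i \<le> ?r then as ! (i - Suc (?q + l)) else 0)" for i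
    using assms unfolding lookup_word_monom r by (auto simp: block_def nth_append)
  have 1: "map (\<lambda>i. Poly_Mapping.lookup ?m (VY i)) (rev [1..<Suc ?q]) = rev ds"
    unfolding rev_map[symmetric] using assms(2)
    by (intro arg_cong[where f = rev] nth_equalityI) (auto simp: Y simp del: upt_Suc)
  have 2: "map (\<lambda>i. Poly_Mapping.lookup ?m (VX i)) [Suc ?r - length us..<Suc ?r] = as"
    using assms(3) by (intro nth_equalityI) (auto simp: X simp del: upt_Suc)
  have 3: "(\<Prod>(k, d)\<leftarrow>?w. fact d) = (\<Prod>i=1..?q. fact (Poly_Mapping.lookup ?m (VY i)) :: rat)"
  proof -
    have "(\<Prod>i=1..?q. fact (Poly_Mapping.lookup ?m (VY i)) :: rat) = (\<Prod>i<?q. fact (ds ! i))"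
      by (rule prod.reindex_bij_witness[of _ Suc "\<lambda>i. i - 1"]) (auto simp: Y)
    also have "\<dots> = (\<Prod>d\<leftarrow>ds. fact d)"
      using assms(2) by (simp add: prod.list_conv_set_nth atLeast0LessThan)
    also have "\<dots> = (\<Prod>(k, d)\<leftarrow>?w. fact d)"
    proof -
      have "(\<Prod>x\<leftarrow>as. 1 :: rat) = 1" for as :: "nat list" by (induction as) auto
      then show ?thesis by (simp add: block_def o_def)
    qed
    finally show ?thesis by simp
  qed
  have 4: "\<forall>v. v \<notin> VY ` {1..?q} \<longrightarrow> v \<notin> VX ` {Suc ?r - length us..?r} \<longrightarrow> Poly_Mapping.lookup ?m v = 0"
  proof (intro allI impI)
    fix v assume "v \<notin> VY ` {1..?q}" "v \<notin> VX ` {Suc ?r - length us..?r}"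
    then show "Poly_Mapping.lookup ?m v = 0" by (cases v) (auto simp: X Y)
  qed
  have "block (rev us) l ks \<in> lists biletters" using assms(1) by (rule block_biletters)
  then show ?thesis
    unfolding lookup_swap_word r 3
    using lookup_gen_summand_block[of ?r us l ks ?m] 4 unfolding 1 2 by simp
qed

lemma swap_coeff_block_0:
  assumes "w \<in> lists biletters" "length w = length us + l + length ks"
    and "\<And>ds as. length ds = length ks \<Longrightarrow> length as = length us \<Longrightarrow> w \<noteq> block ds l (map Suc as)"
  shows "Poly_Mapping.lookup (swap_word w) (block (rev us) l ks) = 0"
proof -
  let ?q = "length ks" and ?r = "length w" and ?m = "word_monom w"
  have False if z: "\<forall>v. v \<notin> VY ` {1..?q} \<longrightarrow> v \<notin> VX ` {Suc ?r - length us..?r} \<longrightarrow> Poly_Mapping.lookup ?m v = 0"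
  proof -
    have pos: "1 \<le> fst (w ! i)" if "i < ?r" for i
      using assms(1) nth_mem[OF that] by (auto simp: biletters_def in_lists_conv_set split_beta)
    have k: "fst (w ! i) = 1" if "i < ?q + l" for i
      using z[rule_format, of "VX (Suc i)"] pos[of i] that assms(2) by (auto simp: lookup_word_monom image_iff)
    have d: "snd (w ! i) = 0" if "?q \<le> i" "i < ?r" for i
      using z[rule_format, of "VY (Suc i)"] that by (auto simp: lookup_word_monom image_iff)
    have "w = block (map snd (take ?q w)) l (map Suc (map (\<lambda>kd. fst kd - 1) (drop (?q + l) w)))"
    proof (rule nth_equalityI)
      fix i assume i: "i < length w"
      show "w ! i = block (map snd (take ?q w)) l (map Suc (map (\<lambda>kd. fst kd - 1) (drop (?q + l) w))) ! i"
      proof -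
        consider "i < ?q" | "?q \<le> i" "i < ?q + l" | "?q + l \<le> i" by linarith
        then show ?thesis
        proof cases
          case 1
          then show ?thesis
            using i assms(2) k[of i] by (simp add: block_def nth_append prod_eq_iff)
        next
          case 2
          then have "i - ?q < l" by linarith
          with 2 show ?thesis
            using i assms(2) k[of i] d[of i] by (simp add: block_def nth_append prod_eq_iff)
        next
          case 3
          then have "\<not> i - ?q < l" by linarith
          with 3 show ?thesis
            using i assms(2) d[of i] pos[of i] by (simp add: block_def nth_append prod_eq_iff)
        qed
      qed
    qed (use assms(2) in auto)
    then show False
      using assms(3)[of "map snd (take ?q w)" "map (\<lambda>kd. fst kd - 1) (drop (?q + l) w)"] assms(2) by simp
  qed
  then have "(\<Prod>i=1..?q. fact (Poly_Mapping.lookup ?m (VY i)))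
      * Poly_Mapping.lookup (gen_summand (swap_args ?r) (block (rev us) l ks)) ?m = 0"
    unfolding lookup_gen_summand_block[OF assms(2)] by auto
  then have "Poly_Mapping.lookup (gen_summand (swap_args ?r) (block (rev us) l ks)) ?m = 0"
    by simp
  then show ?thesis by (simp add: lookup_swap_word)
qed

text \<open>
  The coefficients in the swap of a word with all upper entries one are taken at monomials without
  any \<open>X\<^sub>i\<close>. The lower arguments of the generating series are linear forms in the \<open>X\<^sub>i\<close>, so words
  with a positive lower entry do not occur in such a swap.
\<close>

definition x_divisible :: "gpoly set" where
  "x_divisible = {P. \<forall>m. Poly_Mapping.lookup P m \<noteq> 0 \<longrightarrow> (\<exists>i. Poly_Mapping.lookup m (VX i) \<noteq> 0)}"

lemma x_divisible_mult: "P \<in> x_divisible \<Longrightarrow> P * Q \<in> x_divisible"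
proof -
  assume P: "P \<in> x_divisible"
  have "\<exists>i. Poly_Mapping.lookup m (VX i) \<noteq> 0" if m: "Poly_Mapping.lookup (P * Q) m \<noteq> 0" for m
  proof -
    have "m \<in> Poly_Mapping.keys (P * Q)" using m by (simp add: in_keys_iff)
    then obtain a b where "a \<in> Poly_Mapping.keys P" "m = a + b" using keys_mult[of P Q] by blast
    then show ?thesis using P by (fastforce simp: x_divisible_def in_keys_iff lookup_add)
  qed
  then show ?thesis by (simp add: x_divisible_def)
qed

lemma gen_summand_x_divisible:
  assumes "length PQ = length w" "\<And>P Q. (P, Q) \<in> set PQ \<Longrightarrow> Q \<in> x_divisible" "\<exists>kd\<in>set w. snd kd \<noteq> 0"
  shows "gen_summand PQ w \<in> x_divisible"
  using assms
proof (induction PQ w rule: list_induct2)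
  case (Cons pq PQ kd w)
  obtain P Q k d where e: "pq = (P, Q)" "kd = (k, d)" by (cases pq, cases kd)
  show ?case
  proof (cases d)
    case 0
    with Cons e have "gen_summand PQ w \<in> x_divisible" by auto
    then show ?thesis
      unfolding e gen_summand_Cons by (subst mult.commute) (rule x_divisible_mult)
  next
    case (Suc d')
    have "gen_summand (pq # PQ) (kd # w) = Q * (scale (1 / fact d) (P ^ (k - 1) * Q ^ d') * gen_summand PQ w)"
      by (simp add: e Suc gen_summand_Cons scale_def mult_map_scale_conv_mult mult_ac)
    then show ?thesis using Cons.prems(1)[of P Q] by (simp add: e x_divisible_mult)
  qed
qed simp

lemma swap_args_x_divisible: "(P, Q) \<in> set (swap_args r) \<Longrightarrow> Q \<in> x_divisible"
proof -
  have 1: "gvar_poly (VX i) \<in> x_divisible" for i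
    by (auto simp: x_divisible_def gvar_poly_def lookup_single when_def)
  have 2: "P - Q \<in> x_divisible" if "P \<in> x_divisible" "Q \<in> x_divisible" for P Q
    using that unfolding x_divisible_def by (auto simp: lookup_minus) (metis diff_0_right)
  show "(P, Q) \<in> set (swap_args r) \<Longrightarrow> Q \<in> x_divisible"
    by (auto simp: swap_args_def intro!: 1 2)
qed

lemma swap_coeff_lower_0:
  assumes "\<exists>kd\<in>set w'. snd kd \<noteq> 0"
  shows "Poly_Mapping.lookup (swap_word (map (Pair 1) ds)) w' = 0"
proof (cases "length w' = length ds")
  case True
  have "gen_summand (swap_args (length ds)) w' \<in> x_divisible"
    using assms swap_args_x_divisible True by (intro gen_summand_x_divisible) auto
  then have "Poly_Mapping.lookup P m = 0 \<or> (\<exists>i. Poly_Mapping.lookup m (VX i) \<noteq> 0)"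
    if "P = gen_summand (swap_args (length ds)) w'" for P m
    using that unfolding x_divisible_def by blast
  moreover have "\<not> (\<exists>i. Poly_Mapping.lookup (word_monom (map (Pair 1) ds)) (VX i) \<noteq> 0)"
    by (auto simp: lookup_word_monom)
  ultimately have "Poly_Mapping.lookup (gen_summand (swap_args (length ds)) w') (word_monom (map (Pair 1) ds)) = 0"
    by blast
  then show ?thesis by (simp add: lookup_swap_word)
qed (simp add: lookup_swap_word)

section \<open>Ideals of the stuffle algebra\<close>

definition pos_words :: "nat list set" where
  "pos_words = lists {1..}"

definition decode :: "xy ncpoly \<Rightarrow> nat ncpoly" where
  "decode = lin_ext (\<lambda>w. word (inv_into (pos_words) xy_word w))"

lemma qlinear_decode: "qlinear decode" and qlinear_H1_to_QA: "qlinear H1_to_QA"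
  and qlinear_xy_embed: "qlinear xy_embed"
  by (simp_all add: decode_def H1_to_QA_def xy_embed_def qlinear_lin_ext)

lemma carrier_stuffle_alg: "carrier (stuffle_alg A) = keys_in (lists A)"
  by (simp add: stuffle_alg_def free_alg_keys_in)

lemma Nil_pos_words [simp]: "[] \<in> pos_words"
  by (simp add: pos_words_def)

lemma carrier_H1: "carrier H1 = keys_in pos_words"
  by (simp add: carrier_stuffle_alg pos_words_def)

lemma inv_xy_word: "ks \<in> pos_words \<Longrightarrow> inv_into pos_words xy_word (xy_word ks) = ks"
  using inv_into_f_f[OF inj_on_xy_word] by (simp add: pos_words_def)

lemma ends_y_image: "ends_y = xy_word ` pos_words"
  using xy_word_image by (simp add: pos_words_def)

lemma decode_word [simp]: "ks \<in> pos_words \<Longrightarrow> decode (word (xy_word ks)) = word ks"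
  using inv_xy_word by (simp add: decode_def)

lemma decode_in_H1: "p \<in> keys_in ends_y \<Longrightarrow> decode p \<in> keys_in pos_words"
  by (rule qsubspace_qlinear[OF qsubspace_keys_in qlinear_decode])
     (auto simp: ends_y_image dest!: keys_inD)

lemma qlinear_comp: "qlinear F \<Longrightarrow> qlinear G \<Longrightarrow> qlinear (\<lambda>p. F (G p))"
  by (simp add: qlinear_def)

lemma qlinear_id: "qlinear (\<lambda>p. p)"
  by (simp add: qlinear_def)

lemma xy_embed_word [simp]: "xy_embed (word ks) = word (xy_word ks)"
  by (simp add: xy_embed_def)

lemma xy_embed_decode: "p \<in> keys_in ends_y \<Longrightarrow> xy_embed (decode p) = p"
  by (rule qlinear_eqI[OF qlinear_comp[OF qlinear_xy_embed qlinear_decode] qlinear_id])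
     (auto simp: ends_y_image dest!: keys_inD)

lemma decode_xy_embed: "p \<in> keys_in pos_words \<Longrightarrow> decode (xy_embed p) = p"
  by (rule qlinear_eqI[OF qlinear_comp[OF qlinear_decode qlinear_xy_embed] qlinear_id])
     (auto dest!: keys_inD)

lemma H1_shuffle_decode:
  assumes "p \<in> keys_in (pos_words)" "q \<in> keys_in (pos_words)"
  shows "H1_shuffle p q = decode (shuffle (xy_embed p) (xy_embed q))"
  using H1_shuffle[of p q, unfolded carrier_H1] decode_xy_embed[of "H1_shuffle p q"] assms
  by simp

lemma shuffle_in_ends_y:
  assumes "p \<in> keys_in ends_y" "q \<in> keys_in ends_y"
  shows "shuffle p q \<in> keys_in ends_y"
  unfolding shuffle_def bilin_ext_def
  by (intro qsubspace_lin_ext qsubspace_keys_in)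
     (use assms shuffle_word_ends_y in \<open>fastforce simp: keys_in_def\<close>)

lemma xy_words_ends_y: "xy_words n \<subseteq> ends_y"
  unfolding xy_words_def ends_y_image pos_words_def by blast

lemma tau_ends_y: "lin_ext tau p \<in> keys_in ends_y"
  using tau_keys_in xy_words_ends_y
  by (intro qsubspace_lin_ext qsubspace_keys_in) (fastforce simp: keys_in_def)

lemma lookup_decode:
  assumes "p \<in> keys_in ends_y" "ks \<in> pos_words"
  shows "Poly_Mapping.lookup (decode p) ks = Poly_Mapping.lookup p (xy_word ks)"
  using lookup_xy_embed[of "decode p" ks, folded pos_words_def, unfolded carrier_H1] decode_in_H1[OF assms(1)] xy_embed_decode[OF assms(1)] assms(2)
  by simp

text \<open>
  Multiplication by the scalar \<open>c\<close> is the stuffle product with \<open>c\<close> times the empty word.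
\<close>

lemma qsubspace_ideal:
  assumes "ideal I (stuffle_alg A)"
  shows "qsubspace I"
proof -
  interpret ideal I "stuffle_alg A" by (rule assms)
  have "scale c p \<in> I" if "p \<in> I" for c p
  proof -
    have "scale c (word []) \<in> carrier (stuffle_alg A)"
      by (auto simp: carrier_stuffle_alg intro!: qsubspace_scale)
    from I_l_closed[OF that this] show ?thesis by (simp add: stuffle_alg_def stuffle_lin)
  qed
  then show ?thesis
    using additive_subgroup.a_closed[OF is_additive_subgroup] additive_subgroup.zero_closed[OF is_additive_subgroup]
    unfolding qsubspace_def by (simp add: stuffle_alg_def)
qed

lemma qsubspace_trans: "qsubspace V \<Longrightarrow> p - q \<in> V \<Longrightarrow> q - r \<in> V \<Longrightarrow> p - r \<in> V"
  using qsubspace_add[of V "p - q" "q - r"] by simp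

lemma qsubspace_sym: "qsubspace V \<Longrightarrow> p - q \<in> V \<Longrightarrow> q - p \<in> V"
  using qsubspace_diff[of V 0 "p - q"] qsubspace_0[of V] by simp

lemma ideal_stuffle:
  assumes "ideal I (stuffle_alg A)" "p \<in> I" "q \<in> keys_in (lists A)"
  shows "stuffle p q \<in> I" "stuffle q p \<in> I"
  using ideal.I_r_closed[OF assms(1,2)] ideal.I_l_closed[OF assms(1,2)] assms(3)
  by (simp_all add: stuffle_alg_def free_alg_keys_in)

lemma stuffle_diff: "stuffle (p - q) r = stuffle p r - stuffle q r" "stuffle r (p - q) = stuffle r p - stuffle r q"
  using qlinear_diff[OF qlinear_stuffle_left] qlinear_diff[OF qlinear_stuffle_right] by auto

lemma ideal_stuffle_cong:
  assumes "ideal I (stuffle_alg A)" "p - p' \<in> I" "q - q' \<in> I"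
    and "p' \<in> keys_in (lists A)" "q \<in> keys_in (lists A)"
  shows "stuffle p q - stuffle p' q' \<in> I"
proof -
  have "stuffle p q - stuffle p' q' = stuffle (p - p') q + stuffle p' (q - q')"
    by (simp add: stuffle_diff)
  moreover have "stuffle (p - p') q \<in> I" "stuffle p' (q - q') \<in> I"
    using ideal_stuffle[OF assms(1)] assms(2-5) by blast+
  ultimately show ?thesis
    using qsubspace_add[OF qsubspace_ideal[OF assms(1)]] by simp
qed

lemma quotient_zero_iff:
  assumes "ideal I R" "x \<in> carrier R"
  shows "I +>\<^bsub>R\<^esub> x = \<zero>\<^bsub>R Quot I\<^esub> \<longleftrightarrow> x \<in> I"
proof -
  interpret ideal I R by (rule assms(1))
  show ?thesis
    using rcos_const_imp_mem[OF assms(2)] a_coset_join2[OF assms(2) is_additive_subgroup[THEN additive_subgroup.a_subgroup]]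
    by (auto simp: FactRing_def a_rcos_const)
qed

section \<open>The shuffle relations hold\<close>

text \<open>
  The kernel of the composed projection to \<open>\<Z>\<^sup>f\<close>, which allows computing in \<open>\<rat>\<langle>\<A>\<rangle>\<close> instead of in
  two successive quotients.
\<close>

definition zeta_ideal :: "(nat \<times> nat) ncpoly set" where
  "zeta_ideal = {p \<in> carrier QA. Zf_proj (Gf_class p) = \<zero>\<^bsub>Zf\<^esub>}"

lemma ideal_zeta_ideal: "ideal zeta_ideal QA"
proof -
  have h: "(\<lambda>p. Zf_proj (Gf_class p)) \<in> ring_hom QA Zf"
    using ring_hom_trans[OF Gf_class_hom Zf_proj_hom] by (simp add: o_def)
  interpret ring_hom_ring QA Zf "\<lambda>p. Zf_proj (Gf_class p)"
    by (rule ring_hom_ringI2[OF cring.axioms(1)[OF cring_QA] cring.axioms(1)[OF cring_Zf] h])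
  show ?thesis
    using kernel_is_ideal unfolding a_kernel_def' zeta_ideal_def .
qed

lemma swap_diff_in_zeta_ideal:
  assumes "p \<in> carrier QA"
  shows "swap p - p \<in> zeta_ideal"
proof -
  interpret cring QA by (rule cring_QA)
  have c: "swap q - q \<in> carrier QA" if "q \<in> carrier QA" for q
    using that swap_in_QA[of q]
    by (simp add: carrier_stuffle_alg qsubspace_diff[OF qsubspace_keys_in])
  have "swap p - p \<in> swap_ideal"
    unfolding swap_ideal_def using assms c by (intro subsetD[OF genideal_self]) auto
  then have "Gf_class (swap p - p) = \<zero>\<^bsub>Gf\<^esub>"
    unfolding Gf_class_def Gf_def using quotient_zero_iff[OF ideal_swap c[OF assms]] by simp
  moreover have "Zf_proj \<zero>\<^bsub>Gf\<^esub> = \<zero>\<^bsub>Zf\<^esub>"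
    using ring_hom_zero[OF Zf_proj_hom] cring_Gf cring_Zf by (simp add: cring.axioms(1))
  ultimately show ?thesis using c[OF assms] by (simp add: zeta_ideal_def)
qed

text \<open>
  The words whose classes generate \<open>N_ideal\<close>.
\<close>

definition mixed_words :: "(nat \<times> nat) list set" where
  "mixed_words = lists biletters - {u @ v | u v. u \<in> lists biletters_1 \<and> v \<in> lists biletters_0}"

lemma mixed_word_in_zeta_ideal:
  assumes "w \<in> mixed_words"
  shows "word w \<in> zeta_ideal"
proof -
  interpret cring Gf by (rule cring_Gf)
  have w: "word w \<in> carrier QA" using assms by (simp add: mixed_words_def carrier_stuffle_alg)
  have "Gf_class (word w) \<in> N_ideal"
    unfolding N_ideal_def using assms
    by (intro subsetD[OF genideal_self])
       (auto simp: mixed_words_def carrier_stuffle_alg intro!: ring_hom_closed[OF Gf_class_hom])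
  then have "Zf_proj (Gf_class (word w)) = \<zero>\<^bsub>Zf\<^esub>"
    unfolding Zf_proj_def Zf_def
    using quotient_zero_iff[OF ideal_N ring_hom_closed[OF Gf_class_hom w]] by simp
  with w show ?thesis by (simp add: zeta_ideal_def)
qed

lemma mixed_words_Cons: "w \<in> mixed_words \<Longrightarrow> a \<in> biletters_1 \<Longrightarrow> a # w \<in> mixed_words"
proof -
  assume w: "w \<in> mixed_words" and a: "a \<in> biletters_1"
  have False if "a # w = u @ v" "u \<in> lists biletters_1" "v \<in> lists biletters_0" for u v
  proof (cases u)
    case Nil
    then have "w = [] @ w" "w \<in> lists biletters_0" using that by auto
    then show False using w unfolding mixed_words_def by blast
  next
    case (Cons b u')
    then have "w = u' @ v" "u' \<in> lists biletters_1" using that by auto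
    then show False using w that(3) unfolding mixed_words_def by blast
  qed
  then show ?thesis using w a by (auto simp: mixed_words_def biletters_1_def biletters_def)
qed

lemma mixed_words_head:
  assumes "a # w \<in> lists biletters" "fst a \<noteq> 1" "\<exists>kd\<in>set (a # w). snd kd \<noteq> 0"
  shows "a # w \<in> mixed_words"
proof -
  have False if "a # w = u @ v" "u \<in> lists biletters_1" "v \<in> lists biletters_0" for u v
  proof (cases u)
    case Nil
    then have "a # w \<in> lists biletters_0" using that by auto
    then show False using assms(3) by (fastforce simp: biletters_0_def in_lists_conv_set)
  next
    case (Cons b u')
    then show False using that assms(2) by (auto simp: biletters_1_def)
  qed
  then show ?thesis using assms(1) by (auto simp: mixed_words_def)
qed

lemma keys_stuffle_word_biletters:
  assumes "w \<in> Poly_Mapping.keys (stuffle_word u v)" "u \<in> lists biletters" "v \<in> lists biletters"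
  shows "w \<in> lists biletters"
  using stuffle_word_in_free_alg[OF _ assms(2,3)] assms(1)
  by (auto simp: biletters_def dest!: free_algD)

lemma keys_stuffle_word_Cons:
  assumes "w \<in> Poly_Mapping.keys (stuffle_word (a # u) (b # v))"
  obtains x where "w = a # x" "x \<in> Poly_Mapping.keys (stuffle_word u (b # v))"
  | x where "w = b # x" "x \<in> Poly_Mapping.keys (stuffle_word (a # u) v)"
  | x where "w = (a + b) # x" "x \<in> Poly_Mapping.keys (stuffle_word u v)"
proof -
  have "w \<in> Poly_Mapping.keys (lmul a (stuffle_word u (b # v))) \<or>
      w \<in> Poly_Mapping.keys (lmul b (stuffle_word (a # u) v)) \<or>
      w \<in> Poly_Mapping.keys (lmul (a + b) (stuffle_word u v))"
    using assms keys_add[of "lmul a (stuffle_word u (b # v)) + lmul b (stuffle_word (a # u) v)"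
        "lmul (a + b) (stuffle_word u v)"]
      keys_add[of "lmul a (stuffle_word u (b # v))" "lmul b (stuffle_word (a # u) v)"]
    unfolding stuffle_word.simps by blast
  then show thesis
  proof (elim disjE)
    assume "w \<in> Poly_Mapping.keys (lmul a (stuffle_word u (b # v)))"
    from keys_lmul[OF this] show thesis using that(1) by blast
  next
    assume "w \<in> Poly_Mapping.keys (lmul b (stuffle_word (a # u) v))"
    from keys_lmul[OF this] show thesis using that(2) by blast
  next
    assume "w \<in> Poly_Mapping.keys (lmul (a + b) (stuffle_word u v))"
    from keys_lmul[OF this] show thesis using that(3) by blast
  qed
qed

lemma stuffle_word_lower:
  "w \<in> Poly_Mapping.keys (stuffle_word u v) \<Longrightarrow> \<exists>kd\<in>set v. snd kd \<noteq> (0::nat) \<Longrightarrow>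
     \<exists>kd\<in>set w. snd (kd :: nat \<times> nat) \<noteq> 0"
proof (induction u v arbitrary: w rule: stuffle_word.induct)
  case (3 a u b v)
  from "3.prems"(1) show ?case
  proof (cases rule: keys_stuffle_word_Cons)
    case (1 x)
    then show ?thesis using "3.IH"(1)[of x] "3.prems"(2) by auto
  next
    case (2 x)
    then show ?thesis using "3.IH"(2)[of x] "3.prems"(2) by auto
  next
    case (3 x)
    then show ?thesis using "3.IH"(3)[of x] "3.prems"(2) by auto
  qed
qed auto

text \<open>
  A sum of two letters with upper entry one has upper entry two. It carries a positive lower entry
  itself or, because \<open>v\<close> ends in one, a letter with a positive lower entry follows.
\<close>

lemma stuffle_word_ones_or_mixed:
  "w \<in> Poly_Mapping.keys (stuffle_word u v) \<Longrightarrow> u \<in> lists biletters_1 \<Longrightarrow> v \<in> lists biletters_1 \<Longrightarrow>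
    v \<noteq> [] \<Longrightarrow> snd (last v) \<noteq> 0 \<Longrightarrow> w \<in> lists biletters_1 \<or> w \<in> mixed_words"
proof (induction u v arbitrary: w rule: stuffle_word.induct)
  case (3 a u b v)
  have ab: "a \<in> biletters_1" "b \<in> biletters_1" "u \<in> lists biletters_1" "v \<in> lists biletters_1"
    using "3.prems" by auto
  have sub: "biletters_1 \<subseteq> biletters" by (auto simp: biletters_1_def biletters_def)
  from "3.prems"(1) show ?case
  proof (cases rule: keys_stuffle_word_Cons)
    case (1 x)
    then have "x \<in> lists biletters_1 \<or> x \<in> mixed_words"
      using "3.IH"(1)[of x] "3.prems" ab by auto
    then show ?thesis using 1 ab mixed_words_Cons[of x a] by auto
  next
    case (2 x)
    show ?thesis
    proof (cases "v = []")
      case True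
      then show ?thesis using 2 ab by auto
    next
      case False
      then have "x \<in> lists biletters_1 \<or> x \<in> mixed_words"
        using "3.IH"(2)[of x] "3.prems" 2 ab by auto
      then show ?thesis using 2 ab mixed_words_Cons[of x b] by auto
    qed
  next
    case (3 x)
    have "w \<in> lists biletters"
      using keys_stuffle_word_biletters[OF "3.prems"(1)] ab sub by auto
    moreover have "fst (a + b) \<noteq> 1" using ab by (auto simp: biletters_1_def)
    moreover have "\<exists>kd\<in>set w. snd kd \<noteq> 0"
    proof (cases "v = []")
      case True
      then show ?thesis using 3 "3.prems" by auto
    next
      case False
      then have "\<exists>kd\<in>set v. snd kd \<noteq> 0" using "3.prems" by (intro bexI[of _ "last v"]) auto
      then show ?thesis using stuffle_word_lower[OF 3(2)] 3(1) by auto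
    qed
    ultimately show ?thesis using mixed_words_head 3(1) by metis
  qed
qed auto

definition lower_part :: "(nat \<times> nat) ncpoly \<Rightarrow> nat ncpoly" where
  "lower_part = lin_ext (\<lambda>w. if \<forall>kd\<in>set w. fst kd = 1 then word (map snd w) else 0)"

lemma qlinear_lower_part: "qlinear lower_part"
  by (simp add: lower_part_def qlinear_lin_ext)

lemma lower_part_word: "lower_part (word w) = (if \<forall>kd\<in>set w. fst kd = 1 then word (map snd w) else 0)"
  by (simp add: lower_part_def)

lemma lower_part_lmul: "lower_part (lmul a p) = (if fst a = 1 then lmul (snd a) (lower_part p) else 0)"
  by (rule qlinear_eqI[where F = "\<lambda>p. lower_part (lmul a p)"
        and G = "\<lambda>p. if fst a = 1 then lmul (snd a) (lower_part p) else 0"])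
     (auto intro!: qlinearI simp: lower_part_word lmul_add lmul_scale
        qlinear_add[OF qlinear_lower_part] qlinear_scale[OF qlinear_lower_part])

lemma shuffle_lmul:
  "shuffle (lmul a p) (lmul b q) = lmul a (shuffle p (lmul b q)) + lmul b (shuffle (lmul a p) q)"
  by (rule bilinear_eqI[where F = "\<lambda>p q. shuffle (lmul a p) (lmul b q)"
        and G = "\<lambda>p q. lmul a (shuffle p (lmul b q)) + lmul b (shuffle (lmul a p) q)"])
     (auto intro!: qlinearI simp: shuffle_lin lmul_add lmul_scale scale_add)

text \<open>
  The sum of two letters has upper entry at least two, so the projection to words with all upper
  entries one leaves the shuffles only.
\<close>

lemma lower_part_stuffle_word:
  "u \<in> lists biletters \<Longrightarrow> v \<in> lists biletters \<Longrightarrow>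
     lower_part (stuffle_word u v) = shuffle (lower_part (word u)) (lower_part (word v))"
proof (induction u v rule: stuffle_word.induct)
  case (3 a u b v)
  have c: "lower_part (word (x # w)) = (if fst x = 1 then lmul (snd x) (lower_part (word w)) else 0)" for x w
    using lower_part_lmul[of x "word w"] by simp
  have "fst (a + b) \<noteq> 1" using 3 by (auto simp: biletters_def)
  moreover have "lower_part (stuffle_word u (b # v)) = shuffle (lower_part (word u)) (lower_part (word (b # v)))"
    "lower_part (stuffle_word (a # u) v) = shuffle (lower_part (word (a # u))) (lower_part (word v))"
    using 3 by auto
  ultimately show ?case
    by (auto simp: qlinear_add[OF qlinear_lower_part] lower_part_lmul c shuffle_lmul)
qed (auto simp: lower_part_word)

definition ones_embed :: "nat ncpoly \<Rightarrow> (nat \<times> nat) ncpoly" where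
  "ones_embed = lin_ext (\<lambda>ds. word (map (Pair 1) ds))"

lemma stuffle_ones_diff_in_zeta_ideal:
  assumes "es = [] \<or> last es \<noteq> 0"
  shows "stuffle_word (map (Pair (1::nat)) ds) (map (Pair 1) es) - ones_embed (shuffle_word ds es) \<in> zeta_ideal"
proof (cases "es = []")
  case True
  then show ?thesis
    using qsubspace_0[OF qsubspace_ideal[OF ideal_zeta_ideal]] by (simp add: ones_embed_def)
next
  case False
  let ?u = "map (Pair (1::nat)) ds" and ?v = "map (Pair (1::nat)) es"
  have uv: "?u \<in> lists biletters_1" "?v \<in> lists biletters_1" "?u \<in> lists biletters" "?v \<in> lists biletters"
    by (auto simp: biletters_1_def biletters_def)
  have "lower_part (stuffle_word ?u ?v) = shuffle_word ds es"
    using uv by (simp add: lower_part_stuffle_word lower_part_word o_def)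
  moreover have "stuffle_word ?u ?v - ones_embed (lower_part (stuffle_word ?u ?v)) \<in> zeta_ideal"
  proof (rule qsubspace_qlinear[where F = "\<lambda>p. p - ones_embed (lower_part p)"])
    show "qsubspace zeta_ideal" by (rule qsubspace_ideal[OF ideal_zeta_ideal])
    show "qlinear (\<lambda>p. p - ones_embed (lower_part p))"
      by (auto intro!: qlinearI simp: ones_embed_def lin_ext_add lin_ext_scale scale_diff
          qlinear_add[OF qlinear_lower_part] qlinear_scale[OF qlinear_lower_part])
    fix w assume "w \<in> Poly_Mapping.keys (stuffle_word ?u ?v)"
    then have "w \<in> lists biletters_1 \<or> w \<in> mixed_words"
      using stuffle_word_ones_or_mixed[of w ?u ?v] uv assms False by (simp add: last_map)
    moreover have "word w - ones_embed (lower_part (word w)) = 0" if "w \<in> lists biletters_1"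
    proof -
      have "\<forall>kd\<in>set w. fst kd = 1" using that by (auto simp: biletters_1_def)
      moreover from this have "map (Pair 1 \<circ> snd) w = w"
        by (intro map_idI) (auto simp: prod_eq_iff)
      ultimately show ?thesis by (simp add: lower_part_word ones_embed_def)
    qed
    moreover have "word w - ones_embed (lower_part (word w)) = word w"
      if "w \<in> mixed_words" "w \<notin> lists biletters_1"
    proof -
      have "\<not> (\<forall>kd\<in>set w. fst kd = 1)"
        using that(2) by (fastforce simp: biletters_1_def in_lists_conv_set)
      then show ?thesis unfolding lower_part_word ones_embed_def by (simp only: if_False lin_ext_0 diff_0_right)
    qed
    ultimately show "word w - ones_embed (lower_part (word w)) \<in> zeta_ideal"
      using mixed_word_in_zeta_ideal qsubspace_0[OF qsubspace_ideal[OF ideal_zeta_ideal]] by metis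
  qed
  ultimately show ?thesis by simp
qed

definition rmul :: "'a \<Rightarrow> 'a ncpoly \<Rightarrow> 'a ncpoly" where
  "rmul a = lin_ext (\<lambda>w. word (w @ [a]))"

lemma rmul_add: "rmul a (p + q) = rmul a p + rmul a q"
  and rmul_scale: "rmul a (scale c p) = scale c (rmul a p)"
  and rmul_word [simp]: "rmul a (word w) = word (w @ [a])"
  by (simp_all add: rmul_def lin_ext_add lin_ext_scale)

lemma rmul_lmul: "rmul a (lmul b p) = lmul b (rmul a p)"
  by (rule qlinear_eqI[where F = "\<lambda>p. rmul a (lmul b p)" and G = "\<lambda>p. lmul b (rmul a p)"])
     (auto intro!: qlinearI simp: rmul_add rmul_scale lmul_add lmul_scale)

text \<open>
  The stuffle product is defined from the left, whereas \<open>tau\<close> reads the lower entries from the right.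
\<close>

lemma shuffle_word_snoc:
  "shuffle_word (u @ [a]) (v @ [b]) = rmul a (shuffle_word u (v @ [b])) + rmul b (shuffle_word (u @ [a]) v)"
proof (induction "length u + length v" arbitrary: u v rule: less_induct)
  case less
  show ?case
  proof (cases u)
    case u: Nil
    show ?thesis
    proof (cases v)
      case Nil
      then show ?thesis by (simp add: u)
    next
      case (Cons c v')
      then show ?thesis using less[of "[]" v'] by (simp add: u lmul_add rmul_add rmul_lmul add_ac)
    qed
  next
    case u: (Cons c u')
    show ?thesis
    proof (cases v)
      case Nil
      then show ?thesis using less[of u' "[]"] by (simp add: u lmul_add rmul_add rmul_lmul add_ac)
    next
      case (Cons d v')
      then show ?thesis
        using less[of u' v] less[of u v'] by (simp add: u lmul_add rmul_add rmul_lmul add_ac)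
    qed
  qed
qed

definition reverse :: "'a ncpoly \<Rightarrow> 'a ncpoly" where
  "reverse = lin_ext (\<lambda>w. word (rev w))"

lemma reverse_lmul: "reverse (lmul a p) = rmul a (reverse p)"
  by (rule qlinear_eqI[where F = "\<lambda>p. reverse (lmul a p)" and G = "\<lambda>p. rmul a (reverse p)"])
     (auto intro!: qlinearI simp: rmul_add rmul_scale lmul_add lmul_scale reverse_def lin_ext_add lin_ext_scale)

lemma reverse_shuffle_word: "reverse (shuffle_word u v) = shuffle_word (rev u) (rev v)"
proof (induction u v rule: shuffle_word.induct)
  case (3 a u b v)
  have "reverse (p + q) = reverse p + reverse q" for p q :: "'a ncpoly"
    by (simp add: reverse_def lin_ext_add)
  then show ?case using 3 by (simp add: reverse_lmul shuffle_word_snoc)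
qed (simp_all add: reverse_def)

lemma lookup_H1_to_QA:
  "Poly_Mapping.lookup (H1_to_QA p) w =
     (if \<forall>kd\<in>set w. snd kd = 0 then Poly_Mapping.lookup p (map fst w) else 0)"
proof -
  have "map (\<lambda>k. (k, 0)) ks = w \<longleftrightarrow> (\<forall>kd\<in>set w. snd kd = 0) \<and> ks = map fst w" for ks :: "nat list"
    by (induction w arbitrary: ks) (auto simp: Cons_eq_map_conv map_eq_Cons_conv)
  then show ?thesis
    by (simp add: H1_to_QA_def lookup_lin_ext lookup_word if_distrib in_keys_iff cong: if_cong)
qed

lemma swap_word_ones: "swap_word (map (Pair 1) ds) = H1_to_QA (decode (tau (rev ds)))"
proof (rule poly_mapping_eqI)
  fix w
  have t: "tau (rev ds) \<in> keys_in ends_y" using tau_ends_y[of "word (rev ds)"] by simp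
  show "Poly_Mapping.lookup (swap_word (map (Pair 1) ds)) w = Poly_Mapping.lookup (H1_to_QA (decode (tau (rev ds)))) w"
  proof (cases "\<forall>kd\<in>set w. snd kd = 0")
    case z: True
    define ks where "ks = map fst w"
    have w: "w = map (\<lambda>k. (k, 0)) ks"
      unfolding ks_def map_map o_def using z by (intro map_idI[symmetric]) (auto simp: prod_eq_iff)
    have r: "Poly_Mapping.lookup (H1_to_QA (decode (tau (rev ds)))) w = Poly_Mapping.lookup (decode (tau (rev ds))) ks"
      using z by (simp add: lookup_H1_to_QA ks_def)
    show ?thesis
    proof (cases "ks \<in> pos_words \<and> length ks = length ds")
      case True
      then have "Poly_Mapping.lookup (swap_word (block ds 0 (map Suc []))) (block (rev []) 0 ks)
          = Poly_Mapping.lookup (tau (rev ds)) (xy_word ks) * Poly_Mapping.lookup (theta []) []"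
        by (intro swap_coeff_block) (auto simp: pos_words_def)
      then show ?thesis using True t unfolding r by (simp add: block_def w lookup_word lookup_decode)
    next
      case False
      have "Poly_Mapping.lookup (decode (tau (rev ds))) ks = 0"
      proof (cases "ks \<in> pos_words")
        case True
        then have "xy_word ks \<notin> xy_words (length (rev ds))"
          using False inj_onD[OF inj_on_xy_word] unfolding pos_words_def xy_words_def by fastforce
        then have "Poly_Mapping.lookup (tau (rev ds)) (xy_word ks) = 0"
          using tau_keys_in[of "rev ds"] by (auto simp: keys_in_def in_keys_iff)
        then show ?thesis using lookup_decode[OF t True] by simp
      next
        case False
        then show ?thesis using decode_in_H1[OF t] by (auto simp: keys_in_def in_keys_iff)
      qed
      moreover have "\<not> (w \<in> lists biletters \<and> length w = length ds)"
        using False by (auto simp: w biletters_def pos_words_def)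
      ultimately show ?thesis unfolding r by (auto simp: lookup_swap_word)
    qed
  next
    case False
    then show ?thesis using swap_coeff_lower_0[of w ds] by (auto simp: lookup_H1_to_QA)
  qed
qed

lemma qlinear_swap: "qlinear swap"
  by (simp add: swap_def qlinear_lin_ext)

lemma H1_to_QA_in_QA: "p \<in> keys_in pos_words \<Longrightarrow> H1_to_QA p \<in> keys_in (lists biletters)"
  using ring_hom_closed[OF H1_to_QA_hom, of p] by (simp only: carrier_H1 carrier_stuffle_alg[of biletters])

lemma tau_minus_ones_in_zeta_ideal:
  "H1_to_QA (decode (lin_ext tau p)) - ones_embed (reverse p) \<in> zeta_ideal"
proof (rule qsubspace_qlinear[where F = "\<lambda>p. H1_to_QA (decode (lin_ext tau p)) - ones_embed (reverse p)"])
  show "qsubspace zeta_ideal" by (rule qsubspace_ideal[OF ideal_zeta_ideal])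
  show "qlinear (\<lambda>p. H1_to_QA (decode (lin_ext tau p)) - ones_embed (reverse p))"
    by (intro qlinearI) (simp_all add: H1_to_QA_def decode_def ones_embed_def reverse_def lin_ext_add lin_ext_scale scale_diff)
  fix u :: "nat list"
  have "swap (word (map (Pair 1) (rev u))) - word (map (Pair 1) (rev u)) \<in> zeta_ideal"
    by (intro swap_diff_in_zeta_ideal) (auto simp: carrier_stuffle_alg biletters_def)
  moreover have "swap (word (map (Pair 1) (rev u))) = H1_to_QA (decode (tau u))"
    using swap_word_ones[of "rev u"] by (simp add: swap_def)
  ultimately show "H1_to_QA (decode (lin_ext tau (word u))) - ones_embed (reverse (word u)) \<in> zeta_ideal"
    by (simp add: ones_embed_def reverse_def)
qed

text \<open>
  Each of \<open>tau u\<close>, \<open>tau v\<close> and their shuffle product is congruent to a combination of words with all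
  upper entries one, by swap invariance. For such words the stuffle product is congruent to the
  shuffle product, as the second word, with lower entries \<open>rev v\<close>, ends in a positive one.
\<close>

lemma double_shuffle_tau:
  assumes "v = [] \<or> hd v \<noteq> 0"
  shows "stuffle (H1_to_QA (decode (tau u))) (H1_to_QA (decode (tau v)))
      - H1_to_QA (decode (shuffle (tau u) (tau v))) \<in> zeta_ideal" (is "?X - ?Y \<in> _")
proof -
  note sub = qsubspace_ideal[OF ideal_zeta_ideal]
  let ?e = "\<lambda>u. word (map (Pair (1::nat)) (rev u))"
  have d: "H1_to_QA (decode (tau u)) - ?e u \<in> zeta_ideal" for u
    using tau_minus_ones_in_zeta_ideal[of "word u"] by (simp add: ones_embed_def reverse_def)
  have c: "?e u \<in> keys_in (lists biletters)" for u by (auto simp: biletters_def)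
  have "decode (tau v) \<in> keys_in pos_words"
    using decode_in_H1 tau_ends_y[of "word v"] by simp
  then have "?X - stuffle (?e u) (?e v) \<in> zeta_ideal"
    by (intro ideal_stuffle_cong[OF ideal_zeta_ideal] d c H1_to_QA_in_QA)
  moreover have "stuffle (?e u) (?e v) - ones_embed (reverse (shuffle_word u v)) \<in> zeta_ideal"
    unfolding reverse_shuffle_word stuffle_words
    using assms by (intro stuffle_ones_diff_in_zeta_ideal) (auto simp: last_rev)
  moreover have "?Y - ones_embed (reverse (shuffle_word u v)) \<in> zeta_ideal"
    using tau_minus_ones_in_zeta_ideal[of "shuffle_word u v"] tau_shuffle[of "word u" "word v"] by simp
  ultimately show ?thesis
    using qsubspace_trans[OF sub] qsubspace_sym[OF sub] by blast
qed

lemma qlinear_bilinear_mem: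
  assumes "qsubspace V" "\<And>q. qlinear (\<lambda>p. F p q)" "\<And>p. qlinear (F p)"
    and "\<And>u v. u \<in> Poly_Mapping.keys p \<Longrightarrow> v \<in> Poly_Mapping.keys q \<Longrightarrow> F (word u) (word v) \<in> V"
  shows "F p q \<in> V"
proof (rule qsubspace_qlinear[where F = "\<lambda>p. F p q", OF assms(1,2)])
  fix u assume "u \<in> Poly_Mapping.keys p"
  then show "F (word u) q \<in> V"
    by (intro qsubspace_qlinear[where F = "F (word u)" and p = q, OF assms(1,3)] assms(4))
qed

definition tau_inv :: "nat ncpoly \<Rightarrow> nat ncpoly" where
  "tau_inv = lin_ext (\<lambda>ks. theta (map (\<lambda>k. k - 1) ks))"

lemma tau_tau_inv: "p \<in> keys_in pos_words \<Longrightarrow> lin_ext tau (tau_inv p) = xy_embed p"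
proof (rule qlinear_eqI[where F = "\<lambda>p. lin_ext tau (tau_inv p)" and G = xy_embed])
  show "qlinear (\<lambda>p. lin_ext tau (tau_inv p))"
    unfolding tau_inv_def by (rule qlinear_comp[OF qlinear_lin_ext qlinear_lin_ext])
  fix ks assume "p \<in> keys_in pos_words" "ks \<in> Poly_Mapping.keys p"
  then have "\<forall>k\<in>set ks. 1 \<le> k" by (auto simp: pos_words_def dest!: keys_inD)
  then have "map Suc (map (\<lambda>k. k - 1) ks) = ks"
    unfolding map_map by (intro map_idI) auto
  then show "lin_ext tau (tau_inv (word ks)) = xy_embed (word ks)"
    by (simp add: tau_inv_def tau_theta)
qed (rule qlinear_xy_embed)

theorem double_shuffle_in_zeta_ideal:
  assumes "w \<in> carrier H1" "v \<in> H0"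
  shows "H1_to_QA (stuffle w v - H1_shuffle w v) \<in> zeta_ideal"
proof -
  note sub = qsubspace_ideal[OF ideal_zeta_ideal]
  have w: "w \<in> keys_in pos_words" and v: "v \<in> keys_in pos_words"
    using assms by (simp_all add: H0_def flip: carrier_H1)
  let ?p = "tau_inv w" and ?q = "tau_inv v"
  let ?F = "\<lambda>p q. stuffle (H1_to_QA (decode (lin_ext tau p))) (H1_to_QA (decode (lin_ext tau q)))
      - H1_to_QA (decode (shuffle (lin_ext tau p) (lin_ext tau q)))"
  have q: "y = [] \<or> hd y \<noteq> 0" if "y \<in> Poly_Mapping.keys ?q" for y
  proof -
    have "y \<in> Poly_Mapping.keys (lin_ext (\<lambda>ks. theta (map (\<lambda>k. k - 1) ks)) v)"
      using that by (simp only: tau_inv_def)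
    from keys_lin_ext[OF this] obtain ks where ks: "ks \<in> Poly_Mapping.keys v"
      and y: "y \<in> Poly_Mapping.keys (theta (map (\<lambda>k. k - 1) ks))"
      by blast
    have "length y = length ks" "ks \<noteq> [] \<Longrightarrow> hd (map (\<lambda>k. k - 1) ks) \<le> hd y"
      using theta_keys_in[of "map (\<lambda>k. k - 1) ks"] y by (auto simp: keys_in_def)
    moreover have "ks = [] \<or> hd ks \<noteq> 1" using assms(2) ks by (simp add: H0_def)
    moreover have "ks \<noteq> [] \<Longrightarrow> 1 \<le> hd ks"
      using keys_inD[OF v ks] by (cases ks) (auto simp: pos_words_def)
    ultimately show ?thesis by (cases ks) auto
  qed
  have "?F ?p ?q \<in> zeta_ideal"
  proof (rule qlinear_bilinear_mem[where F = ?F, OF sub])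
    fix x y assume "y \<in> Poly_Mapping.keys ?q"
    then show "?F (word x) (word y) \<in> zeta_ideal"
      using double_shuffle_tau[OF q, of y x] by simp
  qed (intro qlinearI; simp add: H1_to_QA_def decode_def lin_ext_add lin_ext_scale scale_diff shuffle_lin stuffle_lin)+
  moreover have "?F ?p ?q = H1_to_QA (stuffle w v - H1_shuffle w v)"
    unfolding tau_tau_inv[OF w] tau_tau_inv[OF v] decode_xy_embed[OF w] decode_xy_embed[OF v]
    by (simp only: H1_shuffle_decode[OF w v] qlinear_diff[OF qlinear_H1_to_QA] H1_to_QA_stuffle)
  ultimately show ?thesis by simp
qed

section \<open>The ideal of extended double shuffle relations\<close>

definition eds_ideal :: "nat ncpoly set" where
  "eds_ideal = Idl\<^bsub>H1\<^esub> {stuffle w v - H1_shuffle w v | w v. w \<in> carrier H1 \<and> v \<in> H0}"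

lemma eds_generators_in_H1:
  "{stuffle w v - H1_shuffle w v | w v. w \<in> carrier H1 \<and> v \<in> H0} \<subseteq> carrier H1"
proof -
  have "stuffle w v - H1_shuffle w v \<in> carrier H1" if "w \<in> carrier H1" "v \<in> H0" for w v
  proof -
    have v: "v \<in> carrier H1" using that(2) unfolding H0_def by blast
    have "stuffle w v \<in> carrier H1"
      using monoid.m_closed[OF ring.is_monoid[OF cring.axioms(1)[OF cring_H1]] that(1) v]
      unfolding stuffle_alg_def by simp
    then show ?thesis
      using H1_shuffle(1)[OF that(1) v] unfolding carrier_H1
      by (rule qsubspace_diff[OF qsubspace_keys_in])
  qed
  then show ?thesis by blast
qed

lemma ideal_eds: "ideal eds_ideal H1"
  unfolding eds_ideal_def
  by (rule ring.genideal_ideal[OF cring.axioms(1)[OF cring_H1] eds_generators_in_H1])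

lemmas qsubspace_eds = qsubspace_ideal[OF ideal_eds]

lemma stuffle_in_H1: "p \<in> keys_in pos_words \<Longrightarrow> q \<in> keys_in pos_words \<Longrightarrow> stuffle p q \<in> keys_in pos_words"
  unfolding pos_words_def free_alg_keys_in[symmetric] by (rule stuffle_in_free_alg) auto

lemma eds_cong:
  assumes "p - p' \<in> eds_ideal" "q - q' \<in> eds_ideal" "p' \<in> keys_in pos_words" "q \<in> keys_in pos_words"
  shows "stuffle p q - stuffle p' q' \<in> eds_ideal"
  using ideal_stuffle_cong[OF ideal_eds assms(1,2)] assms(3,4) unfolding pos_words_def by blast

lemma eds_sum: "(\<And>x. x \<in> S \<Longrightarrow> f x - g x \<in> eds_ideal) \<Longrightarrow> sum f S - sum g S \<in> eds_ideal"
  unfolding sum_subtractf[symmetric] by (rule qsubspace_sum[OF qsubspace_eds])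

lemma eds_refl: "p - p \<in> eds_ideal"
  using qsubspace_0[OF qsubspace_eds] by simp

text \<open>
  A word starts in \<open>z\<^sub>1\<close> if and only if it starts in \<open>y\<close>.
\<close>

lemma decode_admissible:
  assumes "q \<in> keys_in ends_y" "ldq Ly q = 0"
  shows "decode q \<in> H0"
proof -
  have "ks = [] \<or> hd ks \<noteq> 1" if ks: "ks \<in> Poly_Mapping.keys (decode q)" for ks
  proof (rule ccontr)
    assume "\<not> (ks = [] \<or> hd ks \<noteq> 1)"
    then obtain ks' where e: "ks = 1 # ks'" by (cases ks) auto
    have "ks \<in> pos_words" using keys_inD[OF decode_in_H1[OF assms(1)] ks] .
    then have "Poly_Mapping.lookup (decode q) ks = Poly_Mapping.lookup (ldq Ly q) (xy_word ks')"
      using lookup_decode[OF assms(1)] by (simp add: e lookup_ldq xy_word_Cons)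
    then show False using ks assms(2) by (simp add: in_keys_iff)
  qed
  then show ?thesis using decode_in_H1[OF assms(1)] unfolding H0_def carrier_H1 by blast
qed

lemma decode_shuffle_cong:
  assumes "p \<in> keys_in ends_y" "q \<in> keys_in ends_y" "ldq Ly q = 0"
  shows "decode (shuffle p q) - stuffle (decode p) (decode q) \<in> eds_ideal"
proof -
  have "stuffle (decode p) (decode q) - H1_shuffle (decode p) (decode q) \<in> eds_ideal"
    unfolding eds_ideal_def
    using decode_in_H1[OF assms(1)] decode_admissible[OF assms(2,3)] unfolding carrier_H1[symmetric]
    by (intro subsetD[OF ring.genideal_self[OF cring.axioms(1)[OF cring_H1] eds_generators_in_H1]]) blast
  moreover have "H1_shuffle (decode p) (decode q) = decode (shuffle p q)"
    using assms by (simp add: H1_shuffle_decode decode_in_H1 xy_embed_decode)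
  ultimately show ?thesis using qsubspace_sym[OF qsubspace_eds] by simp
qed

section \<open>Shuffle regularization\<close>

definition ones :: "nat \<Rightarrow> nat ncpoly" where
  "ones m = word (replicate m 1)"

text \<open>
  The coefficients of the inverse of the power series \<open>\<Sum> z\<^sub>1\<^sup>m T\<^sup>m\<close> with respect to the stuffle product;
  here \<open>z\<^sub>1\<^sup>m\<close> is a word and not a stuffle power.
\<close>

fun ones_inv :: "nat \<Rightarrow> nat ncpoly" where
  "ones_inv 0 = word []"
| "ones_inv (Suc m) = - (\<Sum>i\<le>m. stuffle (ones (Suc m - i)) (ones_inv i))"

lemma ones_inv: "(\<Sum>i\<le>n. stuffle (ones (n - i)) (ones_inv i)) = (if n = 0 then word [] else 0)"
  by (cases n) (simp_all add: ones_def)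

lemma ones_in_H1: "ones m \<in> keys_in pos_words"
  by (auto simp: ones_def pos_words_def)

lemma ones_inv_in_H1: "ones_inv m \<in> keys_in pos_words"
proof (induction m rule: less_induct)
  case (less m)
  show ?case
  proof (cases m)
    case (Suc n)
    have "(\<Sum>i\<le>n. stuffle (ones (Suc n - i)) (ones_inv i)) \<in> keys_in pos_words"
      using less Suc by (intro qsubspace_sum[OF qsubspace_keys_in] stuffle_in_H1 ones_in_H1) auto
    from qsubspace_diff[OF qsubspace_keys_in qsubspace_0[OF qsubspace_keys_in] this]
    show ?thesis by (simp add: Suc)
  qed simp
qed

lemma ldq_power_add: "(ldq a ^^ j) (p + q) = (ldq a ^^ j) p + (ldq a ^^ j) q"
  and ldq_power_scale: "(ldq a ^^ j) (scale c p) = scale c ((ldq a ^^ j) p)"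
  and ldq_power_0 [simp]: "(ldq a ^^ j) 0 = 0"
  by (induction j) (simp_all add: ldq_add ldq_scale)

lemma lookup_ldq_power: "Poly_Mapping.lookup ((ldq a ^^ j) p) w = Poly_Mapping.lookup p (replicate j a @ w)"
  by (induction j arbitrary: w) (simp_all add: lookup_ldq replicate_app_Cons_same)

lemma ldq_power_eq_0:
  assumes "\<And>w. w \<in> Poly_Mapping.keys p \<Longrightarrow> length w < j"
  shows "(ldq a ^^ j) p = 0"
proof (rule poly_mapping_eqI)
  fix w
  have "replicate j a @ w \<notin> Poly_Mapping.keys p" using assms[of "replicate j a @ w"] by auto
  then show "Poly_Mapping.lookup ((ldq a ^^ j) p) w = Poly_Mapping.lookup 0 w"
    by (simp add: lookup_ldq_power in_keys_iff)
qed

lemma ldq_power_shuffle: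
  assumes "ldq a q = 0"
  shows "(ldq a ^^ j) (shuffle p q) = shuffle ((ldq a ^^ j) p) q"
  using assms by (induction j) (simp_all add: ldq_shuffle)

lemma ldq_power_ends_y: "p \<in> keys_in ends_y \<Longrightarrow> (ldq a ^^ j) p \<in> keys_in ends_y"
proof -
  assume p: "p \<in> keys_in ends_y"
  have "w \<in> ends_y" if "w \<in> Poly_Mapping.keys ((ldq a ^^ j) p)" for w
    using that keys_inD[OF p, of "replicate j a @ w"]
    by (auto simp: in_keys_iff lookup_ldq_power ends_y_def last_append split: if_splits)
  then show ?thesis by (auto simp: keys_in_def)
qed

text \<open>
  The shuffle regularization with value zero at \<open>z\<^sub>1\<close>. On \<open>z\<^sub>1\<^sup>m v\<close> with \<open>v\<close> in \<open>\<HH>\<^sup>0\<close> the generating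
  series of the regularized values is that of the words \<open>z\<^sub>1\<^sup>m v\<close> divided by that of the words \<open>z\<^sub>1\<^sup>m\<close>.
  The left quotients by \<open>y\<close> strip the leading letters \<open>z\<^sub>1\<close>.
\<close>

definition reg_zeta_word :: "xy list \<Rightarrow> nat ncpoly" where
  "reg_zeta_word w = (\<Sum>j\<le>length w. stuffle (ones_inv j) (decode ((ldq Ly ^^ j) (word w))))"

definition reg_zeta :: "xy ncpoly \<Rightarrow> nat ncpoly" where
  "reg_zeta = lin_ext reg_zeta_word"

lemma qlinear_reg_zeta: "qlinear reg_zeta"
  by (simp add: reg_zeta_def qlinear_lin_ext)

text \<open>
  A common bound makes the number of summands independent of the word.
\<close>

lemma reg_zeta_eq:
  assumes "\<And>w. w \<in> Poly_Mapping.keys p \<Longrightarrow> length w \<le> N"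
  shows "reg_zeta p = (\<Sum>j\<le>N. stuffle (ones_inv j) (decode ((ldq Ly ^^ j) p)))"
proof (rule qlinear_eqI[OF qlinear_reg_zeta, where G = "\<lambda>p. \<Sum>j\<le>N. stuffle (ones_inv j) (decode ((ldq Ly ^^ j) p))"])
  show "qlinear (\<lambda>p. \<Sum>j\<le>N. stuffle (ones_inv j) (decode ((ldq Ly ^^ j) p)))"
    by (intro qlinearI) (simp_all add: decode_def lin_ext_add lin_ext_scale ldq_power_add ldq_power_scale
        stuffle_lin sum.distrib scale_sum)
  fix w assume "w \<in> Poly_Mapping.keys p"
  then have N: "length w \<le> N" by (rule assms)
  have "reg_zeta_word w = (\<Sum>j\<le>N. stuffle (ones_inv j) (decode ((ldq Ly ^^ j) (word w))))"
    unfolding reg_zeta_word_def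
  proof (rule sum.mono_neutral_left)
    show "\<forall>j\<in>{..N} - {..length w}. stuffle (ones_inv j) (decode ((ldq Ly ^^ j) (word w))) = 0"
    proof
      fix j assume "j \<in> {..N} - {..length w}"
      then have "(ldq Ly ^^ j) (word w) = 0" by (intro ldq_power_eq_0) auto
      then show "stuffle (ones_inv j) (decode ((ldq Ly ^^ j) (word w))) = 0"
        by (simp add: decode_def)
    qed
  qed (use N in auto)
  then show "reg_zeta (word w) = (\<Sum>j\<le>N. stuffle (ones_inv j) (decode ((ldq Ly ^^ j) (word w))))"
    by (simp add: reg_zeta_def)
qed

lemma ex_length_bound: "\<exists>N. \<forall>w\<in>Poly_Mapping.keys p \<union> Poly_Mapping.keys q. length w \<le> N"
proof -
  have "finite (length ` (Poly_Mapping.keys p \<union> Poly_Mapping.keys q))" by simp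
  then show ?thesis by (metis finite_nat_set_iff_bounded_le imageI)
qed

lemma reg_zeta_in_H1: "p \<in> keys_in ends_y \<Longrightarrow> reg_zeta p \<in> keys_in pos_words"
proof -
  assume p: "p \<in> keys_in ends_y"
  obtain N where "\<forall>w\<in>Poly_Mapping.keys p \<union> Poly_Mapping.keys p. length w \<le> N" using ex_length_bound by blast
  then show ?thesis
    by (subst reg_zeta_eq[of p N]) (auto intro!: qsubspace_sum[OF qsubspace_keys_in] stuffle_in_H1 ones_inv_in_H1
        decode_in_H1 ldq_power_ends_y p)
qed

text \<open>
  As \<open>ldq Ly\<close> is a derivation that annihilates \<open>q\<close>, stripping a letter \<open>y\<close> from the product means
  stripping it from \<open>p\<close>, and then the defining relations of \<open>eds_ideal\<close> apply termwise.
\<close>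

lemma reg_zeta_shuffle_admissible:
  assumes "p \<in> keys_in ends_y" "q \<in> keys_in ends_y" "ldq Ly q = 0"
  shows "reg_zeta (shuffle p q) - stuffle (reg_zeta p) (decode q) \<in> eds_ideal"
proof -
  obtain N where N: "\<forall>w\<in>Poly_Mapping.keys p \<union> Poly_Mapping.keys (shuffle p q). length w \<le> N"
    using ex_length_bound by blast
  have "reg_zeta (shuffle p q) = (\<Sum>j\<le>N. stuffle (ones_inv j) (decode (shuffle ((ldq Ly ^^ j) p) q)))"
    using N by (subst reg_zeta_eq[of _ N]) (auto simp: ldq_power_shuffle assms(3))
  moreover have "stuffle (reg_zeta p) (decode q)
      = (\<Sum>j\<le>N. stuffle (ones_inv j) (stuffle (decode ((ldq Ly ^^ j) p)) (decode q)))"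
    using N by (subst reg_zeta_eq[of _ N]) (auto simp: qlinear_sum[OF qlinear_stuffle_left] stuffle_assoc)
  ultimately show ?thesis
    by (simp only:) (intro eds_sum eds_cong eds_refl ones_inv_in_H1 decode_in_H1 decode_shuffle_cong
        shuffle_in_ends_y ldq_power_ends_y assms)
qed

lemma decode_y_power: "decode (word (replicate m Ly)) = ones m"
proof -
  have "xy_word (replicate m 1) = replicate m Ly" by (induction m) (auto simp: xy_word_Cons)
  moreover have "replicate m 1 \<in> pos_words" by (auto simp: pos_words_def)
  ultimately show ?thesis using decode_word by (metis ones_def)
qed

lemma y_power_ends_y: "word (replicate m Ly) \<in> keys_in ends_y"
  by (cases m) (auto simp: ends_y_def)

lemma reg_zeta_y_power: "reg_zeta (word (replicate m Ly)) = (if m = 0 then word [] else 0)"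
proof -
  have d: "(ldq Ly ^^ j) (word (replicate m Ly)) = word (replicate (m - j) Ly)" if "j \<le> m" for j
    using that
  proof (induction j)
    case (Suc j)
    then have "m - j = Suc (m - Suc j)" by simp
    with Suc show ?case by simp
  qed simp
  have "reg_zeta (word (replicate m Ly)) = (\<Sum>j\<le>m. stuffle (ones_inv j) (ones (m - j)))"
    by (subst reg_zeta_eq[of _ m]) (auto simp: d decode_y_power intro!: sum.cong)
  then show ?thesis using ones_inv[of m] by (simp add: stuffle_commute)
qed

text \<open>
  The shuffle products of a power of \<open>y\<close> and an admissible element span the words ending in \<open>y\<close>: if \<open>n\<close> is the largest number of leading letters \<open>y\<close> and \<open>q\<close>
  is the admissible element that follows them, subtracting \<open>y\<^sup>n \<squnion> q\<close> makes \<open>n\<close> smaller.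
\<close>

lemma admissible_decomposition_induct:
  assumes p: "p \<in> keys_in ends_y"
    and add: "\<And>p q. p \<in> keys_in ends_y \<Longrightarrow> q \<in> keys_in ends_y \<Longrightarrow> P p \<Longrightarrow> P q \<Longrightarrow> P (p + q)"
    and zero: "P 0"
    and base: "\<And>i q. q \<in> keys_in ends_y \<Longrightarrow> ldq Ly q = 0 \<Longrightarrow> P (shuffle (word (replicate i Ly)) q)"
  shows "P p"
proof -
  have "P p" if "p \<in> keys_in ends_y" "(ldq Ly ^^ n) p = 0" for n p
    using that
  proof (induction n arbitrary: p)
    case 0
    then show ?case using zero by simp
  next
    case (Suc n)
    let ?q = "(ldq Ly ^^ n) p"
    let ?r = "shuffle (word (replicate n Ly)) ?q"
    have q: "ldq Ly ?q = 0" "?q \<in> keys_in ends_y"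
      using Suc.prems by (simp_all add: ldq_power_ends_y)
    have r: "?r \<in> keys_in ends_y" by (intro shuffle_in_ends_y y_power_ends_y q)
    \<comment> \<open>Stripping \<open>n\<close> letters \<open>y\<close> from \<open>y\<^sup>n \<squnion> ?q\<close> leaves \<open>?q\<close>, as \<open>?q\<close> is admissible.\<close>
    have "(ldq Ly ^^ j) (word (replicate j Ly)) = word []" for j
      by (induction j) (simp_all add: funpow_Suc_right del: funpow.simps(2))
    then have "(ldq Ly ^^ n) (p - ?r) = 0"
      using q(1) by (simp add: diff_scale ldq_power_add ldq_power_scale ldq_power_shuffle)
         (simp flip: diff_scale)
    moreover have pr: "p - ?r \<in> keys_in ends_y"
      using Suc.prems r by (intro qsubspace_diff[OF qsubspace_keys_in])
    ultimately have "P (p - ?r)" by (rule Suc.IH[rotated])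
    then have "P ((p - ?r) + ?r)" by (intro add pr r base q)
    then show ?case by simp
  qed
  moreover obtain N where "\<forall>w\<in>Poly_Mapping.keys p \<union> Poly_Mapping.keys p. length w \<le> N" using ex_length_bound by blast
  then have "(ldq Ly ^^ Suc N) p = 0" by (intro ldq_power_eq_0) (auto simp: less_Suc_eq_le)
  ultimately show ?thesis using p by blast
qed

lemma shuffle_y_powers:
  "\<exists>c. shuffle (word (replicate a Ly)) (word (replicate b Ly)) = scale c (word (replicate (a + b) Ly))"
proof (induction "a + b" arbitrary: a b)
  case (Suc n)
  show ?case
  proof (cases "a = 0 \<or> b = 0")
    case True
    then show ?thesis by (auto intro!: exI[of _ 1])
  next
    case False
    then obtain a' b' where ab: "a = Suc a'" "b = Suc b'" by (cases a; cases b) auto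
    obtain c d where "shuffle_word (replicate a' Ly) (replicate b Ly) = scale c (word (replicate (a' + b) Ly))"
      "shuffle_word (replicate a Ly) (replicate b' Ly) = scale d (word (replicate (a + b') Ly))"
      using Suc(1)[of a' b] Suc(1)[of a b'] Suc(2) ab by auto
    then have "shuffle_word (replicate a Ly) (replicate b Ly) = scale (c + d) (word (replicate (a + b) Ly))"
      by (simp add: ab lmul_scale scale_left_add)
    then show ?thesis by auto
  qed
qed (auto intro!: exI[of _ 1])

text \<open>
  By the preceding induction it suffices to treat \<open>p = y\<^sup>i \<squnion> u\<close> and \<open>q = y\<^sup>j \<squnion> v\<close> with admissible
  \<open>u\<close> and \<open>v\<close>. Both sides vanish modulo the relations unless \<open>i = j = 0\<close>, because the regularized
  value of a positive power of \<open>y\<close> is zero, and for \<open>i = j = 0\<close> this is a double shuffle relation.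
\<close>

lemma reg_zeta_shuffle:
  assumes p: "p \<in> keys_in ends_y" and q: "q \<in> keys_in ends_y"
  shows "reg_zeta (shuffle p q) - stuffle (reg_zeta p) (reg_zeta q) \<in> eds_ideal"
proof -
  let ?P = "\<lambda>p q. reg_zeta (shuffle p q) - stuffle (reg_zeta p) (reg_zeta q) \<in> eds_ideal"
  let ?y = "\<lambda>i. word (replicate i Ly)"
  have z: "reg_zeta (shuffle (?y i) r) - (if i = 0 then decode r else 0) \<in> eds_ideal"
    if "r \<in> keys_in ends_y" "ldq Ly r = 0" for i r
    using reg_zeta_shuffle_admissible[OF y_power_ends_y that, of i] by (simp add: reg_zeta_y_power split: if_splits)
  have base: "?P (shuffle (?y i) u) (shuffle (?y j) v)"
    if u: "u \<in> keys_in ends_y" "ldq Ly u = 0" and v: "v \<in> keys_in ends_y" "ldq Ly v = 0" for i j u v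
  proof -
    obtain c where c: "shuffle (?y i) (?y j) = scale c (?y (i + j))" using shuffle_y_powers by blast
    \<comment> \<open>The value of the binomial coefficient \<open>c\<close> matters only for \<open>i = j = 0\<close>.\<close>
    have c1: "c = 1" if "i + j = 0"
    proof -
      have "scale c (word []) = (word [] :: xy ncpoly)" using c that by simp
      then have "Poly_Mapping.lookup (scale c (word [] :: xy ncpoly)) [] = Poly_Mapping.lookup (word [] :: xy ncpoly) []"
        by (rule arg_cong[where f = "\<lambda>p. Poly_Mapping.lookup p []"])
      then show ?thesis by (simp add: lookup_word)
    qed
    let ?uv = "shuffle u v"
    have uv: "?uv \<in> keys_in ends_y" "ldq Ly ?uv = 0"
      using u v by (simp_all add: shuffle_in_ends_y ldq_shuffle)
    have "shuffle (shuffle (?y i) u) (shuffle (?y j) v) = shuffle (shuffle (?y i) (?y j)) ?uv"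
      by (metis shuffle_assoc shuffle_commute)
    then have e: "reg_zeta (shuffle (shuffle (?y i) u) (shuffle (?y j) v)) = scale c (reg_zeta (shuffle (?y (i + j)) ?uv))"
      by (simp only: c shuffle_lin qlinear_scale[OF qlinear_reg_zeta])
    have "scale c (reg_zeta (shuffle (?y (i + j)) ?uv) - (if i + j = 0 then decode ?uv else 0)) \<in> eds_ideal"
      by (intro qsubspace_scale[OF qsubspace_eds] z uv)
    moreover have "scale c (if i + j = 0 then decode ?uv else 0) = (if i + j = 0 then decode ?uv else 0)"
      using c1 by simp
    ultimately have 1: "reg_zeta (shuffle (shuffle (?y i) u) (shuffle (?y j) v)) - (if i + j = 0 then decode ?uv else 0) \<in> eds_ideal"
      unfolding e scale_diff by simp
    have 2: "(if i + j = 0 then decode ?uv else 0)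
        - stuffle (if i = 0 then decode u else 0) (if j = 0 then decode v else 0) \<in> eds_ideal"
      using decode_shuffle_cong[OF u(1) v] eds_refl[of 0] by auto
    have "stuffle (reg_zeta (shuffle (?y i) u)) (reg_zeta (shuffle (?y j) v))
        - stuffle (if i = 0 then decode u else 0) (if j = 0 then decode v else 0) \<in> eds_ideal"
    proof (rule eds_cong)
      show "(if i = 0 then decode u else 0) \<in> keys_in pos_words"
        using decode_in_H1[OF u(1)] qsubspace_0[OF qsubspace_keys_in] by auto
      show "reg_zeta (shuffle (?y j) v) \<in> keys_in pos_words"
        by (intro reg_zeta_in_H1 shuffle_in_ends_y y_power_ends_y v)
    qed (intro z u v)+
    then show ?thesis
      using 1 2 qsubspace_trans[OF qsubspace_eds] qsubspace_sym[OF qsubspace_eds] by blast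
  qed
  have addl: "?P (a + b) r" if "?P a r" "?P b r" for a b r
    using qsubspace_add[OF qsubspace_eds that]
    by (simp add: shuffle_lin stuffle_lin qlinear_add[OF qlinear_reg_zeta] algebra_simps)
  have addr: "?P r (a + b)" if "?P r a" "?P r b" for a b r
    using qsubspace_add[OF qsubspace_eds that]
    by (simp add: shuffle_lin stuffle_lin qlinear_add[OF qlinear_reg_zeta] algebra_simps)
  show ?thesis
  proof (rule admissible_decomposition_induct[OF p, where P = "\<lambda>p. ?P p q"])
    fix i u assume u: "u \<in> keys_in ends_y" "ldq Ly u = 0"
    show "?P (shuffle (?y i) u) q"
    proof (rule admissible_decomposition_induct[OF q, where P = "\<lambda>q. ?P (shuffle (?y i) u) q"])
      show "?P (shuffle (?y i) u) (shuffle (?y j) v)" if "v \<in> keys_in ends_y" "ldq Ly v = 0" for j v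
        using base[OF u that] .
    qed (use addr eds_refl[of 0] in \<open>auto simp: qlinear_0[OF qlinear_reg_zeta]\<close>)
  qed (use addl eds_refl[of 0] in \<open>auto simp: qlinear_0[OF qlinear_reg_zeta]\<close>)
qed

text \<open>
  Multiplying the generating series in the definition of \<open>reg_zeta\<close> by that of the words \<open>z\<^sub>1\<^sup>l\<close>
  cancels \<open>ones_inv\<close>.
\<close>

lemma decode_eq_ones_reg_zeta:
  assumes "\<And>w. w \<in> Poly_Mapping.keys p \<Longrightarrow> length w \<le> N"
  shows "decode p = (\<Sum>l\<le>N. stuffle (ones l) (reg_zeta ((ldq Ly ^^ l) p)))"
proof -
  let ?d = "\<lambda>n. decode ((ldq Ly ^^ n) p)"
  have "(\<Sum>l\<le>N. stuffle (ones l) (reg_zeta ((ldq Ly ^^ l) p)))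
      = (\<Sum>l\<le>N. \<Sum>j\<le>N - l. stuffle (stuffle (ones l) (ones_inv j)) (?d (l + j)))"
  proof (intro sum.cong refl)
    fix l assume l: "l \<in> {..N}"
    have "reg_zeta ((ldq Ly ^^ l) p) = (\<Sum>j\<le>N - l. stuffle (ones_inv j) (decode ((ldq Ly ^^ j) ((ldq Ly ^^ l) p))))"
    proof (rule reg_zeta_eq)
      fix w assume "w \<in> Poly_Mapping.keys ((ldq Ly ^^ l) p)"
      then have "replicate l Ly @ w \<in> Poly_Mapping.keys p" by (simp add: in_keys_iff lookup_ldq_power)
      from assms[OF this] show "length w \<le> N - l" by simp
    qed
    moreover have "(ldq Ly ^^ j) ((ldq Ly ^^ l) p) = (ldq Ly ^^ (l + j)) p" for j
      by (simp add: funpow_add add.commute[of l])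
    ultimately show "stuffle (ones l) (reg_zeta ((ldq Ly ^^ l) p))
        = (\<Sum>j\<le>N - l. stuffle (stuffle (ones l) (ones_inv j)) (?d (l + j)))"
      by (simp add: qlinear_sum[OF qlinear_stuffle_right] stuffle_assoc)
  qed
  also have "\<dots> = (\<Sum>(l, j)\<in>{(l, j). l + j \<le> N}. stuffle (stuffle (ones l) (ones_inv j)) (?d (l + j)))"
    by (subst sum.Sigma) (auto intro!: sum.cong)
  also have "\<dots> = (\<Sum>n\<le>N. \<Sum>l\<le>n. stuffle (stuffle (ones l) (ones_inv (n - l))) (?d (l + (n - l))))"
    by (rule sum.triangle_reindex_eq)
  also have "\<dots> = (\<Sum>n\<le>N. stuffle (if n = 0 then word [] else 0) (?d n))"
  proof (intro sum.cong refl)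
    fix n
    have "(\<Sum>l\<le>n. stuffle (stuffle (ones l) (ones_inv (n - l))) (?d (l + (n - l))))
        = stuffle (\<Sum>l\<le>n. stuffle (ones l) (ones_inv (n - l))) (?d n)"
      by (simp add: qlinear_sum[OF qlinear_stuffle_left])
    also have "(\<Sum>l\<le>n. stuffle (ones l) (ones_inv (n - l))) = (\<Sum>i\<le>n. stuffle (ones (n - i)) (ones_inv i))"
      by (rule sum.reindex_bij_witness[of _ "\<lambda>i. n - i" "\<lambda>i. n - i"]) auto
    finally show "(\<Sum>l\<le>n. stuffle (stuffle (ones l) (ones_inv (n - l))) (?d (l + (n - l))))
        = stuffle (if n = 0 then word [] else 0) (?d n)"
      unfolding ones_inv .
  qed
  also have "\<dots> = (\<Sum>n\<le>N. if n = 0 then decode p else 0)"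
    by (intro sum.cong) auto
  finally show ?thesis by simp
qed

section \<open>Deconcatenation\<close>

text \<open>
  The convolution product with respect to deconcatenation of words.
\<close>

definition convolution ::
    "('a ncpoly \<Rightarrow> nat ncpoly) \<Rightarrow> ('a ncpoly \<Rightarrow> nat ncpoly) \<Rightarrow> 'a ncpoly \<Rightarrow> nat ncpoly" where
  "convolution f g = lin_ext (\<lambda>w. \<Sum>i\<le>length w. stuffle (f (word (take i w))) (g (word (drop i w))))"

lemma qlinear_convolution: "qlinear (convolution f g)"
  by (simp add: convolution_def qlinear_lin_ext)

lemma qlinear_lmul: "qlinear (lmul a)"
  by (intro qlinearI lmul_add lmul_scale)

lemma convolution_lmul:
  assumes "qlinear f" "qlinear g"
  shows "convolution f g (lmul a p)
     = stuffle (f (word [])) (g (lmul a p)) + convolution (\<lambda>p. f (lmul a p)) g p"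
proof (rule qlinear_eqI[where F = "\<lambda>p. convolution f g (lmul a p)"
      and G = "\<lambda>p. stuffle (f (word [])) (g (lmul a p)) + convolution (\<lambda>p. f (lmul a p)) g p"])
  show "qlinear (\<lambda>p. convolution f g (lmul a p))"
    by (rule qlinear_comp[OF qlinear_convolution qlinear_lmul])
  show "qlinear (\<lambda>p. stuffle (f (word [])) (g (lmul a p)) + convolution (\<lambda>p. f (lmul a p)) g p)"
    by (intro qlinearI) (simp_all add: lmul_add lmul_scale qlinear_add[OF assms(2)] qlinear_scale[OF assms(2)]
        stuffle_lin qlinear_add[OF qlinear_convolution] qlinear_scale[OF qlinear_convolution] scale_add add_ac)
  fix w
  show "convolution f g (lmul a (word w))
      = stuffle (f (word [])) (g (lmul a (word w))) + convolution (\<lambda>p. f (lmul a p)) g (word w)"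
    by (simp add: convolution_def sum.atMost_Suc_shift del: sum.atMost_Suc)
qed

text \<open>
  Deconcatenation is an algebra homomorphism for the stuffle product. The map \<open>f\<close> is arbitrary in the
  induction because splitting off a first letter \<open>a\<close> replaces \<open>f\<close> by \<open>f \<circ> lmul a\<close>.
\<close>

lemma convolution_stuffle_word:
  assumes "qlinear f" "qlinear g"
  shows "convolution f g (stuffle_word u v) =
    (\<Sum>i\<le>length u. \<Sum>j\<le>length v. stuffle (f (stuffle_word (take i u) (take j v)))
        (g (stuffle_word (drop i u) (drop j v))))"
  using assms(1)
proof (induction u v arbitrary: f rule: stuffle_word.induct)
  case (1 v)
  then show ?case by (simp add: convolution_def)
next
  case (2 a u)
  then show ?case by (simp add: convolution_def)
next
  case (3 a u b v)
  have l: "qlinear (\<lambda>p. f (lmul c p))" for c by (rule qlinear_comp[OF 3(4) qlinear_lmul])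
  let ?T = "\<lambda>f u v. \<Sum>i\<le>length u. \<Sum>j\<le>length v. stuffle (f (stuffle_word (take i u) (take j v)))
        (g (stuffle_word (drop i u) (drop j v)))"
  have "convolution f g (stuffle_word (a # u) (b # v))
      = stuffle (f (word [])) (g (stuffle_word (a # u) (b # v)))
        + (?T (\<lambda>p. f (lmul a p)) u (b # v) + ?T (\<lambda>p. f (lmul b p)) (a # u) v
           + ?T (\<lambda>p. f (lmul (a + b) p)) u v)"
    unfolding "3.IH"[OF l, symmetric] stuffle_word.simps
    by (simp only: qlinear_add[OF qlinear_convolution] convolution_lmul[OF 3(4) assms(2)]
        qlinear_add[OF assms(2)] stuffle_lin add_ac)
  also have "\<dots> = ?T f (a # u) (b # v)"
  proof -
    \<comment> \<open>The first cut falls before the first letter of both words, of one of them, or of none.\<close>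
    have a: "?T (\<lambda>p. f (lmul a p)) u (b # v)
       = (\<Sum>i\<le>length u. stuffle (f (word (a # take i u))) (g (stuffle_word (drop i u) (b # v))))
       + (\<Sum>i\<le>length u. \<Sum>j\<le>length v. stuffle (f (lmul a (stuffle_word (take i u) (b # take j v))))
           (g (stuffle_word (drop i u) (drop j v))))"
      by (simp add: sum.atMost_Suc_shift sum.distrib del: sum.atMost_Suc)
    have b: "?T (\<lambda>p. f (lmul b p)) (a # u) v
       = (\<Sum>j\<le>length v. stuffle (f (word (b # take j v))) (g (stuffle_word (a # u) (drop j v))))
       + (\<Sum>i\<le>length u. \<Sum>j\<le>length v. stuffle (f (lmul b (stuffle_word (a # take i u) (take j v))))
           (g (stuffle_word (drop i u) (drop j v))))"
      by (simp add: sum.atMost_Suc_shift del: sum.atMost_Suc)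
    have c: "?T f (a # u) (b # v) = stuffle (f (word [])) (g (stuffle_word (a # u) (b # v)))
       + (\<Sum>j\<le>length v. stuffle (f (word (b # take j v))) (g (stuffle_word (a # u) (drop j v))))
       + (\<Sum>i\<le>length u. stuffle (f (word (a # take i u))) (g (stuffle_word (drop i u) (b # v))))
       + (\<Sum>i\<le>length u. \<Sum>j\<le>length v. stuffle (f (stuffle_word (a # take i u) (b # take j v)))
           (g (stuffle_word (drop i u) (drop j v))))"
      by (simp add: sum.atMost_Suc_shift sum.distrib add_ac del: sum.atMost_Suc stuffle_word.simps(3))
    show ?thesis
      unfolding a b c
      by (simp add: qlinear_add[OF 3(4)] stuffle_lin sum.distrib add_ac)
  qed
  finally show ?case .
qed

section \<open>A realization modulo extended double shuffle relations\<close>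

lemma reverse_shuffle: "reverse (shuffle p q) = shuffle (reverse p) (reverse q)"
  by (rule bilinear_eqI[where F = "\<lambda>p q. reverse (shuffle p q)" and G = "\<lambda>p q. shuffle (reverse p) (reverse q)"])
     (auto intro!: qlinearI simp: reverse_def lin_ext_add lin_ext_scale shuffle_lin reverse_shuffle_word[unfolded reverse_def])

definition ones_zeta :: "(nat \<times> nat) ncpoly \<Rightarrow> nat ncpoly" where
  "ones_zeta p = reg_zeta (lin_ext tau (reverse (lower_part p)))"

lemma qlinear_ones_zeta: "qlinear ones_zeta"
  unfolding ones_zeta_def reverse_def
  by (intro qlinear_comp[OF qlinear_reg_zeta] qlinear_comp[OF qlinear_lin_ext] qlinear_lower_part)

lemma ones_zeta_stuffle_word:
  assumes "u \<in> lists biletters" "v \<in> lists biletters"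
  shows "ones_zeta (stuffle_word u v) - stuffle (ones_zeta (word u)) (ones_zeta (word v)) \<in> eds_ideal"
  unfolding ones_zeta_def lower_part_stuffle_word[OF assms] reverse_shuffle tau_shuffle
  by (intro reg_zeta_shuffle tau_ends_y)

lemma ones_zeta_in_H1: "ones_zeta p \<in> keys_in pos_words"
  unfolding ones_zeta_def by (intro reg_zeta_in_H1 tau_ends_y)

definition upper_part :: "(nat \<times> nat) ncpoly \<Rightarrow> nat ncpoly" where
  "upper_part = lin_ext (\<lambda>w. if \<forall>kd\<in>set w. snd kd = 0 then word (map fst w) else 0)"

lemma qlinear_upper_part: "qlinear upper_part"
  by (simp add: upper_part_def qlinear_lin_ext)

lemma upper_part_word: "upper_part (word w) = (if \<forall>kd\<in>set w. snd kd = 0 then word (map fst w) else 0)"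
  by (simp add: upper_part_def)

lemma upper_part_lmul: "upper_part (lmul a p) = (if snd a = 0 then lmul (fst a) (upper_part p) else 0)"
  by (rule qlinear_eqI[where F = "\<lambda>p. upper_part (lmul a p)"
        and G = "\<lambda>p. if snd a = 0 then lmul (fst a) (upper_part p) else 0"])
     (auto intro!: qlinearI simp: upper_part_word lmul_add lmul_scale
        qlinear_add[OF qlinear_upper_part] qlinear_scale[OF qlinear_upper_part])

lemma upper_part_stuffle_word:
  "upper_part (stuffle_word u v) = stuffle (upper_part (word u)) (upper_part (word v))"
proof (induction u v rule: stuffle_word.induct)
  case (3 a u b v)
  have c: "upper_part (word (x # w)) = (if snd x = 0 then lmul (fst x) (upper_part (word w)) else 0)" for x w
    using upper_part_lmul[of x "word w"] by simp
  show ?case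
    using 3 by (auto simp: qlinear_add[OF qlinear_upper_part] upper_part_lmul c stuffle_lmul)
qed (auto simp: upper_part_word)

lemma upper_part_in_H1: "w \<in> lists biletters \<Longrightarrow> upper_part (word w) \<in> keys_in pos_words"
  using qsubspace_0[OF qsubspace_keys_in]
  by (auto simp: upper_part_word pos_words_def biletters_def in_lists_conv_set)

definition realization :: "(nat \<times> nat) ncpoly \<Rightarrow> nat ncpoly" where
  "realization = convolution ones_zeta upper_part"

lemma qlinear_realization: "qlinear realization"
  by (simp add: realization_def qlinear_convolution)

lemma realization_word:
  "realization (word w) = (\<Sum>i\<le>length w. stuffle (ones_zeta (word (take i w))) (upper_part (word (drop i w))))"
  by (simp add: realization_def convolution_def)

lemma realization_in_H1: "w \<in> lists biletters \<Longrightarrow> realization (word w) \<in> keys_in pos_words"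
  unfolding realization_word
  by (intro qsubspace_sum[OF qsubspace_keys_in] stuffle_in_H1 ones_zeta_in_H1 upper_part_in_H1)
     (auto dest: in_set_dropD)

text \<open>
  By \<open>convolution_stuffle_word\<close>, the convolution of two multiplicative maps into a commutative algebra
  is multiplicative.
\<close>

lemma realization_stuffle_word:
  assumes "u \<in> lists biletters" "v \<in> lists biletters"
  shows "realization (stuffle_word u v) - stuffle (realization (word u)) (realization (word v)) \<in> eds_ideal"
proof -
  let ?S = "\<lambda>w i. ones_zeta (word (take i w))" and ?Z = "\<lambda>w i. upper_part (word (drop i w))"
  have t: "take i w \<in> lists biletters" "drop i w \<in> lists biletters" if "w \<in> lists biletters" for i w
    using that by (auto dest: in_set_takeD in_set_dropD)
  have "stuffle (realization (word u)) (realization (word v))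
      = (\<Sum>i\<le>length u. \<Sum>j\<le>length v. stuffle (stuffle (?S u i) (?S v j)) (stuffle (?Z u i) (?Z v j)))"
  proof -
    have "stuffle (stuffle a b) (stuffle c d) = stuffle (stuffle a c) (stuffle b d)" for a b c d :: "nat ncpoly"
      by (metis stuffle_assoc stuffle_commute)
    then show ?thesis
      unfolding realization_word
      by (subst sum.swap) (simp only: qlinear_sum[OF qlinear_stuffle_left] qlinear_sum[OF qlinear_stuffle_right])
  qed
  then show ?thesis
    unfolding realization_def convolution_stuffle_word[OF qlinear_ones_zeta qlinear_upper_part]
    unfolding realization_def[symmetric]
    by (simp only: upper_part_stuffle_word)
       (intro eds_sum eds_cong ones_zeta_stuffle_word eds_refl stuffle_in_H1 ones_zeta_in_H1 upper_part_in_H1 t assms)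
qed

lemma realization_mixed:
  assumes "w \<in> mixed_words"
  shows "realization (word w) = 0"
proof -
  have "stuffle (ones_zeta (word (take i w))) (upper_part (word (drop i w))) = 0" for i
  proof (rule ccontr)
    assume ne: "stuffle (ones_zeta (word (take i w))) (upper_part (word (drop i w))) \<noteq> 0"
    have "\<forall>kd\<in>set (take i w). fst kd = 1"
      using ne by (auto simp: ones_zeta_def lower_part_word reverse_def qlinear_0[OF qlinear_reg_zeta] split: if_splits)
    moreover have "\<forall>kd\<in>set (drop i w). snd kd = 0"
      using ne by (auto simp: upper_part_word split: if_splits)
    moreover have "w \<in> lists biletters" using assms by (simp add: mixed_words_def)
    ultimately have "take i w \<in> lists biletters_1" "drop i w \<in> lists biletters_0"
      by (auto simp: biletters_1_def biletters_0_def biletters_def in_lists_conv_set dest: in_set_dropD) 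
    moreover have "w = take i w @ drop i w" by simp
    ultimately show False using assms unfolding mixed_words_def by blast
  qed
  then show ?thesis unfolding realization_word by simp
qed

lemma tau_zeros: "tau (replicate i 0) = word (replicate i Ly)"
proof (induction i)
  case (Suc i)
  then show ?case by (cases i) (simp_all add: insert_y_word ins_cases)
qed simp

text \<open>
  A nonempty initial part of the word contributes the regularized value of a power of \<open>y\<close>, or zero.
\<close>

lemma realization_H1_to_QA: "realization (H1_to_QA p) = p"
proof (rule qlinear_eqI[OF qlinear_comp[OF qlinear_realization qlinear_H1_to_QA] qlinear_id])
  fix ks :: "nat list"
  let ?w = "map (\<lambda>k. (k, 0)) ks :: (nat \<times> nat) list"
  have "realization (word ?w) = (\<Sum>i\<le>length ?w. if i = 0 then word ks else 0)"
    unfolding realization_word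
  proof (intro sum.cong refl)
    fix i assume i: "i \<in> {..length ?w}"
    have s: "map snd (take i ?w) = replicate i 0"
      using i by (intro nth_equalityI) auto
    show "stuffle (ones_zeta (word (take i ?w))) (upper_part (word (drop i ?w))) = (if i = 0 then word ks else 0)"
    proof (cases "i = 0")
      case True
      then show ?thesis
        using reg_zeta_y_power[of 0] by (simp add: ones_zeta_def lower_part_word reverse_def upper_part_word o_def)
    next
      case False
      have "ones_zeta (word (take i ?w)) = 0"
        unfolding ones_zeta_def lower_part_word s
        using False by (simp add: reverse_def tau_zeros reg_zeta_y_power qlinear_0[OF qlinear_reg_zeta])
      then show ?thesis using False by simp
    qed
  qed
  then show "realization (H1_to_QA (word ks)) = word ks" by (simp add: H1_to_QA_def)
qed

section \<open>Swap invariance\<close>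

definition block_value :: "nat list \<Rightarrow> nat \<Rightarrow> nat list \<Rightarrow> nat ncpoly" where
  "block_value ds l ks = stuffle (reg_zeta (tau (rev ds))) (stuffle (ones l) (reg_zeta (word (xy_word ks))))"

text \<open>
  The contribution to \<open>realization\<close> of the decomposition of \<open>w\<close> as a block word with outer parts of
  lengths \<open>j\<close> and \<open>q\<close>.
\<close>

definition block_part :: "nat \<Rightarrow> nat \<Rightarrow> (nat \<times> nat) list \<Rightarrow> nat ncpoly" where
  "block_part j q w = (let l = length w - j - q; ds = map snd (take j w); ks = map fst (drop (j + l) w)
     in if w = block ds l ks then block_value ds l ks else 0)"

lemma block_eq_iff:
  assumes "length ds = length ds'"
  shows "block ds l ks = block ds' l ks' \<longleftrightarrow> ds = ds' \<and> ks = ks'"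
  using assms by (simp add: block_def inj_map_eq_map inj_on_def)

lemma block_part_block:
  "block_part (length ds) (length ks) (block ds l ks) = block_value ds l ks"
proof -
  have "map snd (take (length ds) (block ds l ks)) = ds" "map fst (drop (length ds + l) (block ds l ks)) = ks"
    by (simp_all add: block_def o_def)
  then show ?thesis by (simp add: block_part_def Let_def)
qed

lemma block_part_nonzeroD:
  assumes "block_part j q w \<noteq> 0" "length w = j + l + q"
  obtains ds ks where "w = block ds l ks" "length ds = j" "length ks = q"
proof -
  let ?ds = "map snd (take j w)" and ?ks = "map fst (drop (j + l) w)"
  have "w = block ?ds l ?ks"
    using assms by (simp add: block_part_def Let_def split: if_splits)
  moreover have "length ?ds = j" "length ?ks = q"
    using assms(2) by auto
  ultimately show thesis by (rule that)
qed

lemma ldq_power_xy_word: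
  assumes "ks \<in> pos_words" "l \<le> length ks"
  shows "(ldq Ly ^^ l) (word (xy_word ks)) = (if take l ks = replicate l 1 then word (xy_word (drop l ks)) else 0)"
  using assms
proof (induction l arbitrary: ks)
  case (Suc l)
  then obtain k ks' where ks: "ks = k # ks'" by (cases ks) auto
  have "(ldq Ly ^^ Suc l) (word (xy_word ks)) = (ldq Ly ^^ l) (ldq Ly (word (xy_word ks)))"
    by (simp add: funpow_Suc_right del: funpow.simps)
  also have "ldq Ly (word (xy_word ks)) = (if k = 1 then word (xy_word ks') else 0)"
    using Suc.prems by (cases "k - 1") (auto simp: ks xy_word_Cons pos_words_def)
  also have "(ldq Ly ^^ l) \<dots> = (if take (Suc l) ks = replicate (Suc l) 1 then word (xy_word (drop (Suc l) ks)) else 0)"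
    using Suc.IH[of ks'] Suc.prems by (auto simp: ks pos_words_def)
  finally show ?case .
qed simp

lemma word_eq_ones_reg_zeta:
  assumes "ks \<in> pos_words"
  shows "word ks = (\<Sum>l\<le>length ks. if take l ks = replicate l 1
      then stuffle (ones l) (reg_zeta (word (xy_word (drop l ks)))) else 0)"
proof -
  let ?N = "length (xy_word ks)"
  have len: "length ks \<le> ?N" by (induction ks) (auto simp: xy_word_Cons)
  have z: "(ldq Ly ^^ l) (word (xy_word ks)) = 0" if l: "l > length ks" for l
  proof -
    have "(ldq Ly ^^ length ks) (word (xy_word ks)) = word [] \<or> (ldq Ly ^^ length ks) (word (xy_word ks)) = 0"
      using ldq_power_xy_word[OF assms, of "length ks"] by auto
    moreover have "(ldq Ly ^^ Suc i) (word [] :: xy ncpoly) = 0" for i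
      by (simp add: funpow_Suc_right del: funpow.simps)
    moreover obtain i where "l = Suc i + length ks" using l less_iff_Suc_add[of "length ks" l] by auto
    moreover from this have "(ldq Ly ^^ l) (word (xy_word ks)) = (ldq Ly ^^ Suc i) ((ldq Ly ^^ length ks) (word (xy_word ks)))"
      by (simp only: funpow_add o_apply)
    ultimately show ?thesis by (elim disjE) (simp_all only: ldq_power_0)
  qed
  have "word ks = (\<Sum>l\<le>?N. stuffle (ones l) (reg_zeta ((ldq Ly ^^ l) (word (xy_word ks)))))"
    using decode_eq_ones_reg_zeta[of "word (xy_word ks)" ?N] assms by simp
  also have "\<dots> = (\<Sum>l\<le>length ks. stuffle (ones l) (reg_zeta ((ldq Ly ^^ l) (word (xy_word ks)))))"
    using len by (intro sum.mono_neutral_right) (auto simp: z qlinear_0[OF qlinear_reg_zeta])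
  also have "\<dots> = (\<Sum>l\<le>length ks. if take l ks = replicate l 1
      then stuffle (ones l) (reg_zeta (word (xy_word (drop l ks)))) else 0)"
    by (intro sum.cong) (auto simp: ldq_power_xy_word[OF assms] qlinear_0[OF qlinear_reg_zeta])
  finally show ?thesis .
qed

text \<open>
  The second factor in each summand of \<open>realization\<close> is expanded with \<open>word_eq_ones_reg_zeta\<close>; this
  separates the leading letters \<open>(1, 0)\<close> as the middle part of a block word.
\<close>

lemma realization_block_parts:
  assumes w: "w \<in> lists biletters"
  shows "realization (word w) = (\<Sum>(j, q) | j + q \<le> length w. block_part j q w)"
proof -
  let ?r = "length w"
  have "stuffle (ones_zeta (word (take j w))) (upper_part (word (drop j w)))
      = (\<Sum>l\<le>?r - j. block_part j (?r - j - l) w)" if j: "j \<le> ?r" for j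
  proof (cases "(\<forall>kd\<in>set (take j w). fst kd = 1) \<and> (\<forall>kd\<in>set (drop j w). snd kd = 0)")
    case True
    define ds ks where "ds = map snd (take j w)" and "ks = map fst (drop j w)"
    have ks: "ks \<in> pos_words" "length ks = ?r - j"
      using w by (auto simp: ks_def pos_words_def biletters_def in_lists_conv_set dest!: in_set_dropD)
    have ds: "length ds = j" using j by (simp add: ds_def)
    have tk: "take j w = map (Pair 1) ds" "drop j w = map (\<lambda>k. (k, 0)) ks"
      unfolding ds_def ks_def map_map o_def using True
      by (auto intro!: map_idI[symmetric] simp: prod_eq_iff)
    then have wd: "w = map (Pair 1) ds @ map (\<lambda>k. (k, 0)) ks" by (metis append_take_drop_id)
    have "ones_zeta (word (take j w)) = reg_zeta (tau (rev ds))"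
      using True by (simp add: ones_zeta_def lower_part_word reverse_def ds_def)
    moreover have "upper_part (word (drop j w)) = word ks"
      using True by (simp add: upper_part_word ks_def)
    moreover have "stuffle (reg_zeta (tau (rev ds))) (if take l ks = replicate l 1
        then stuffle (ones l) (reg_zeta (word (xy_word (drop l ks)))) else 0) = block_part j (?r - j - l) w"
      if l: "l \<le> length ks" for l
    proof -
      have e: "?r - j - (?r - j - l) = l" using l ks by simp
      have f: "map fst (drop (j + l) w) = drop l ks" by (simp add: ks_def drop_map add.commute)
      have "w = block ds l (drop l ks) \<longleftrightarrow> take l ks = replicate l 1"
      proof -
        have "map (\<lambda>k. (k, 0 :: nat)) ks = map (\<lambda>k. (k, 0)) (take l ks) @ map (\<lambda>k. (k, 0)) (drop l ks)"
          by (metis append_take_drop_id map_append)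
        then have "w = block ds l (drop l ks) \<longleftrightarrow> map (\<lambda>k. (k, 0 :: nat)) (take l ks) = replicate l (1, 0)"
          by (simp add: wd block_def)
        also have "\<dots> \<longleftrightarrow> take l ks = replicate l 1"
          using l by (auto simp: list_eq_iff_nth_eq)
        finally show ?thesis .
      qed
      then show ?thesis
        unfolding block_part_def Let_def e f ds_def[symmetric] by (simp add: block_value_def)
    qed
    ultimately show ?thesis
      by (subst (asm) word_eq_ones_reg_zeta[OF ks(1)]) (simp add: qlinear_sum[OF qlinear_stuffle_right] ks(2))
  next
    case False
    have "block_part j (?r - j - l) w = 0" if l: "l \<le> ?r - j" for l
    proof (rule ccontr)
      assume "block_part j (?r - j - l) w \<noteq> 0"
      moreover have "?r = j + l + (?r - j - l)" using j l by simp
      ultimately obtain ds ks where b: "w = block ds l ks" "length ds = j"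
        by (rule block_part_nonzeroD)
      have "take j w = map (Pair 1) ds" "drop j w = replicate l (1, 0) @ map (\<lambda>k. (k, 0)) ks"
        unfolding b(1) block_def using b(2) by simp_all
      then show False using False by auto
    qed
    moreover have "stuffle (ones_zeta (word (take j w))) (upper_part (word (drop j w))) = 0"
      using False by (auto simp: ones_zeta_def lower_part_word upper_part_word reverse_def qlinear_0[OF qlinear_reg_zeta])
    ultimately show ?thesis by simp
  qed
  then have "realization (word w) = (\<Sum>j\<le>?r. \<Sum>l\<le>?r - j. block_part j (?r - j - l) w)"
    unfolding realization_word by (intro sum.cong) auto
  also have "\<dots> = (\<Sum>j\<le>?r. \<Sum>q\<le>?r - j. block_part j q w)"
  proof (rule sum.cong[OF refl])
    fix j
    show "(\<Sum>l\<le>?r - j. block_part j (?r - j - l) w) = (\<Sum>q\<le>?r - j. block_part j q w)"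
      by (rule sum.reindex_bij_witness[of _ "\<lambda>i. ?r - j - i" "\<lambda>i. ?r - j - i"]) auto
  qed
  also have "\<dots> = (\<Sum>(j, q) | j + q \<le> ?r. block_part j q w)"
    by (subst sum.Sigma) (auto intro!: sum.cong)
  finally show ?thesis .
qed

lemma bilinear_expand:
  assumes "\<And>q. qlinear (\<lambda>p. F p q)" "\<And>p. qlinear (F p)"
  shows "F p q = (\<Sum>(u, v)\<in>Poly_Mapping.keys p \<times> Poly_Mapping.keys q.
     scale (Poly_Mapping.lookup p u * Poly_Mapping.lookup q v) (F (word u) (word v)))"
proof -
  have "F p q = (\<Sum>u\<in>Poly_Mapping.keys p. scale (Poly_Mapping.lookup p u) (F (word u) q))"
    by (rule qlinear_expand[OF assms(1)])
  also have "\<dots> = (\<Sum>u\<in>Poly_Mapping.keys p. \<Sum>v\<in>Poly_Mapping.keys q.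
     scale (Poly_Mapping.lookup p u * Poly_Mapping.lookup q v) (F (word u) (word v)))"
    by (intro sum.cong refl, subst qlinear_expand[OF assms(2)]) (simp add: scale_sum)
  finally show ?thesis by (simp add: sum.cartesian_product)
qed

text \<open>
  The coefficients of the swap are products of coefficients of \<open>tau\<close> and \<open>theta\<close>. Summation over
  the first part gives \<open>reg_zeta\<close> at \<open>tau (theta \<dots>)\<close>, hence at the word in \<open>z\<^sub>k\<close> from the last part of
  \<open>w\<close>; summation over the last part gives \<open>reg_zeta\<close> at \<open>tau\<close> of the first part of \<open>w\<close>. These are the
  two factors in the value of \<open>w\<close>, in the opposite order.
\<close>

lemma block_part_swap:
  assumes w: "w \<in> lists biletters" and jq: "j + q \<le> length w"
  shows "lin_ext (block_part j q) (swap_word w) = block_part q j w"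
proof -
  let ?r = "length w" and ?l = "length w - j - q"
  have len: "length w' = ?r" if "w' \<in> Poly_Mapping.keys (swap_word w)" for w'
    using that by (auto simp: in_keys_iff lookup_swap_word split: if_splits)
  show ?thesis
  proof (cases "\<exists>ds as. w = block ds ?l (map Suc as) \<and> length ds = q \<and> length as = j")
    case True
    then obtain ds as where b: "w = block ds ?l (map Suc as)" "length ds = q" "length as = j" by blast
    define l where "l = ?l"
    have b': "w = block ds l (map Suc as)" using b l_def by simp
    define t where "t = decode (tau (rev ds))"
    have te: "tau (rev ds) \<in> keys_in ends_y" using tau_ends_y[of "word (rev ds)"] by simp
    \<comment> \<open>Only the words \<open>?c (us, ks)\<close> contribute, and for them the coefficients factor.\<close>
    let ?c = "\<lambda>(us, ks). block (rev us) l ks"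
    let ?K = "Poly_Mapping.keys (theta as) \<times> Poly_Mapping.keys t"
    have us: "length us = j" if "us \<in> Poly_Mapping.keys (theta as)" for us
      using keys_inD[OF theta_keys_in that] b(3) by simp
    have ks: "ks \<in> pos_words \<and> length ks = q" if "ks \<in> Poly_Mapping.keys t" for ks
    proof
      show p: "ks \<in> pos_words" using keys_inD[OF decode_in_H1[OF te]] that by (simp add: t_def)
      have "xy_word ks \<in> Poly_Mapping.keys (tau (rev ds))"
        using that lookup_decode[OF te p] by (simp add: in_keys_iff t_def)
      from keys_inD[OF tau_keys_in this] show "length ks = q"
        using p inj_onD[OF inj_on_xy_word] b(2) unfolding xy_words_def pos_words_def by fastforce
    qed
    have coeff: "Poly_Mapping.lookup (swap_word w) (block (rev us) l ks)
        = Poly_Mapping.lookup (theta as) us * Poly_Mapping.lookup t ks"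
      if "length us = j" "length ks = q" "ks \<in> pos_words" for us ks
      using swap_coeff_block[of ks ds as us l] that b(2,3) lookup_decode[OF te that(3)]
      by (simp add: b' t_def pos_words_def mult.commute)
    have inj: "inj_on ?c ?K"
    proof (rule inj_onI, clarify)
      fix us ks us' ks'
      assume "us \<in> Poly_Mapping.keys (theta as)" "us' \<in> Poly_Mapping.keys (theta as)"
        "block (rev us) l ks = block (rev us') l ks'"
      then show "us = us' \<and> ks = ks'"
        using us[of us] us[of us'] block_eq_iff[of "rev us" "rev us'"] by simp
    qed
    have "lin_ext (block_part j q) (swap_word w)
        = (\<Sum>w'\<in>Poly_Mapping.keys (swap_word w) \<union> ?c ` ?K.
             scale (Poly_Mapping.lookup (swap_word w) w') (block_part j q w'))"
      by (rule lin_ext_superset) auto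
    also have "\<dots> = (\<Sum>w'\<in>?c ` ?K. scale (Poly_Mapping.lookup (swap_word w) w') (block_part j q w'))"
    proof (rule sum.mono_neutral_right)
      show "\<forall>w'\<in>Poly_Mapping.keys (swap_word w) \<union> ?c ` ?K - ?c ` ?K.
          scale (Poly_Mapping.lookup (swap_word w) w') (block_part j q w') = 0"
      proof (rule ballI, rule ccontr)
        fix w' assume w': "w' \<in> Poly_Mapping.keys (swap_word w) \<union> ?c ` ?K - ?c ` ?K"
          and ne: "scale (Poly_Mapping.lookup (swap_word w) w') (block_part j q w') \<noteq> 0"
        have k: "w' \<in> Poly_Mapping.keys (swap_word w)" using w' by blast
        have "block_part j q w' \<noteq> 0" using ne by auto
        moreover have "length w' = j + l + q" using len[OF k] jq by (simp add: l_def)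
        ultimately obtain ds' ks' where b2: "w' = block ds' l ks'" "length ds' = j" "length ks' = q"
          by (rule block_part_nonzeroD)
        have "w' \<in> lists biletters" using k by (auto simp: in_keys_iff lookup_swap_word split: if_splits)
        then have "ks' \<in> pos_words" by (auto simp: b2 block_def biletters_def pos_words_def)
        then have "Poly_Mapping.lookup (swap_word w) w'
            = Poly_Mapping.lookup (theta as) (rev ds') * Poly_Mapping.lookup t ks'"
          using coeff[of "rev ds'" ks'] b2 by simp
        then have "(rev ds', ks') \<in> ?K" using k by (auto simp: in_keys_iff)
        then have "w' \<in> ?c ` ?K" unfolding b2 by (rule rev_image_eqI) simp
        then show False using w' by blast
      qed
    qed auto
    also have "\<dots> = (\<Sum>(us, ks)\<in>?K. scale (Poly_Mapping.lookup (theta as) us * Poly_Mapping.lookup t ks)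
        (block_value (rev us) l ks))"
      unfolding sum.reindex[OF inj]
    proof (intro sum.cong refl, clarsimp)
      fix u v assume "u \<in> Poly_Mapping.keys (theta as)" "v \<in> Poly_Mapping.keys t"
      then show "scale (Poly_Mapping.lookup (swap_word w) (block (rev u) l v)) (block_part j q (block (rev u) l v))
          = scale (Poly_Mapping.lookup (theta as) u * Poly_Mapping.lookup t v) (block_value (rev u) l v)"
        using us[of u] ks[of v] coeff[of u v] block_part_block[of "rev u" v l] by simp
    qed
    also have "\<dots> = stuffle (reg_zeta (lin_ext tau (theta as))) (stuffle (ones l) (reg_zeta (xy_embed t)))"
      by (subst bilinear_expand[where F = "\<lambda>p q. stuffle (reg_zeta (lin_ext tau p)) (stuffle (ones l) (reg_zeta (xy_embed q)))"])
         (auto intro!: qlinearI simp: lin_ext_add lin_ext_scale qlinear_add[OF qlinear_reg_zeta] qlinear_scale[OF qlinear_reg_zeta]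
            qlinear_add[OF qlinear_xy_embed] qlinear_scale[OF qlinear_xy_embed] stuffle_lin block_value_def)
    also have "\<dots> = block_value ds l (map Suc as)"
      unfolding t_def xy_embed_decode[OF te] tau_theta block_value_def
      by (metis stuffle_assoc stuffle_commute)
    also have "\<dots> = block_part q j w"
      using block_part_block[of ds "map Suc as" l] b(2,3) b' by simp
    finally show ?thesis .
  next
    case False
    have "scale (Poly_Mapping.lookup (swap_word w) w') (block_part j q w') = 0"
      if k: "w' \<in> Poly_Mapping.keys (swap_word w)" for w'
    proof (rule ccontr)
      assume "scale (Poly_Mapping.lookup (swap_word w) w') (block_part j q w') \<noteq> 0"
      then have "block_part j q w' \<noteq> 0" by auto
      moreover have "length w' = j + ?l + q" using len[OF k] jq by simp
      ultimately obtain ds' ks' where b2: "w' = block ds' ?l ks'" "length ds' = j" "length ks' = q"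
        by (rule block_part_nonzeroD)
      have "Poly_Mapping.lookup (swap_word w) (block (rev (rev ds')) ?l ks') = 0"
        using False b2 jq by (intro swap_coeff_block_0[OF w]) auto
      then have "Poly_Mapping.lookup (swap_word w) w' = 0"
        by (simp only: rev_rev_ident b2(1))
      then show False using k by (simp add: in_keys_iff)
    qed
    then have "lin_ext (block_part j q) (swap_word w) = 0" by (simp add: lin_ext_def)
    moreover have "block_part q j w = 0"
    proof (rule ccontr)
      assume "block_part q j w \<noteq> 0"
      moreover have "length w = q + ?l + j" using jq by simp
      ultimately obtain ds ks where b: "w = block ds ?l ks" "length ds = q" "length ks = j"
        by (rule block_part_nonzeroD)
      have "set ks \<subseteq> fst ` set (block ds ?l ks)" by (force simp: block_def)
      also have "\<dots> \<subseteq> fst ` biletters" using w unfolding b(1)[symmetric] by auto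
      finally have "\<forall>k\<in>set ks. 1 \<le> k" by (auto simp: biletters_def)
      then have "map Suc (map (\<lambda>k. k - 1) ks) = ks" unfolding map_map by (intro map_idI) auto
      then show False using False b by (metis length_map)
    qed
    ultimately show ?thesis by simp
  qed
qed

lemma realization_swap:
  assumes "p \<in> keys_in (lists biletters)"
  shows "realization (swap p) = realization p"
proof (rule qlinear_eqI[OF qlinear_comp[OF qlinear_realization qlinear_swap] qlinear_realization])
  fix w assume "w \<in> Poly_Mapping.keys p"
  then have w: "w \<in> lists biletters" using assms by (rule keys_inD[rotated])
  have fin: "finite {(j, q). j + q \<le> length w}"
    by (rule finite_subset[of _ "{..length w} \<times> {..length w}"]) auto
  have "realization (swap_word w)
      = (\<Sum>w'\<in>Poly_Mapping.keys (swap_word w). scale (Poly_Mapping.lookup (swap_word w) w') (realization (word w')))"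
    by (rule qlinear_expand[OF qlinear_realization])
  also have "\<dots> = (\<Sum>w'\<in>Poly_Mapping.keys (swap_word w). \<Sum>(j, q) | j + q \<le> length w.
      scale (Poly_Mapping.lookup (swap_word w) w') (block_part j q w'))"
  proof (intro sum.cong refl)
    fix w' assume "w' \<in> Poly_Mapping.keys (swap_word w)"
    then have "w' \<in> lists biletters" "length w' = length w"
      by (auto simp: in_keys_iff lookup_swap_word split: if_splits)
    then show "scale (Poly_Mapping.lookup (swap_word w) w') (realization (word w'))
        = (\<Sum>(j, q) | j + q \<le> length w. scale (Poly_Mapping.lookup (swap_word w) w') (block_part j q w'))"
      by (simp add: realization_block_parts scale_sum split_beta)
  qed
  also have "\<dots> = (\<Sum>(j, q) | j + q \<le> length w. lin_ext (block_part j q) (swap_word w))"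
    unfolding lin_ext_def by (subst sum.swap) (simp add: split_beta)
  also have "\<dots> = (\<Sum>(j, q) | j + q \<le> length w. block_part q j w)"
    by (intro sum.cong) (auto simp: block_part_swap[OF w])
  also have "\<dots> = (\<Sum>(j, q) | j + q \<le> length w. block_part j q w)"
    by (rule sum.reindex_bij_witness[of _ prod.swap prod.swap]) auto
  also have "\<dots> = realization (word w)"
    by (rule realization_block_parts[OF w, symmetric])
  finally show "realization (swap (word w)) = realization (word w)" by (simp add: swap_def)
qed

section \<open>The kernel\<close>

definition realization_kernel :: "(nat \<times> nat) ncpoly set" where
  "realization_kernel = {p \<in> carrier QA. realization p \<in> eds_ideal}"

lemma realization_carrier: "p \<in> keys_in (lists biletters) \<Longrightarrow> realization p \<in> keys_in pos_words"
  by (rule qsubspace_qlinear[OF qsubspace_keys_in qlinear_realization])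
     (auto intro: realization_in_H1 dest: keys_inD)

lemma realization_stuffle:
  assumes "p \<in> keys_in (lists biletters)" "q \<in> keys_in (lists biletters)"
  shows "realization (stuffle p q) - stuffle (realization p) (realization q) \<in> eds_ideal"
  by (rule qlinear_bilinear_mem[OF qsubspace_eds,
        where F = "\<lambda>p q. realization (stuffle p q) - stuffle (realization p) (realization q)"])
     (use assms realization_stuffle_word in \<open>auto intro!: qlinearI dest!: keys_inD
        simp: stuffle_lin qlinear_add[OF qlinear_realization] qlinear_scale[OF qlinear_realization] scale_diff\<close>)

lemma ideal_stuffle_algI:
  assumes "ring (stuffle_alg A)" "qsubspace I" "I \<subseteq> keys_in (lists A)"
    and closed: "\<And>p q. p \<in> I \<Longrightarrow> q \<in> keys_in (lists A) \<Longrightarrow> stuffle q p \<in> I"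
  shows "ideal I (stuffle_alg A)"
proof (rule idealI[OF assms(1)])
  interpret ring "stuffle_alg A" by (rule assms(1))
  have inv: "\<ominus>\<^bsub>stuffle_alg A\<^esub> p = scale (- 1) p" if "p \<in> I" for p
  proof (rule minus_equality)
    show "scale (- 1) p \<oplus>\<^bsub>stuffle_alg A\<^esub> p = \<zero>\<^bsub>stuffle_alg A\<^esub>"
      by (auto simp: stuffle_alg_def lookup_add intro!: poly_mapping_eqI)
  qed (use that assms(3) qsubspace_scale[OF qsubspace_keys_in] in \<open>auto simp: carrier_stuffle_alg\<close>)
  show "subgroup I (add_monoid (stuffle_alg A))"
  proof (rule add.subgroupI)
    show "I \<subseteq> carrier (stuffle_alg A)" using assms(3) by (simp add: carrier_stuffle_alg)
    show "I \<noteq> {}" using qsubspace_0[OF assms(2)] by auto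
    show "\<ominus>\<^bsub>stuffle_alg A\<^esub> p \<in> I" if "p \<in> I" for p
      using inv[OF that] qsubspace_scale[OF assms(2) that] by simp
    show "p \<oplus>\<^bsub>stuffle_alg A\<^esub> q \<in> I" if "p \<in> I" "q \<in> I" for p q
      using qsubspace_add[OF assms(2) that] by (simp add: stuffle_alg_def)
  qed
  fix p q assume "p \<in> I" "q \<in> carrier (stuffle_alg A)"
  then have "stuffle q p \<in> I" using closed by (simp add: carrier_stuffle_alg)
  then show "q \<otimes>\<^bsub>stuffle_alg A\<^esub> p \<in> I" "p \<otimes>\<^bsub>stuffle_alg A\<^esub> q \<in> I"
    by (simp_all add: stuffle_alg_def stuffle_commute)
qed

lemma qsubspace_vimage:
  assumes "qlinear F" "qsubspace U" "qsubspace V"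
  shows "qsubspace {p \<in> U. F p \<in> V}"
  using assms by (auto simp: qsubspace_def qlinear_add qlinear_scale qlinear_0)

lemma ideal_realization_kernel: "ideal realization_kernel QA"
proof (rule ideal_stuffle_algI)
  show "ring QA" by (rule cring.axioms(1)[OF cring_QA])
  show "qsubspace realization_kernel"
    unfolding realization_kernel_def carrier_stuffle_alg
    by (rule qsubspace_vimage[OF qlinear_realization qsubspace_keys_in qsubspace_eds])
  show "realization_kernel \<subseteq> keys_in (lists biletters)"
    by (auto simp: realization_kernel_def carrier_stuffle_alg)
  fix p q assume p: "p \<in> realization_kernel" and q: "q \<in> keys_in (lists biletters)"
  then have p': "p \<in> keys_in (lists biletters)" "realization p \<in> eds_ideal"
    by (auto simp: realization_kernel_def carrier_stuffle_alg)
  have "stuffle (realization q) (realization p) \<in> eds_ideal"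
    using ideal_stuffle(2)[OF ideal_eds p'(2)] realization_carrier[OF q] unfolding pos_words_def by blast
  from qsubspace_add[OF qsubspace_eds realization_stuffle[OF q p'(1)] this]
  have "realization (stuffle q p) \<in> eds_ideal" by simp
  moreover have "stuffle q p \<in> keys_in (lists biletters)"
    using q p'(1) unfolding free_alg_keys_in[symmetric]
    by (intro stuffle_in_free_alg) (auto simp: biletters_def)
  ultimately show "stuffle q p \<in> realization_kernel"
    by (simp add: realization_kernel_def carrier_stuffle_alg)
qed

lemma swap_ideal_subset: "swap_ideal \<subseteq> realization_kernel"
  unfolding swap_ideal_def
proof (rule ring.genideal_minimal[OF cring.axioms(1)[OF cring_QA] ideal_realization_kernel], clarify)
  fix p assume p: "p \<in> carrier QA"
  then have "realization (swap p - p) = 0"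
    using realization_swap by (simp add: qlinear_diff[OF qlinear_realization] carrier_stuffle_alg)
  moreover have "swap p - p \<in> carrier QA"
    using p swap_in_QA[of p] unfolding carrier_stuffle_alg by (intro qsubspace_diff[OF qsubspace_keys_in])
  ultimately show "swap p - p \<in> realization_kernel"
    using qsubspace_0[OF qsubspace_eds] by (simp add: realization_kernel_def)
qed

lemma ideal_surjective_image:
  assumes "ring R" "ring S" "f \<in> ring_hom R S" "f ` carrier R = carrier S" "ideal I R"
  shows "ideal (f ` I) S"
proof (rule idealI[OF assms(2)])
  interpret ring_hom_ring R S f by (rule ring_hom_ringI2[OF assms(1-3)])
  interpret I: ideal I R by (rule assms(5))
  show "subgroup (f ` I) (add_monoid S)"
    using group_hom.subgroup_img_is_subgroup[OF a_group_hom I.a_subgroup] by simp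
  fix a x assume "a \<in> f ` I" "x \<in> carrier S"
  then obtain b y where "b \<in> I" "a = f b" "y \<in> carrier R" "x = f y" using assms(4) by blast
  then show "x \<otimes>\<^bsub>S\<^esub> a \<in> f ` I" "a \<otimes>\<^bsub>S\<^esub> x \<in> f ` I"
    using I.I_l_closed I.I_r_closed I.a_subset by (auto simp flip: hom_mult intro!: imageI)
qed

text \<open>
  The image of \<open>realization_kernel\<close> in \<open>\<G>\<^sup>f\<close> is an ideal that contains the classes of the mixed words,
  hence all of \<open>N_ideal\<close>; and \<open>realization_kernel\<close> contains \<open>swap_ideal\<close>, so membership of a class in
  this image does not depend on the representative.
\<close>

lemma zeta_ideal_subset: "zeta_ideal \<subseteq> realization_kernel"
proof
  fix p assume "p \<in> zeta_ideal"
  then have p: "p \<in> carrier QA" "Zf_proj (Gf_class p) = \<zero>\<^bsub>Zf\<^esub>" by (simp_all add: zeta_ideal_def)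
  have surj: "Gf_class ` carrier QA = carrier Gf"
    unfolding Gf_class_def[abs_def] Gf_def FactRing_def by (auto simp: A_RCOSETS_def')
  have "N_ideal \<subseteq> Gf_class ` realization_kernel"
    unfolding N_ideal_def
  proof (rule ring.genideal_minimal[OF cring.axioms(1)[OF cring_Gf]])
    show "ideal (Gf_class ` realization_kernel) Gf"
      by (rule ideal_surjective_image[OF cring.axioms(1)[OF cring_QA] cring.axioms(1)[OF cring_Gf]
            Gf_class_hom surj ideal_realization_kernel])
    show "{Gf_class (word w) | w. w \<in> lists biletters - {u @ v | u v. u \<in> lists biletters_1 \<and> v \<in> lists biletters_0}}
        \<subseteq> Gf_class ` realization_kernel"
      unfolding mixed_words_def[symmetric]
    proof clarify
      fix w assume w: "w \<in> mixed_words"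
      then have "word w \<in> realization_kernel"
        using realization_mixed[OF w] qsubspace_0[OF qsubspace_eds]
        by (simp add: realization_kernel_def carrier_stuffle_alg mixed_words_def)
      then show "Gf_class (word w) \<in> Gf_class ` realization_kernel" by blast
    qed
  qed
  moreover have "Gf_class p \<in> N_ideal"
    using p(2) quotient_zero_iff[OF ideal_N ring_hom_closed[OF Gf_class_hom p(1)]]
    unfolding Zf_proj_def Zf_def by simp
  ultimately obtain q where q: "q \<in> realization_kernel" "Gf_class p = Gf_class q" by blast
  have qc: "q \<in> carrier QA" using q(1) by (simp add: realization_kernel_def)
  interpret swap: ideal swap_ideal QA by (rule ideal_swap)
  have "p \<in> swap_ideal +>\<^bsub>QA\<^esub> q"
    using swap.a_rcos_self[OF p(1)] q(2) unfolding Gf_class_def by simp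
  then obtain s where "s \<in> swap_ideal" "p = s \<oplus>\<^bsub>QA\<^esub> q"
    unfolding a_r_coset_def' by blast
  then show "p \<in> realization_kernel"
    using swap_ideal_subset q(1)
      additive_subgroup.a_closed[OF ideal.axioms(1)[OF ideal_realization_kernel]] by blast
qed

theorem theorem2p17:
  shows "zeta_hom \<in> ring_hom H1 Zf \<and>
    (\<forall>ks \<in> lists {1..}. zeta_hom (word ks) = formal_zeta ks) \<and>
    a_kernel H1 Zf zeta_hom =
      Idl\<^bsub>H1\<^esub> {stuffle w v - H1_shuffle w v | w v. w \<in> carrier H1 \<and> v \<in> H0}"
proof (intro conjI ballI)
  show "zeta_hom \<in> ring_hom H1 Zf" by (rule zeta_hom_ring_hom)
  show "zeta_hom (word ks) = formal_zeta ks" for ks by (rule zeta_hom_word)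
  have kernel: "a_kernel H1 Zf zeta_hom = {p \<in> carrier H1. H1_to_QA p \<in> zeta_ideal}"
    unfolding a_kernel_def' zeta_ideal_def zeta_hom_def
    using ring_hom_closed[OF H1_to_QA_hom] by blast
  have "a_kernel H1 Zf zeta_hom = eds_ideal"
  proof
    show "a_kernel H1 Zf zeta_hom \<subseteq> eds_ideal"
    proof
      fix p assume "p \<in> a_kernel H1 Zf zeta_hom"
      then have "H1_to_QA p \<in> realization_kernel"
        using zeta_ideal_subset unfolding kernel by blast
      then show "p \<in> eds_ideal" by (simp add: realization_kernel_def realization_H1_to_QA)
    qed
    interpret zeta: ring_hom_ring H1 Zf zeta_hom
      by (rule ring_hom_ringI2[OF cring.axioms(1)[OF cring_H1] cring.axioms(1)[OF cring_Zf] zeta_hom_ring_hom])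
    show "eds_ideal \<subseteq> a_kernel H1 Zf zeta_hom"
      unfolding eds_ideal_def
    proof (rule ring.genideal_minimal[OF cring.axioms(1)[OF cring_H1] zeta.kernel_is_ideal])
      show "{stuffle w v - H1_shuffle w v | w v. w \<in> carrier H1 \<and> v \<in> H0} \<subseteq> a_kernel H1 Zf zeta_hom"
        using eds_generators_in_H1 double_shuffle_in_zeta_ideal unfolding kernel by blast
    qed
  qed
  then show "a_kernel H1 Zf zeta_hom =
      Idl\<^bsub>H1\<^esub> {stuffle w v - H1_shuffle w v | w v. w \<in> carrier H1 \<and> v \<in> H0}"
    by (simp only: eds_ideal_def)
qed

end
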